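(* Let $T>0$, $\beta\in(0,1)$, let $H\colon[0,T]\times\mathbb{R}^d\times\mathbb{R}^d\to\mathbb{R}$, and let $\mathcal{L}$ be a Lévy operator with triplet $(A,0,\mu)$ and heat kernel $p_t$. Assume: (1) $p_t\in C_b^\infty(\mathbb{R}^d)$ and there exist $\alpha\in(1,2]$ and $c_0>0$ such that $\int_{\mathbb{R}^d}|Dp_t(y)|\,dy\le c_0t^{-1/\alpha}$ for all $t\in(0,T]$; moreover $\alpha+\beta\in(1,2)\cup(2,3)$; (2) $A=0$ and there is $c>0$ such that for all $r\in(0,1)$: $$r^{-\beta}\int_{B_r}|y|^{\alpha+\beta}\,d\mu(y)+r^{\alpha-1}\int_{B_1\setminus B_r}|y|\,d\mu(y)\le c\quad\text{if }\alpha+\beta\in(1,2),$$ $$r^{\alpha-2}\int_{B_r}|y|^2\,d\mu(y)+r^{1-\beta}\int_{B_1\setminus B_r}|y|^{\alpha+\beta-1}\,d\mu(y)\le c\quad\text{if }\alpha+\beta\in(2,3);$$ (3) $H$ is continuous, there is $H_0>0$ with $|H(t,x,0)|\le H_0$ for all $t\in(0,T)$, $x\in\mathbb{R}^d$, and for each $R>0$ there is $L_R>0$ such that $|H(t,x,p)-H(t,x,q)|\le L_R|p-q|$ for all $t\in(0,T)$, $x\in\mathbb{R}^d$, $p,q\in B(0,R)$; (4) for each $R>0$ there is $M_R>0$ such that $|H(t,x,p)-H(t,x',p)|\le M_R|x-x'|^\beta$ for all $t\in[0,T]$, $p\in B(0,R)$ and $x,x'\in\mathbb{R}^d$ with $|x-x'|<1$;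 (5) for each $R>0$ there is $K_R>0$ such that $|H(t_2,x,p)-H(t_1,x,p)|\le K_R|t_2-t_1|^{\beta/\alpha}$ for all $t_1,t_2\in[0,T]$ with $|t_2-t_1|<1$, $x\in\mathbb{R}^d$, $p\in B(0,R)$; (6) $u_0\in C_b^{\alpha+\beta}(\mathbb{R}^d)$. Let $u\in C_b((0,T];C_b^1(\mathbb{R}^d))$ be a mild solution of $\partial_tu-\mathcal{L}u-H(t,x,Du)=0$ in $(0,T]\times\mathbb{R}^d$, $u(0,\cdot)=u_0$. Then $$\sup_{x\in\mathbb{R}^d}\|u(\cdot,x)\|_{C_b^{1+\frac\beta\alpha}([0,T])}\le C\Big(\sup_{t\in[0,T]}\|u(t,\cdot)\|_{C_b^{\alpha+\beta}}+1\Big),$$ where $C$ depends only on $d,\alpha,\beta,T,\|Du\|_\infty$, $H$ and $\mathcal{L}$.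
   Context: Lévy operator: $A$ is a nonnegative definite real symmetric $d\times d$ matrix, $\mu\ge 0$ is a Borel measure on $\mathbb{R}^d\setminus\{0\}$ with $\int(1\wedge|z|^2)\,d\mu(z)<\infty$, and $$\mathcal{L}\varphi(x)=\operatorname{div}(AD\varphi(x))+\int_{\mathbb{R}^d}\big[\varphi(x+z)-\varphi(x)-\mathbf{1}_{|z|<1}D\varphi(x)\cdot z\big]\,d\mu(z).$$ Heat kernel: $p_t$, $t>0$, are the probability measures with $\int e^{-i\xi\cdot x}p_t(dx)=e^{-t\psi(\xi)}$, where $\psi(\xi)=\xi\cdot A\xi+\int(1-e^{i\xi\cdot z}+i\xi\cdot z\mathbf{1}_{|z|<1})\,d\mu(z)$; they are assumed absolutely continuous with density again denoted $p_t$. Semigroup: $P_t\varphi=p_t*\varphi$. $B_r=B(0,r)$. Hölder spaces: $C_b^n$ has norm $\sum_{j\le n}\max_{|\kappa|=j}\|\partial^\kappa\varphi\|_\infty$; for $\gamma=n+\beta'$ with $\beta'\in(0,1)$, $\|\varphi\|_{C_b^\gamma}=\|\varphi\|_{C_b^n}+\max_{|\kappa|=n}[\partial^\kappa\varphi]_{\beta'}$ with $[\cdot]_{\beta'}$ the usual global Hölder seminorm; analogously on $[0,T]$. $D$ is the spatial gradient; $\|Du\|_\infty$ is the supremum over $(0,T]\times\mathbb{R}^d$; $C_b((0,T];X)$ denotes bounded continuous functions from $(0,T]$ to $X$. Mild solution: $u\in C((0,T];C_b^1(\mathbb{R}^d))$ such that for all $t\in(0,T]$, $x\in\mathbb{R}^d$,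 $$u(t,x)=P_t[u_0](x)+\int_0^tP_{t-s}\big[H(s,\cdot,Du(s,\cdot))\big](x)\,ds;$$ one sets $u(0,\cdot)=u_0$. *)

theory Defs
  imports "HOL-Probability.Probability"
begin

text \<open>
  Hoelder norms are given values in \<open>[0, \<infinity>]\<close>: the norm of a function outside the space is
  \<open>\<infinity>\<close>, so membership in the space is finiteness of the norm. Everything is relative to a set
  \<open>S\<close> on which derivatives are taken; only \<open>S = UNIV\<close> and \<open>S = {0..T}\<close> (one-sided derivatives
  at the end points) are used.
\<close>

definition partial_deriv :: "'a::euclidean_space set \<Rightarrow> 'a \<Rightarrow> ('a \<Rightarrow> real) \<Rightarrow> 'a \<Rightarrow> real" where
  "partial_deriv S b f x = frechet_derivative f (at x within S) b"

primrec Ck_on :: "nat \<Rightarrow> 'a::euclidean_space set \<Rightarrow> ('a \<Rightarrow> real) \<Rightarrow> bool" where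
  "Ck_on 0 S f \<longleftrightarrow> continuous_on S f"
| "Ck_on (Suc n) S f \<longleftrightarrow> f differentiable_on S \<and> (\<forall>b\<in>Basis. Ck_on n S (partial_deriv S b f))"

text \<open>
  A multi-index of order \<open>j\<close> is represented by a word of \<open>j\<close> coordinate directions. Distinct words
  may represent the same multi-index; for functions of class \<open>C\<^sup>j\<close> the order of differentiation is
  irrelevant, so maxima over words and over multi-indices agree.
\<close>

definition index_words :: "nat \<Rightarrow> 'a::euclidean_space list set" where
  "index_words j = {w. set w \<subseteq> Basis \<and> length w = j}"

definition multi_deriv :: "'a::euclidean_space set \<Rightarrow> 'a list \<Rightarrow> ('a \<Rightarrow> real) \<Rightarrow> 'a \<Rightarrow> real" where
  "multi_deriv S w f = foldr (partial_deriv S) w f"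

definition sup_norm :: "'a set \<Rightarrow> ('a \<Rightarrow> real) \<Rightarrow> ennreal" where
  "sup_norm S g = (SUP x\<in>S. ennreal \<bar>g x\<bar>)"

definition holder_seminorm :: "real \<Rightarrow> 'a::metric_space set \<Rightarrow> ('a \<Rightarrow> real) \<Rightarrow> ennreal" where
  "holder_seminorm b S g =
     (SUP x\<in>S. SUP y\<in>S - {x}. ennreal (\<bar>g x - g y\<bar> / dist x y powr b))"

definition Cbn_norm :: "nat \<Rightarrow> 'a::euclidean_space set \<Rightarrow> ('a \<Rightarrow> real) \<Rightarrow> ennreal" where
  "Cbn_norm n S f =
     (if Ck_on n S f then \<Sum>j\<le>n. SUP w\<in>index_words j. sup_norm S (multi_deriv S w f) else \<infinity>)"

definition Cb_norm :: "real \<Rightarrow> 'a::euclidean_space set \<Rightarrow> ('a \<Rightarrow> real) \<Rightarrow> ennreal" where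
  "Cb_norm \<gamma> S f =
     (let n = nat \<lfloor>\<gamma>\<rfloor>; b = frac \<gamma> in
      if b = 0 then Cbn_norm n S f
      else Cbn_norm n S f + (SUP w\<in>index_words n. holder_seminorm b S (multi_deriv S w f)))"

definition Cb :: "real \<Rightarrow> 'a::euclidean_space set \<Rightarrow> ('a \<Rightarrow> real) set" where
  "Cb \<gamma> S = {f. Cb_norm \<gamma> S f < \<infinity>}"

definition Cb_infinity :: "('a::euclidean_space \<Rightarrow> real) set" where
  "Cb_infinity = (\<Inter>n. Cb (real n) UNIV)"

text \<open>\<open>C((0,T]; C\<^sub>b\<^sup>1)\<close> and \<open>C\<^sub>b((0,T]; C\<^sub>b\<^sup>1)\<close>, with norm continuity in time.\<close>

definition C_Cb1 :: "real \<Rightarrow> (real \<Rightarrow> 'a::euclidean_space \<Rightarrow> real) set" where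
  "C_Cb1 T = {u. (\<forall>t\<in>{0<..T}. u t \<in> Cb 1 UNIV) \<and>
     (\<forall>t\<in>{0<..T}. ((\<lambda>s. Cb_norm 1 UNIV (\<lambda>x. u s x - u t x)) \<longlongrightarrow> 0) (at t within {0<..T}))}"

definition Cb_Cb1 :: "real \<Rightarrow> (real \<Rightarrow> 'a::euclidean_space \<Rightarrow> real) set" where
  "Cb_Cb1 T = {u \<in> C_Cb1 T. (SUP t\<in>{0<..T}. Cb_norm 1 UNIV (u t)) < \<infinity>}"

definition grad :: "(real^'d \<Rightarrow> real) \<Rightarrow> real^'d \<Rightarrow> real^'d" where
  "grad f x = (\<chi> i. partial_deriv UNIV (axis i 1) f x)"

definition divergence :: "(real^'d \<Rightarrow> real^'d) \<Rightarrow> real^'d \<Rightarrow> real" where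
  "divergence F x = (\<Sum>i\<in>UNIV. partial_deriv UNIV (axis i 1) (\<lambda>y. F y $ i) x)"

text \<open>A measure on \<open>\<real>\<^sup>d\<close> without the origin is identified with its extension by zero.\<close>

definition levy_measure :: "(real^'d) measure \<Rightarrow> bool" where
  "levy_measure \<mu> \<longleftrightarrow> sets \<mu> = sets borel \<and> emeasure \<mu> {0} = 0 \<and>
     (\<integral>\<^sup>+ z. ennreal (min 1 ((norm z)\<^sup>2)) \<partial>\<mu>) < \<infinity>"

text \<open>\<open>L\<close> is the Levy operator with triplet \<open>(A, 0, \<mu>)\<close>; the formula is imposed on \<open>C\<^sub>b\<^sup>2\<close>.\<close>

definition levy_operator ::
    "real^'d^'d \<Rightarrow> (real^'d) measure \<Rightarrow> ((real^'d \<Rightarrow> real) \<Rightarrow> real^'d \<Rightarrow> real) \<Rightarrow> bool" where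
  "levy_operator A \<mu> L \<longleftrightarrow>
     transpose A = A \<and> (\<forall>\<xi>. 0 \<le> \<xi> \<bullet> (A *v \<xi>)) \<and> levy_measure \<mu> \<and>
     (\<forall>\<phi>\<in>Cb 2 UNIV. \<forall>x. L \<phi> x =
        divergence (\<lambda>y. A *v grad \<phi> y) x
        + (LINT z|\<mu>. \<phi> (x + z) - \<phi> x - indicator (ball 0 1) z * (grad \<phi> x \<bullet> z)))"

definition levy_symbol :: "real^'d^'d \<Rightarrow> (real^'d) measure \<Rightarrow> real^'d \<Rightarrow> complex" where
  "levy_symbol A \<mu> \<xi> = of_real (\<xi> \<bullet> (A *v \<xi>))
     + (LINT z|\<mu>. 1 - cis (\<xi> \<bullet> z) + \<i> * of_real (\<xi> \<bullet> z * indicator (ball 0 1) z))"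

definition heat_kernel ::
    "real^'d^'d \<Rightarrow> (real^'d) measure \<Rightarrow> (real \<Rightarrow> real^'d \<Rightarrow> real) \<Rightarrow> bool" where
  "heat_kernel A \<mu> p \<longleftrightarrow> (\<forall>t>0.
     p t \<in> borel_measurable borel \<and> (\<forall>x. 0 \<le> p t x) \<and>
     (let P = density lborel (\<lambda>x. ennreal (p t x)) in
        prob_space P \<and>
        (\<forall>\<xi>. (LINT x|P. cis (- (\<xi> \<bullet> x))) = exp (- (of_real t * levy_symbol A \<mu> \<xi>)))))"

definition semigroup_conv ::
    "(real \<Rightarrow> real^'d \<Rightarrow> real) \<Rightarrow> real \<Rightarrow> (real^'d \<Rightarrow> real) \<Rightarrow> real^'d \<Rightarrow> real" where
  "semigroup_conv p t \<phi> x = (LINT y|lborel. p t (x - y) * \<phi> y)"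

text \<open>
  The integrability clause says that the time integral in the Duhamel formula makes sense: elements
  of \<open>C((0,T]; C\<^sub>b\<^sup>1)\<close> may blow up as \<open>t\<close> tends to \<open>0\<close>, and the Bochner integral of a non-integrable
  function is \<open>0\<close> by convention.
\<close>

definition mild_solution ::
    "real \<Rightarrow> (real \<Rightarrow> real^'d \<Rightarrow> real) \<Rightarrow> (real \<Rightarrow> real^'d \<Rightarrow> real^'d \<Rightarrow> real) \<Rightarrow>
     (real^'d \<Rightarrow> real) \<Rightarrow> (real \<Rightarrow> real^'d \<Rightarrow> real) \<Rightarrow> bool" where
  "mild_solution T p H u0 u \<longleftrightarrow>
     u \<in> C_Cb1 T \<and> u 0 = u0 \<and>
     (\<forall>t\<in>{0<..T}. \<forall>x.
        set_integrable lborel {0<..<t}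
          (\<lambda>s. semigroup_conv p (t - s) (\<lambda>y. H s y (grad (u s) y)) x) \<and>
        u t x = semigroup_conv p t u0 x
          + (LINT s:{0<..<t}|lborel. semigroup_conv p (t - s) (\<lambda>y. H s y (grad (u s) y)) x))"

text \<open>
  A real supremum, which is meaningful for \<open>u \<in> Cb_Cb1 T\<close> with \<open>T > 0\<close>, where the gradients
  are uniformly bounded.
\<close>

definition grad_sup :: "real \<Rightarrow> (real \<Rightarrow> real^'d \<Rightarrow> real) \<Rightarrow> real" where
  "grad_sup T u = (SUP (t, x)\<in>{0<..T} \<times> UNIV. norm (grad (u t) x))"

end

theory Submission
  imports Defs
begin

text \<open>
  The idea is that a mild solution which is bounded in \<open>C\<^sub>b\<^sup>\<gamma>\<close>, \<open>\<gamma> = \<alpha> + \<beta>\<close>, is in fact classical: with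
  \<open>h = H(s, y, Du) + L u\<close> one has \<open>u(t, y) = u(0, y) + \<integral>\<^sub>0\<^sup>t h(s, y) ds\<close> (lemma \<open>strong_form\<close>). Then \<open>h\<close> is
  the time derivative of \<open>u\<close>, and everything reduces to bounding \<open>h\<close> and its modulus of continuity in time.

  To get from the Duhamel formula to the integral equation, it suffices to convolve both sides in space
  with every Gaussian \<open>G\<close>, because Gaussians form an approximate identity. A Gaussian is a superposition
  \<open>\<integral> exp(i y \<bullet> \<xi>) d\<Gamma>(\<xi>)\<close> of characters, and both the semigroup and \<open>L\<close> act on a character by a
  multiplier, \<open>exp(-t \<psi>(\<xi>))\<close> and \<open>-\<psi>(\<xi>)\<close>. So \<open>P\<^sub>t G - G = \<integral>\<^sub>0\<^sup>t P\<^sub>s (L G) ds\<close> is the fundamental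
  theorem of calculus for \<open>exp(-t \<psi>)\<close> (lemma \<open>Dynkin_gaussian\<close>). Convolving the Duhamel formula
  with \<open>G\<close> and with \<open>L G\<close>, integrating the second identity in time and applying Fubini gives
  \<open>G * u(t) = G * u(0) + \<integral>\<^sub>0\<^sup>t (G * f(s) + (L G) * u(s)) ds\<close> (lemma \<open>mollified_equation\<close>); finally \<open>L\<close> is
  moved from \<open>G\<close> to \<open>u(s)\<close>, which is smooth enough for that (lemma \<open>gaussian_jumps_adjoint\<close>).

  The quantitative part is an interpolation. Splitting the jumps at \<open>|z| = |x - y|\<close>, the conditions on \<open>\<mu>\<close>
  show that \<open>L\<close> maps \<open>C\<^sub>b\<^sup>\<gamma>\<close> to \<open>C\<^sub>b\<^sup>\<beta>\<close> (lemma \<open>regular_levy_int_Holder\<close>). So \<open>h(s, .)\<close> is bounded in \<open>C\<^sub>b\<^sup>\<beta>\<close>, and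
  the increment \<open>w = u(t) - u(s)\<close> is of size \<open>|t - s|\<close> in \<open>C\<^sub>b\<^sup>\<beta>\<close> and of size one in \<open>C\<^sub>b\<^sup>\<gamma>\<close>. At the scale
  \<open>r = |t - s|\<^bsup>1/\<alpha>\<^esup>\<close> the two bounds balance: \<open>|Dw|\<close> is at most of order \<open>r\<^bsup>\<gamma>-1\<^esup>\<close> and \<open>|L w|\<close>, splitting the
  jumps at \<open>|z| = r\<close>, of order \<open>r\<^bsup>\<beta>\<^esup> = |t - s|\<^bsup>\<beta>/\<alpha>\<^esup>\<close> (lemmas \<open>interpolate_gradient\<close> and
  \<open>interpolate_levy_int\<close>). The sup norm of \<open>w\<close> in place of its \<open>C\<^sub>b\<^sup>\<beta>\<close> norm would only give a smaller power
  for \<open>|Dw|\<close>. With the regularity of \<open>H\<close> in \<open>t\<close> and \<open>p\<close> this is the asserted Hoelder bound on \<open>h\<close>. All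
  estimates are affine in the supremum of the \<open>C\<^sub>b\<^sup>\<gamma>\<close> norms, as required.
\<close>

section \<open>Measurability, Fubini and convolutions\<close>

abbreviation conv :: "(real^'d \<Rightarrow> real) \<Rightarrow> (real^'d \<Rightarrow> real) \<Rightarrow> real^'d \<Rightarrow> real" where
  "conv J \<phi> x \<equiv> (LINT y|lborel. J (x - y) * \<phi> y)"

abbreviation time_int :: "real \<Rightarrow> (real \<Rightarrow> real) \<Rightarrow> real" where
  "time_int t h \<equiv> (LINT s|lborel. indicator {0<..<t} s * h s)"

text \<open>
  Integrability on the product follows from an integrable bound on the \<open>L\<^sup>1\<close> norms of the sections. In
  this form Fubini's theorem is applied to signed and complex integrands throughout.
\<close>

lemma (in pair_sigma_finite) Fubini_bounded_sections:
  fixes f :: "'a \<Rightarrow> 'b \<Rightarrow> 'c::{banach, second_countable_topology}"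
  assumes meas: "case_prod f \<in> borel_measurable (M1 \<Otimes>\<^sub>M M2)"
    and sect: "\<And>x. x \<in> space M1 \<Longrightarrow> (\<integral>\<^sup>+y. ennreal (norm (f x y)) \<partial>M2) \<le> ennreal (b x)"
    and b: "integrable M1 b"
  shows "integrable (M1 \<Otimes>\<^sub>M M2) (case_prod f)"
    and "(\<integral>y. (\<integral>x. f x y \<partial>M1) \<partial>M2) = (\<integral>x. (\<integral>y. f x y \<partial>M2) \<partial>M1)"
proof -
  have "(\<integral>\<^sup>+ z. ennreal (norm (case_prod f z)) \<partial>(M1 \<Otimes>\<^sub>M M2))
      = (\<integral>\<^sup>+ x. (\<integral>\<^sup>+ y. ennreal (norm (f x y)) \<partial>M2) \<partial>M1)"
    using meas by (subst M2.nn_integral_fst [symmetric]) auto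
  also have "\<dots> \<le> (\<integral>\<^sup>+ x. ennreal (b x) \<partial>M1)"
    by (intro nn_integral_mono sect)
  also have "\<dots> \<le> (\<integral>\<^sup>+ x. ennreal (norm (b x)) \<partial>M1)"
    by (intro nn_integral_mono) (auto intro: ennreal_leI)
  also have "\<dots> < \<infinity>" using b unfolding integrable_iff_bounded by simp
  finally show int: "integrable (M1 \<Otimes>\<^sub>M M2) (case_prod f)"
    using meas by (intro integrableI_bounded) auto
  show "(\<integral>y. (\<integral>x. f x y \<partial>M1) \<partial>M2) = (\<integral>x. (\<integral>y. f x y \<partial>M2) \<partial>M1)"
    by (rule Fubini_integral[OF int])
qed

text \<open>
  Joint measurability of Caratheodory functions: evaluating at a point rounded to a finer and finer grid
  involves only countably many second arguments. The mild formulation provides measurability in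
  time for each point only, and the heat kernel is only given for each time separately, so joint
  measurability has to come from continuity in space.
\<close>

lemma Caratheodory_measurable:
  fixes F :: "'a \<Rightarrow> real^'d \<Rightarrow> 'b::metric_space"
  assumes meas: "\<And>y. (\<lambda>s. F s y) \<in> borel_measurable M"
    and cont: "\<And>s. s \<in> space M \<Longrightarrow> continuous_on UNIV (F s)"
  shows "(\<lambda>z. F (fst z) (snd z)) \<in> borel_measurable (M \<Otimes>\<^sub>M borel)"
proof -
  \<comment> \<open>The rounding of \<open>y\<close> to the grid of mesh \<open>1 / (n + 1)\<close>.\<close>
  define r :: "nat \<Rightarrow> real^'d \<Rightarrow> real^'d" where
    "r n y = (\<chi> i. of_int \<lfloor>real (Suc n) * y $ i\<rfloor> / real (Suc n))" for n y
  have r_meas [measurable]: "(\<lambda>z. (\<chi> i. \<lfloor>real (Suc n) * snd z $ i\<rfloor>) :: int^'d) \<in> M \<Otimes>\<^sub>M borel \<rightarrow>\<^sub>M count_space UNIV" for n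
  proof -
    let ?g = "(\<lambda>z. (\<chi> i. \<lfloor>real (Suc n) * snd z $ i\<rfloor>) :: int^'d) :: 'a \<times> (real^'d) \<Rightarrow> int^'d"
    have m: "(\<lambda>z :: 'a \<times> (real^'d). \<lfloor>real (Suc n) * snd z $ i\<rfloor>) \<in> M \<Otimes>\<^sub>M borel \<rightarrow>\<^sub>M count_space UNIV" for i
    proof -
      have "(\<lambda>y :: real^'d. y $ i) \<in> borel_measurable borel"
        by (intro borel_measurable_continuous_onI continuous_intros)
      from this [measurable] show ?thesis by measurable
    qed
    have "?g -` {k} \<inter> space (M \<Otimes>\<^sub>M borel) \<in> sets (M \<Otimes>\<^sub>M borel)" for k
    proof -
      have "?g -` {k} \<inter> space (M \<Otimes>\<^sub>M borel)
        = {z \<in> space (M \<Otimes>\<^sub>M borel). \<forall>i\<in>UNIV. \<lfloor>real (Suc n) * snd z $ i\<rfloor> = k $ i}"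
        by (auto simp: vec_eq_iff)
      also have "\<dots> \<in> sets (M \<Otimes>\<^sub>M borel)" using m by measurable
      finally show ?thesis .
    qed
    then show ?thesis by (subst measurable_count_space_eq_countable) auto
  qed
  have lim: "(\<lambda>n. r n y) \<longlonglongrightarrow> y" for y
  proof (rule vec_tendstoI)
    fix i
    have b: "\<bar>of_int \<lfloor>real (Suc n) * y $ i\<rfloor> / real (Suc n) - y $ i\<bar> \<le> 1 / real (Suc n)" for n
    proof -
      have "\<bar>of_int \<lfloor>real (Suc n) * y $ i\<rfloor> - real (Suc n) * y $ i\<bar> \<le> 1" by linarith
      moreover have "of_int \<lfloor>real (Suc n) * y $ i\<rfloor> / real (Suc n) - y $ i
        = (of_int \<lfloor>real (Suc n) * y $ i\<rfloor> - real (Suc n) * y $ i) / real (Suc n)"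
        by (simp add: diff_divide_distrib del: of_nat_Suc)
      ultimately show ?thesis by (simp add: abs_divide divide_right_mono del: of_nat_Suc)
    qed
    have "(\<lambda>n. of_int \<lfloor>real (Suc n) * y $ i\<rfloor> / real (Suc n) - y $ i) \<longlonglongrightarrow> 0"
      by (rule Lim_null_comparison[where g = "\<lambda>n. 1 / real (Suc n)"])
         (use b LIMSEQ_inverse_real_of_nat in \<open>auto simp: inverse_eq_divide\<close>)
    then show "(\<lambda>n. r n y $ i) \<longlonglongrightarrow> y $ i" unfolding r_def by (simp add: LIM_zero_iff del: of_nat_Suc)
  qed
  have step: "(\<lambda>z. F (fst z) (r n (snd z))) \<in> borel_measurable (M \<Otimes>\<^sub>M borel)" for n
    unfolding r_def
    using measurable_compose_countable'[where I = UNIV and g = "\<lambda>z. (\<chi> i. \<lfloor>real (Suc n) * snd z $ i\<rfloor>) :: int^'d"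
        and f = "\<lambda>k z. F (fst z) (\<chi> i. of_int (k $ i) / real (Suc n))" and M = "M \<Otimes>\<^sub>M borel" and N = borel,
        OF measurable_compose[OF measurable_fst meas] r_meas]
    by simp
  show ?thesis
  proof (rule borel_measurable_LIMSEQ_metric[OF step])
    fix z assume "z \<in> space (M \<Otimes>\<^sub>M (borel :: (real^'d) measure))"
    then have "fst z \<in> space M" by (auto simp: space_pair_measure)
    then have "isCont (F (fst z)) (snd z)"
      using cont continuous_on_eq_continuous_at open_UNIV by blast
    then show "(\<lambda>n. F (fst z) (r n (snd z))) \<longlonglongrightarrow> F (fst z) (snd z)"
      using lim isCont_tendsto_compose by blast
  qed
qed

lemma lborel_reflect: "lborel = distr lborel borel (\<lambda>y. x - y :: 'a::euclidean_space)"
  using lborel_affine[of "-1" x] by (simp add: density_1)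

lemma lborel_translate: "lborel = distr lborel borel (\<lambda>y. x + y :: 'a::euclidean_space)"
  using lborel_affine[of "1" x] by (simp add: density_1)

lemma integral_reflect:
  fixes f :: "'a::euclidean_space \<Rightarrow> 'b::{banach, second_countable_topology}"
  assumes [measurable]: "f \<in> borel_measurable borel"
  shows "(LINT y|lborel. f (x - y)) = (LINT y|lborel. f y)"
  by (subst (2) lborel_reflect[of x]) (simp add: integral_distr)

lemma integrable_reflect:
  fixes f :: "'a::euclidean_space \<Rightarrow> 'b::{banach, second_countable_topology}"
  assumes [measurable]: "f \<in> borel_measurable borel"
  shows "integrable lborel (\<lambda>y. f (x - y)) \<longleftrightarrow> integrable lborel f"
  by (subst (2) lborel_reflect[of x]) (simp add: integrable_distr_eq)

lemma nn_integral_reflect: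
  fixes f :: "'a::euclidean_space \<Rightarrow> ennreal"
  assumes [measurable]: "f \<in> borel_measurable borel"
  shows "(\<integral>\<^sup>+y. f (x - y) \<partial>lborel) = (\<integral>\<^sup>+y. f y \<partial>lborel)"
  by (subst (2) lborel_reflect[of x]) (simp add: nn_integral_distr)

lemma integral_translate:
  fixes f :: "'a::euclidean_space \<Rightarrow> 'b::{banach, second_countable_topology}"
  assumes [measurable]: "f \<in> borel_measurable borel"
  shows "(LINT y|lborel. f (x + y)) = (LINT y|lborel. f y)"
  by (subst (2) lborel_translate[of x]) (simp add: integral_distr)

lemma nn_integral_translate:
  fixes f :: "'a::euclidean_space \<Rightarrow> ennreal"
  assumes [measurable]: "f \<in> borel_measurable borel"
  shows "(\<integral>\<^sup>+y. f (x + y) \<partial>lborel) = (\<integral>\<^sup>+y. f y \<partial>lborel)"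
  by (subst (2) lborel_translate[of x]) (simp add: nn_integral_distr)

section \<open>Gaussians\<close>

lemma cis_measurable [measurable]: "cis \<in> borel_measurable borel"
  by (intro borel_measurable_continuous_onI continuous_on_cis continuous_on_id)

definition gaussian :: "real \<Rightarrow> real^'d \<Rightarrow> real" where
  "gaussian a y = exp (- a / 2 * (norm y)\<^sup>2)"

lemma gaussian_measurable [measurable]: "gaussian a \<in> borel_measurable borel"
  unfolding gaussian_def by measurable

lemma gaussian_pos: "0 < gaussian a y"
  unfolding gaussian_def by simp

lemma gaussian_integrable:
  fixes a :: real
  assumes "a > 0"
  shows "integrable lborel (gaussian a :: real^'d \<Rightarrow> real)"
proof (rule integrableI_bounded)
  have eq: "gaussian a y = (\<Prod>b\<in>Basis. exp (- a / 2 * (y \<bullet> b)\<^sup>2))" for y :: "real^'d"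
  proof -
    have "(norm y)\<^sup>2 = (\<Sum>b\<in>Basis. (y \<bullet> b)\<^sup>2)"
      unfolding power2_norm_eq_inner by (subst euclidean_inner) (simp add: power2_eq_square)
    then show ?thesis unfolding gaussian_def by (simp add: exp_sum[symmetric] sum_distrib_left)
  qed
  have one: "(\<integral>\<^sup>+x. ennreal (exp (- a / 2 * x\<^sup>2)) \<partial>lborel) < \<infinity>"
  proof -
    define s where "s = 1 / sqrt a"
    have s: "s > 0" and s2: "s\<^sup>2 = 1 / a" using assms by (auto simp: s_def power_divide)
    have eq: "exp (- a / 2 * x\<^sup>2) = sqrt (2 * pi * s\<^sup>2) * normal_density 0 s x" for x
      using s assms unfolding normal_density_def s2 by (simp add: field_simps)
    have "integrable lborel (\<lambda>x. exp (- a / 2 * x\<^sup>2))"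
      unfolding eq using s by (intro integrable_mult_right integrable_normal_density)
    then show ?thesis unfolding integrable_iff_bounded by simp
  qed
  have "(\<integral>\<^sup>+y. ennreal (norm (gaussian a (y :: real^'d))) \<partial>lborel)
     = (\<integral>\<^sup>+y. (\<Prod>b\<in>Basis. ennreal (exp (- a / 2 * (y \<bullet> b)\<^sup>2))) \<partial>(lborel :: (real^'d) measure))"
    by (subst prod_ennreal) (auto simp: eq abs_prod)
  also have "\<dots> = (\<Prod>b\<in>(Basis::(real^'d) set). (\<integral>\<^sup>+x. ennreal (exp (- a / 2 * x\<^sup>2)) \<partial>lborel))"
    by (rule nn_integral_lborel_prod) auto
  also have "\<dots> < \<infinity>"
    using one by (simp add: power_less_top_ennreal)
  finally show "(\<integral>\<^sup>+y. ennreal (norm (gaussian a (y :: real^'d))) \<partial>lborel) < \<infinity>" .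
qed simp

text \<open>
  The spectral measure is again Gaussian: the law of \<open>sqrt a\<close> times a vector of independent
  standard normal variables. Its second moment is finite, which is what symbols of Levy operators
  require, as they grow at most quadratically.
\<close>

lemma gaussian_characters:
  fixes a :: real
  assumes a: "a > 0"
  obtains \<Gamma> :: "(real^'d) measure" where "prob_space \<Gamma>" "sets \<Gamma> = sets borel"
    "integrable \<Gamma> (\<lambda>\<xi>. (norm \<xi>)\<^sup>2)"
    "\<And>y. (LINT \<xi>|\<Gamma>. cis (y \<bullet> \<xi>)) = of_real (gaussian a y)"
proof -
  let ?N = "std_normal_distribution"
  interpret N: prob_space ?N by (rule prob_space_normal_density) simp
  define PP where "PP = (\<Pi>\<^sub>M i\<in>(UNIV::'d set). ?N)"
  interpret P: product_prob_space "\<lambda>_::'d. ?N" ..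
  have pp: "prob_space PP" unfolding PP_def by (rule prob_space_PiM) (rule N.prob_space_axioms)
  define X where "X \<omega> = (\<chi> i. sqrt a * \<omega> i)" for \<omega> :: "'d \<Rightarrow> real"
  have comp: "(\<lambda>\<omega>. \<omega> i) \<in> borel_measurable PP" for i
  proof -
    have "(\<lambda>\<omega>. \<omega> i) \<in> PP \<rightarrow>\<^sub>M ?N" unfolding PP_def by (rule measurable_component_singleton) simp
    then show ?thesis by (simp add: measurable_cong_sets[OF refl, of ?N borel])
  qed
  have X_meas [measurable]: "X \<in> borel_measurable PP"
  proof -
    have "X = (\<lambda>\<omega>. \<Sum>i\<in>UNIV. (sqrt a * \<omega> i) *\<^sub>R axis i 1)"
      unfolding X_def by (auto simp: vec_eq_iff axis_def if_distrib cong: if_cong)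
    also have "\<dots> \<in> borel_measurable PP" using comp by measurable
    finally show ?thesis .
  qed
  define \<Gamma> where "\<Gamma> = distr PP borel X"
  have "prob_space \<Gamma>" unfolding \<Gamma>_def by (rule prob_space.prob_space_distr[OF pp X_meas])
  moreover have "sets \<Gamma> = sets borel" by (simp add: \<Gamma>_def)
  moreover have "integrable \<Gamma> (\<lambda>\<xi>. (norm \<xi>)\<^sup>2)"
  proof -
    have 1: "integrable PP (\<lambda>\<omega>. (\<omega> i)\<^sup>2)" for i
    proof -
      have "integrable lborel (\<lambda>x. std_normal_density x * x^2)" by (rule integrable_std_normal_moment)
      then have "integrable ?N (\<lambda>x. x^2)" by (subst integrable_density) auto
      then have "integrable (distr PP ?N (\<lambda>\<omega>. \<omega> i)) (\<lambda>x. x^2)"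
        unfolding PP_def by (subst distr_PiM_component) (auto intro: N.prob_space_axioms)
      then show ?thesis using comp[of i]
        by (subst (asm) integrable_distr_eq) (auto simp: measurable_cong_sets[OF refl, of ?N borel])
    qed
    have "(norm (X \<omega>))\<^sup>2 = (\<Sum>i\<in>UNIV. a * (\<omega> i)\<^sup>2)" for \<omega>
    proof -
      have "(sqrt a * \<omega> i) * (sqrt a * \<omega> i) = a * (\<omega> i)\<^sup>2" for i
        using a by (simp add: power2_eq_square[symmetric] power_mult_distrib)
      then show ?thesis unfolding power2_norm_eq_inner by (simp add: X_def inner_vec_def)
    qed
    then have "integrable PP (\<lambda>\<omega>. (norm (X \<omega>))\<^sup>2)" using 1 by simp
    then show ?thesis unfolding \<Gamma>_def by (subst integrable_distr_eq) auto
  qed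
  moreover have "(LINT \<xi>|\<Gamma>. cis (y \<bullet> \<xi>)) = of_real (gaussian a y)" for y
  proof -
    have "(LINT \<xi>|\<Gamma>. cis (y \<bullet> \<xi>)) = (LINT \<omega>|PP. cis (y \<bullet> X \<omega>))"
      unfolding \<Gamma>_def by (rule integral_distr) auto
    also have "\<dots> = (LINT \<omega>|PP. (\<Prod>i\<in>UNIV. cis (y $ i * sqrt a * \<omega> i)))"
    proof (rule Bochner_Integration.integral_cong[OF refl])
      fix \<omega> :: "'d \<Rightarrow> real"
      have "y \<bullet> X \<omega> = (\<Sum>i\<in>UNIV. y $ i * sqrt a * \<omega> i)"
        by (simp add: X_def inner_vec_def algebra_simps)
      then show "cis (y \<bullet> X \<omega>) = (\<Prod>i\<in>UNIV. cis (y $ i * sqrt a * \<omega> i))"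
        by (simp add: cis_conv_exp sum_distrib_left exp_sum)
    qed
    also have "\<dots> = (\<Prod>i\<in>(UNIV::'d set). (LINT x|?N. cis (y $ i * sqrt a * x)))"
      unfolding PP_def
    proof (rule P.product_integral_prod)
      show "integrable ?N (\<lambda>x. cis (y $ i * sqrt a * x))" for i
        by (rule N.integrable_const_bound[where B = 1]) auto
    qed simp
    also have "\<dots> = (\<Prod>i\<in>(UNIV::'d set). complex_of_real (exp (- ((y $ i * sqrt a)\<^sup>2) / 2)))"
    proof (rule prod.cong[OF refl])
      fix i :: 'd
      have "(LINT x|?N. cis (y $ i * sqrt a * x)) = char ?N (y $ i * sqrt a)"
        by (simp add: char_def cis_conv_exp)
      then show "(LINT x|?N. cis (y $ i * sqrt a * x)) = complex_of_real (exp (- ((y $ i * sqrt a)\<^sup>2) / 2))"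
        by (simp add: char_std_normal_distribution)
    qed
    also have "\<dots> = of_real (gaussian a y)"
    proof -
      have n: "(norm y)\<^sup>2 = (\<Sum>i\<in>UNIV. (y $ i)\<^sup>2)"
        unfolding power2_norm_eq_inner by (simp add: inner_vec_def power2_eq_square)
      have "(\<Prod>i\<in>(UNIV::'d set). exp (- ((y $ i * sqrt a)\<^sup>2) / 2)) = gaussian a y"
        unfolding gaussian_def n using a
        by (simp add: exp_sum[symmetric] power_mult_distrib sum_distrib_left mult_ac)
      then show ?thesis by (metis of_real_prod)
    qed
    finally show ?thesis .
  qed
  ultimately show thesis by (rule that)
qed


definition gaussian_grad :: "real \<Rightarrow> real^'d \<Rightarrow> real^'d" where
  "gaussian_grad a y = (- a * gaussian a y) *\<^sub>R y"

lemma gaussian_grad_measurable [measurable]: "gaussian_grad a \<in> borel_measurable borel"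
  unfolding gaussian_grad_def by measurable

lemma gaussian_mono: "0 \<le> b \<Longrightarrow> b \<le> a \<Longrightarrow> gaussian a y \<le> gaussian b y"
  unfolding gaussian_def by (simp add: mult_right_mono)

text \<open>
  Polynomial factors are absorbed by widening the Gaussian.
\<close>

lemma square_times_gaussian_le:
  assumes "a > 0" shows "a * (norm y)\<^sup>2 * gaussian a y \<le> 4 * gaussian (a / 2) y"
proof -
  have "1 + a / 4 * (norm y)\<^sup>2 \<le> exp (a / 4 * (norm y)\<^sup>2)" by (rule exp_ge_add_one_self)
  moreover have "a * (norm y)\<^sup>2 = 4 * (a / 4 * (norm y)\<^sup>2)" by simp
  ultimately have "a * (norm y)\<^sup>2 \<le> 4 * exp (a / 4 * (norm y)\<^sup>2)" by linarith
  then have "a * (norm y)\<^sup>2 * gaussian a y \<le> 4 * exp (a / 4 * (norm y)\<^sup>2) * gaussian a y"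
    by (intro mult_right_mono) (auto simp: gaussian_pos less_imp_le)
  also have "\<dots> = 4 * gaussian (a / 2) y"
    unfolding gaussian_def by (simp add: exp_add[symmetric] field_simps)
  finally show ?thesis .
qed

lemma gaussian_shift_le:
  assumes "a > 0" and "norm w \<le> 1"
  shows "gaussian (a / 2) (y + w) \<le> exp (a / 4) * gaussian (a / 4) y"
proof -
  have "(norm y)\<^sup>2 \<le> (norm (y + w) + norm w)\<^sup>2"
    by (intro power_mono) (use norm_triangle_ineq4[of "y + w" w] in auto)
  also have "\<dots> \<le> 2 * (norm (y + w))\<^sup>2 + 2 * (norm w)\<^sup>2"
    using sum_squares_bound[of "norm (y + w)" "norm w"] by (simp add: power2_sum)
  also have "(norm w)\<^sup>2 \<le> 1" using assms by (simp add: power_le_one)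
  finally have "(norm y)\<^sup>2 \<le> 2 * (norm (y + w))\<^sup>2 + 2" by simp
  then have "a * (norm y)\<^sup>2 \<le> a * (2 * (norm (y + w))\<^sup>2 + 2)" using assms by (intro mult_left_mono) auto
  then show ?thesis unfolding gaussian_def by (simp add: exp_add[symmetric] field_simps)
qed

lemma gaussian_has_derivative_line:
  "((\<lambda>\<theta>. gaussian a (y + \<theta> *\<^sub>R z)) has_real_derivative
     gaussian_grad a (y + \<theta> *\<^sub>R z) \<bullet> z) (at \<theta>)"
proof -
  have eq: "(norm (y + \<theta> *\<^sub>R z))\<^sup>2 = y \<bullet> y + 2 * \<theta> * (y \<bullet> z) + \<theta>\<^sup>2 * (z \<bullet> z)" for \<theta>
    unfolding power2_norm_eq_inner by (simp add: inner_add inner_commute power2_eq_square algebra_simps)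
  have "((\<lambda>\<theta>. y \<bullet> y + 2 * \<theta> * (y \<bullet> z) + \<theta>\<^sup>2 * (z \<bullet> z)) has_real_derivative
      2 * ((y + \<theta> *\<^sub>R z) \<bullet> z)) (at \<theta>)"
    by (auto intro!: derivative_eq_intros simp: inner_add algebra_simps)
  then have d: "((\<lambda>\<theta>. (norm (y + \<theta> *\<^sub>R z))\<^sup>2) has_real_derivative 2 * ((y + \<theta> *\<^sub>R z) \<bullet> z)) (at \<theta>)"
    by (simp only: eq)
  show ?thesis unfolding gaussian_grad_def gaussian_def
    by (rule DERIV_cong[OF DERIV_chain2[OF DERIV_exp DERIV_cmult[OF d]]]) simp
qed

text \<open>
  The increments that enter a Levy operator are of order \<open>|z|\<^sup>2\<close>, with a factor that is integrable in \<open>y\<close>;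
  therefore the operator maps a Gaussian into \<open>L\<^sup>1\<close>.
\<close>

lemma gaussian_Taylor:
  fixes y z :: "real^'d"
  assumes a: "a > 0" and z: "norm z \<le> 1"
  shows "\<bar>gaussian a (y + z) - gaussian a y - gaussian_grad a y \<bullet> z\<bar>
    \<le> 5 * a * exp (a / 4) * (norm z)\<^sup>2 * gaussian (a / 4) y"
proof -
  define f0 where "f0 \<theta> = gaussian a (y + \<theta> *\<^sub>R z)" for \<theta>
  define l where "l \<theta> = (y + \<theta> *\<^sub>R z) \<bullet> z" for \<theta>
  define f1 where "f1 \<theta> = - a * l \<theta> * f0 \<theta>" for \<theta>
  define f2 where "f2 \<theta> = (a\<^sup>2 * (l \<theta>)\<^sup>2 - a * (norm z)\<^sup>2) * f0 \<theta>" for \<theta>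
  have f1: "f1 \<theta> = gaussian_grad a (y + \<theta> *\<^sub>R z) \<bullet> z" for \<theta>
    unfolding f1_def f0_def l_def gaussian_grad_def by simp
  have d0: "(f0 has_real_derivative f1 \<theta>) (at \<theta>)" for \<theta>
    unfolding f1 unfolding f0_def by (rule gaussian_has_derivative_line)
  have d1: "(f1 has_real_derivative f2 \<theta>) (at \<theta>)" for \<theta>
  proof -
    have lin: "(l has_real_derivative (norm z)\<^sup>2) (at \<theta>)"
      unfolding l_def power2_norm_eq_inner by (auto intro!: derivative_eq_intros simp: inner_add)
    show ?thesis unfolding f1_def
      by (rule DERIV_cong[OF DERIV_mult[OF DERIV_cmult[OF lin] d0]])
         (simp add: f1_def f2_def power2_eq_square[of a] power2_eq_square[of "l \<theta>"] algebra_simps)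
  qed
  define D where "D m = (if m = 0 then f0 else if m = Suc 0 then f1 else f2)" for m :: nat
  \<comment> \<open>Taylor expansion with Lagrange remainder along the segment from \<open>y\<close> to \<open>y + z\<close>.\<close>
  have "\<exists>t. 0 < t \<and> t \<le> 1 \<and> f0 1 = (\<Sum>m<2. D m 0 / fact m * 1 ^ m) + D 2 t / fact 2 * 1 ^ 2"
    by (rule Maclaurin2) (auto simp: D_def less_2_cases_iff d0 d1)
  then obtain t where t: "0 < t" "t \<le> 1" and ft: "f0 1 = f0 0 + f1 0 + f2 t / 2"
    by (auto simp: D_def numeral_2_eq_2)
  let ?v = "y + t *\<^sub>R z"
  have "\<bar>f2 t\<bar> \<le> (a\<^sup>2 * (?v \<bullet> z)\<^sup>2 + a * (norm z)\<^sup>2) * gaussian a ?v"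
    unfolding f2_def f0_def l_def abs_mult using a
    by (intro mult_mono order_trans[OF abs_triangle_ineq4]) (auto simp: gaussian_pos less_imp_le)
  also have "\<dots> \<le> (a\<^sup>2 * ((norm ?v)\<^sup>2 * (norm z)\<^sup>2) + a * (norm z)\<^sup>2) * gaussian a ?v"
    using Cauchy_Schwarz_ineq[of ?v z]
    by (intro mult_right_mono add_right_mono mult_left_mono) (auto simp: gaussian_pos less_imp_le power2_norm_eq_inner)
  also have "\<dots> = a * (norm z)\<^sup>2 * (a * (norm ?v)\<^sup>2 * gaussian a ?v + gaussian a ?v)"
    by (simp add: power2_eq_square[of a] algebra_simps)
  also have "\<dots> \<le> a * (norm z)\<^sup>2 * (4 * gaussian (a / 2) ?v + gaussian (a / 2) ?v)"
    using a by (intro mult_left_mono add_mono square_times_gaussian_le gaussian_mono) auto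
  also have "\<dots> = 5 * a * (norm z)\<^sup>2 * gaussian (a / 2) ?v" by simp
  also have "\<dots> \<le> 5 * a * (norm z)\<^sup>2 * (exp (a / 4) * gaussian (a / 4) y)"
    using a t z by (intro mult_left_mono gaussian_shift_le) (auto intro: mult_le_one)
  finally have "\<bar>f2 t\<bar> \<le> 5 * a * exp (a / 4) * (norm z)\<^sup>2 * gaussian (a / 4) y" by (simp add: mult_ac)
  moreover have "gaussian a (y + z) - gaussian a y - gaussian_grad a y \<bullet> z = f2 t / 2"
    using ft unfolding f0_def f1 by simp
  moreover have "\<bar>f2 t / 2\<bar> \<le> \<bar>f2 t\<bar>" by simp
  ultimately show ?thesis by linarith
qed

lemma le_one_plus_square: "s \<le> 1 + s\<^sup>2" for s :: real
proof -
  have "2 * s \<le> s\<^sup>2 + 1" using sum_squares_bound[of s 1] by simp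
  then show ?thesis using zero_le_power2[of s] by linarith
qed

lemma gaussian_grad_le:
  fixes y z :: "real^'d"
  assumes a: "a > 0"
  shows "\<bar>gaussian_grad a y \<bullet> z\<bar> \<le> (a + 4) * norm z * gaussian (a / 4) y"
proof -
  have "norm y \<le> 1 + (norm y)\<^sup>2"
    by (rule le_one_plus_square)
  then have "a * norm y * gaussian a y \<le> a * (1 + (norm y)\<^sup>2) * gaussian a y"
    using a by (intro mult_right_mono mult_left_mono) (auto simp: gaussian_pos less_imp_le)
  also have "\<dots> = a * gaussian a y + a * (norm y)\<^sup>2 * gaussian a y" by (simp add: algebra_simps)
  also have "\<dots> \<le> a * gaussian (a / 4) y + 4 * gaussian (a / 2) y"
    using a by (intro add_mono mult_left_mono gaussian_mono square_times_gaussian_le) auto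
  also have "\<dots> \<le> a * gaussian (a / 4) y + 4 * gaussian (a / 4) y"
    using a by (intro add_mono mult_left_mono gaussian_mono) auto
  finally have *: "a * norm y * gaussian a y \<le> (a + 4) * gaussian (a / 4) y" by (simp add: algebra_simps)
  have "\<bar>gaussian_grad a y \<bullet> z\<bar> \<le> norm (gaussian_grad a y) * norm z" by (rule Cauchy_Schwarz_ineq2)
  also have "\<dots> = (a * norm y * gaussian a y) * norm z"
    using a by (simp add: gaussian_grad_def abs_mult gaussian_pos less_imp_le)
  also have "\<dots> \<le> ((a + 4) * gaussian (a / 4) y) * norm z" by (rule mult_right_mono[OF *]) simp
  finally show ?thesis by (simp add: mult_ac)
qed

lemma gaussian_grad_inner_integrable:
  assumes a: "a > 0"
  shows "integrable lborel (\<lambda>y. gaussian_grad a y \<bullet> (z :: real^'d))"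
  by (rule Bochner_Integration.integrable_bound[of _ "\<lambda>y. (a + 4) * norm z * gaussian (a / 4) y"])
     (use a gaussian_grad_le[OF a] in \<open>auto intro!: integrable_mult_right gaussian_integrable AE_I2
        simp: abs_mult gaussian_pos less_imp_le\<close>)

text \<open>
  Gradients are only taken through difference quotients along the sequence \<open>1 / (n + 1)\<close>, to which dominated
  convergence applies directly.
\<close>

lemma gaussian_difference_quotient:
  "(\<lambda>n. real (Suc n) * (gaussian a (y + (1 / real (Suc n)) *\<^sub>R z) - gaussian a y))
     \<longlonglongrightarrow> gaussian_grad a y \<bullet> z"
proof -
  have "((\<lambda>h. (gaussian a (y + h *\<^sub>R z) - gaussian a y) / h) \<longlongrightarrow> gaussian_grad a y \<bullet> z) (at 0)"
    using gaussian_has_derivative_line[of a y z 0] by (simp add: has_field_derivative_iff)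
  moreover have "filterlim (\<lambda>n. 1 / real (Suc n)) (at 0) sequentially"
    using LIMSEQ_inverse_real_of_nat by (auto simp: filterlim_at inverse_eq_divide)
  ultimately have "(\<lambda>n. (gaussian a (y + (1 / real (Suc n)) *\<^sub>R z) - gaussian a y) / (1 / real (Suc n)))
     \<longlonglongrightarrow> gaussian_grad a y \<bullet> z"
    by (rule filterlim_compose)
  then show ?thesis by (simp add: mult.commute del: of_nat_Suc)
qed

lemma cis_approx1: "norm (cis s - 1) \<le> \<bar>s\<bar>"
  using iexp_approx1[of s 0] by (simp add: cis_conv_exp)

lemma cis_approx2: "norm (cis s - 1 - \<i> * of_real s) \<le> s\<^sup>2 / 2"
  using iexp_approx1[of s 1] by (simp add: cis_conv_exp diff_diff_eq power2_eq_square)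

text \<open>
  Differentiation under the integral sign. The difference quotients of the characters are dominated by
  \<open>|z \<bullet> \<xi>|\<close>, which is integrable by the second moment.
\<close>

lemma gaussian_grad_characters:
  fixes w z :: "real^'d"
  assumes \<Gamma>: "prob_space \<Gamma>" "sets \<Gamma> = sets borel" "integrable \<Gamma> (\<lambda>\<xi>. (norm \<xi>)\<^sup>2)"
    and char: "\<And>y. (LINT \<xi>|\<Gamma>. cis (y \<bullet> \<xi>)) = of_real (gaussian a y)"
  shows "(LINT \<xi>|\<Gamma>. cis (w \<bullet> \<xi>) * (\<i> * of_real (z \<bullet> \<xi>))) = of_real (gaussian_grad a w \<bullet> z)"
proof -
  interpret prob_space \<Gamma> by fact
  note [measurable_cong] = \<Gamma>(2)
  let ?q = "\<lambda>n \<xi>. of_real (real (Suc n)) * (cis ((w + (1 / real (Suc n)) *\<^sub>R z) \<bullet> \<xi>) - cis (w \<bullet> \<xi>))"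
  have q: "?q n \<xi> = of_real (real (Suc n)) * cis (w \<bullet> \<xi>) * (cis ((z \<bullet> \<xi>) / real (Suc n)) - 1)" for n \<xi>
  proof -
    have "(w + (1 / real (Suc n)) *\<^sub>R z) \<bullet> \<xi> = w \<bullet> \<xi> + (z \<bullet> \<xi>) / real (Suc n)" by (simp add: inner_add_left)
    then have "cis ((w + (1 / real (Suc n)) *\<^sub>R z) \<bullet> \<xi>) = cis (w \<bullet> \<xi>) * cis ((z \<bullet> \<xi>) / real (Suc n))"
      by (simp only: cis_mult)
    note this [simp]
    show ?thesis by (simp add: right_diff_distrib mult.assoc del: of_nat_Suc)
  qed
  have ci: "integrable \<Gamma> (\<lambda>\<xi>. cis (y \<bullet> \<xi>))" for y
    by (rule integrable_const_bound[where B = 1]) auto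
  have lim: "(\<lambda>n. \<integral>\<xi>. ?q n \<xi> \<partial>\<Gamma>) \<longlonglongrightarrow> (LINT \<xi>|\<Gamma>. cis (w \<bullet> \<xi>) * (\<i> * of_real (z \<bullet> \<xi>)))"
  proof (rule integral_dominated_convergence[where w = "\<lambda>\<xi>. norm z * (1 + (norm \<xi>)\<^sup>2)"])
    show "integrable \<Gamma> (\<lambda>\<xi>. norm z * (1 + (norm \<xi>)\<^sup>2))" using \<Gamma>(3) by simp
    show "AE \<xi> in \<Gamma>. (\<lambda>n. ?q n \<xi>) \<longlonglongrightarrow> cis (w \<bullet> \<xi>) * (\<i> * of_real (z \<bullet> \<xi>))"
    proof (rule AE_I2)
      fix \<xi>
      let ?\<theta> = "z \<bullet> \<xi>"
      have "(\<lambda>n. ?q n \<xi> - cis (w \<bullet> \<xi>) * (\<i> * of_real ?\<theta>)) \<longlonglongrightarrow> 0"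
      proof (rule Lim_null_comparison[where g = "\<lambda>n. ?\<theta>\<^sup>2 * inverse (real (Suc n))"])
        have "norm (?q n \<xi> - cis (w \<bullet> \<xi>) * (\<i> * of_real ?\<theta>)) \<le> ?\<theta>\<^sup>2 * inverse (real (Suc n))" for n
        proof -
          let ?s = "?\<theta> / real (Suc n)"
          have "?q n \<xi> - cis (w \<bullet> \<xi>) * (\<i> * of_real ?\<theta>)
            = of_real (real (Suc n)) * cis (w \<bullet> \<xi>) * (cis ?s - 1 - \<i> * of_real ?s)"
            unfolding q by (simp add: field_simps del: of_nat_Suc)
          then have "norm (?q n \<xi> - cis (w \<bullet> \<xi>) * (\<i> * of_real ?\<theta>)) = real (Suc n) * norm (cis ?s - 1 - \<i> * of_real ?s)"
            by (simp add: norm_mult del: of_nat_Suc)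
          also have "\<dots> \<le> real (Suc n) * (?s\<^sup>2 / 2)" by (intro mult_left_mono cis_approx2) simp
          also have "\<dots> = ?\<theta>\<^sup>2 * inverse (real (Suc n)) / 2" by (simp add: power2_eq_square field_simps del: of_nat_Suc)
          also have "\<dots> \<le> ?\<theta>\<^sup>2 * inverse (real (Suc n))" by simp
          finally show ?thesis .
        qed
        then show "\<forall>\<^sub>F n in sequentially. norm (?q n \<xi> - cis (w \<bullet> \<xi>) * (\<i> * of_real ?\<theta>)) \<le> ?\<theta>\<^sup>2 * inverse (real (Suc n))"
          by simp
        show "(\<lambda>n. ?\<theta>\<^sup>2 * inverse (real (Suc n))) \<longlonglongrightarrow> 0"
          using tendsto_mult_left[OF LIMSEQ_inverse_real_of_nat] by fastforce
      qed
      then show "(\<lambda>n. ?q n \<xi>) \<longlonglongrightarrow> cis (w \<bullet> \<xi>) * (\<i> * of_real (z \<bullet> \<xi>))" by (simp add: LIM_zero_iff)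
    qed
    show "AE \<xi> in \<Gamma>. norm (?q n \<xi>) \<le> norm z * (1 + (norm \<xi>)\<^sup>2)" for n
    proof (rule AE_I2)
      fix \<xi>
      let ?\<theta> = "z \<bullet> \<xi>"
      have "norm (?q n \<xi>) = real (Suc n) * norm (cis (?\<theta> / real (Suc n)) - 1)"
        unfolding q by (simp add: norm_mult del: of_nat_Suc)
      also have "\<dots> \<le> real (Suc n) * \<bar>?\<theta> / real (Suc n)\<bar>" by (intro mult_left_mono cis_approx1) simp
      also have "\<dots> = \<bar>?\<theta>\<bar>" by (simp add: abs_mult del: of_nat_Suc)
      also have "\<dots> \<le> norm z * norm \<xi>" by (rule Cauchy_Schwarz_ineq2)
      also have "\<dots> \<le> norm z * (1 + (norm \<xi>)\<^sup>2)"
        by (intro mult_left_mono le_one_plus_square) simp_all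
      finally show "norm (?q n \<xi>) \<le> norm z * (1 + (norm \<xi>)\<^sup>2)" .
    qed
  qed auto
  have int: "(LINT \<xi>|\<Gamma>. ?q n \<xi>) = of_real (real (Suc n) * (gaussian a (w + (1 / real (Suc n)) *\<^sub>R z) - gaussian a w))" for n
    by (simp add: ci char of_real_diff del: of_nat_Suc)
  have "(\<lambda>n. complex_of_real (real (Suc n) * (gaussian a (w + (1 / real (Suc n)) *\<^sub>R z) - gaussian a w)))
     \<longlonglongrightarrow> of_real (gaussian_grad a w \<bullet> z)"
    by (intro tendsto_of_real gaussian_difference_quotient)
  then show ?thesis by (rule LIMSEQ_unique[OF lim[unfolded int]])
qed

lemma bounded_gradient_Lipschitz:
  fixes \<phi> :: "real^'d \<Rightarrow> real"
  assumes deriv: "\<And>y. (\<phi> has_derivative (\<lambda>h. g y \<bullet> h)) (at y)" and bound: "\<And>y. norm (g y) \<le> M"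
  shows "\<bar>\<phi> x - \<phi> y\<bar> \<le> M * norm (x - y)"
proof -
  have "norm (\<phi> x - \<phi> y) \<le> M * norm (x - y)"
  proof (rule differentiable_bound[OF convex_UNIV])
    show "onorm (\<lambda>h. g z \<bullet> h) \<le> M" for z
      using order_trans[OF Cauchy_Schwarz_ineq2 mult_right_mono[OF bound norm_ge_zero]]
      by (intro onorm_le) auto
  qed (use deriv in auto)
  then show ?thesis by simp
qed

text \<open>
  Both sides are the directional derivative along \<open>z\<close> of the convolution of \<open>\<phi>\<close> with the Gaussian: by translation
  invariance the difference quotient can be put on either factor.
\<close>

lemma gaussian_integration_by_parts:
  fixes x z :: "real^'d" and \<phi> :: "real^'d \<Rightarrow> real"
  assumes a: "a > 0" and z: "norm z \<le> 1"
    and deriv: "\<And>y. (\<phi> has_derivative (\<lambda>h. g y \<bullet> h)) (at y)"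
    and bound: "\<And>y. \<bar>\<phi> y\<bar> \<le> M" "\<And>y. norm (g y) \<le> M"
  shows "(LINT y|lborel. (gaussian_grad a (x - y) \<bullet> z) * \<phi> y) = (LINT y|lborel. gaussian a (x - y) * (g y \<bullet> z))"
proof -
  have M: "M \<ge> 0" using bound(1)[of 0] by linarith
  have "continuous_on UNIV \<phi>"
    using deriv by (auto intro!: continuous_at_imp_continuous_on has_derivative_continuous)
  then have [measurable]: "\<phi> \<in> borel_measurable borel" by (rule borel_measurable_continuous_onI)
  let ?h = "\<lambda>n. 1 / real (Suc n)"
  have h: "0 < ?h n" "?h n \<le> 1" for n by auto
  have quot: "(\<lambda>n. real (Suc n) * (\<phi> (y + ?h n *\<^sub>R z) - \<phi> y)) \<longlonglongrightarrow> g y \<bullet> z" for y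
  proof -
    have "((\<lambda>t. \<phi> (y + t *\<^sub>R z)) has_derivative (\<lambda>t. g y \<bullet> (t *\<^sub>R z))) (at 0)"
      by (rule has_derivative_compose[of "\<lambda>t. y + t *\<^sub>R z" "\<lambda>t. t *\<^sub>R z", where g = \<phi>])
         (auto intro!: derivative_eq_intros deriv)
    then have "((\<lambda>t. \<phi> (y + t *\<^sub>R z)) has_real_derivative g y \<bullet> z) (at 0)"
      by (simp add: has_field_derivative_def mult_commute_abs)
    then have "((\<lambda>t. (\<phi> (y + t *\<^sub>R z) - \<phi> y) / t) \<longlongrightarrow> g y \<bullet> z) (at 0)"
      by (simp add: has_field_derivative_iff)
    moreover have "filterlim ?h (at 0) sequentially"
      using LIMSEQ_inverse_real_of_nat by (auto simp: filterlim_at inverse_eq_divide)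
    ultimately have "(\<lambda>n. (\<phi> (y + ?h n *\<^sub>R z) - \<phi> y) / ?h n) \<longlonglongrightarrow> g y \<bullet> z"
      by (rule filterlim_compose)
    then show ?thesis by (simp add: mult.commute del: of_nat_Suc)
  qed
  have gm [measurable]: "(\<lambda>y. g y \<bullet> z) \<in> borel_measurable borel"
    by (rule borel_measurable_LIMSEQ_real[OF quot]) measurable
  let ?L = "\<lambda>n y. real (Suc n) * (gaussian a (x - y + ?h n *\<^sub>R z) - gaussian a (x - y)) * \<phi> y"
  let ?R = "\<lambda>n y. gaussian a (x - y) * (real (Suc n) * (\<phi> (y + ?h n *\<^sub>R z) - \<phi> y))"
  have gi: "integrable lborel (\<lambda>y. gaussian b (x - y + v))" if "b > 0" for b and v :: "real^'d"
    using integrable_reflect[of "gaussian b" "x + v"] gaussian_integrable[OF that] by (simp add: algebra_simps)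
  have gi0: "integrable lborel (\<lambda>y. gaussian b (x - y))" if "b > 0" for b
    using gi[OF that, of 0] by simp
  have g\<phi>: "integrable lborel (\<lambda>y. gaussian a (x - y + v) * \<phi> y)" for v :: "real^'d"
    by (rule Bochner_Integration.integrable_bound[OF integrable_mult_left[OF gi[OF a, of v], of M]])
      (use bound(1) M in \<open>auto intro!: AE_I2 mult_left_mono simp: abs_mult gaussian_pos less_imp_le\<close>)
  have eqn: "(LINT y|lborel. ?L n y) = (LINT y|lborel. ?R n y)" for n
  proof -
    have shift: "(LINT y|lborel. gaussian a (x - y + ?h n *\<^sub>R z) * \<phi> y)
      = (LINT y|lborel. gaussian a (x - y) * \<phi> (y + ?h n *\<^sub>R z))"
      using integral_translate[of "\<lambda>y. gaussian a (x - y + ?h n *\<^sub>R z) * \<phi> y" "?h n *\<^sub>R z"]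
      by (simp add: add.commute diff_diff_eq algebra_simps)
    have i2: "integrable lborel (\<lambda>y. gaussian a (x - y) * \<phi> (y + ?h n *\<^sub>R z))"
      by (rule Bochner_Integration.integrable_bound[OF integrable_mult_left[OF gi0[OF a], of M]])
        (use bound(1) M in \<open>auto intro!: AE_I2 mult_left_mono simp: abs_mult gaussian_pos less_imp_le\<close>)
    have "(LINT y|lborel. ?L n y) = real (Suc n) * (LINT y|lborel. gaussian a (x - y + ?h n *\<^sub>R z) * \<phi> y - gaussian a (x - y) * \<phi> y)"
      by (simp add: algebra_simps flip: Bochner_Integration.integral_mult_right_zero del: of_nat_Suc)
    also have "\<dots> = real (Suc n) * ((LINT y|lborel. gaussian a (x - y + ?h n *\<^sub>R z) * \<phi> y) - (conv (gaussian a) \<phi> x))"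
      using g\<phi>[of "?h n *\<^sub>R z"] g\<phi>[of 0] by (simp del: of_nat_Suc)
    also have "\<dots> = real (Suc n) * (LINT y|lborel. gaussian a (x - y) * \<phi> (y + ?h n *\<^sub>R z) - gaussian a (x - y) * \<phi> y)"
      unfolding shift using i2 g\<phi>[of 0] by (simp del: of_nat_Suc)
    also have "\<dots> = (LINT y|lborel. ?R n y)"
      by (simp add: algebra_simps flip: Bochner_Integration.integral_mult_right_zero del: of_nat_Suc)
    finally show ?thesis .
  qed
  define C where "C = 5 * a * exp (a / 4)"
  have L: "(\<lambda>n. \<integral>y. ?L n y \<partial>lborel) \<longlonglongrightarrow> (LINT y|lborel. (gaussian_grad a (x - y) \<bullet> z) * \<phi> y)"
  proof (rule integral_dominated_convergence[where w = "\<lambda>y. (a + 4 + C) * gaussian (a / 4) (x - y) * M"])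
    show "integrable lborel (\<lambda>y. (a + 4 + C) * gaussian (a / 4) (x - y) * M)"
      using gi0[of "a / 4"] a by simp
    show "AE y in lborel. (\<lambda>n. ?L n y) \<longlonglongrightarrow> (gaussian_grad a (x - y) \<bullet> z) * \<phi> y"
      by (intro AE_I2 tendsto_mult_right gaussian_difference_quotient)
    show "AE y in lborel. norm (?L n y) \<le> (a + 4 + C) * gaussian (a / 4) (x - y) * M" for n
    proof (rule AE_I2)
      fix y
      let ?v = "x - y" and ?N = "real (Suc n)"
      have "norm (?h n *\<^sub>R z) \<le> 1" using h[of n] z by (auto intro: mult_le_one)
      then have "\<bar>gaussian a (?v + ?h n *\<^sub>R z) - gaussian a ?v - gaussian_grad a ?v \<bullet> (?h n *\<^sub>R z)\<bar>
        \<le> C * (norm (?h n *\<^sub>R z))\<^sup>2 * gaussian (a / 4) ?v"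
        unfolding C_def by (rule gaussian_Taylor[OF a])
      also have "\<dots> \<le> C * ?h n * gaussian (a / 4) ?v"
      proof -
        have "(norm (?h n *\<^sub>R z))\<^sup>2 = ?h n * (?h n * (norm z)\<^sup>2)"
          by (simp add: power2_eq_square abs_mult del: of_nat_Suc)
        also have "\<dots> \<le> ?h n * 1" using h[of n] z
          by (intro mult_left_mono mult_le_one) (auto simp: power_le_one)
        finally show ?thesis
          using a by (intro mult_right_mono mult_left_mono) (auto simp: C_def gaussian_pos less_imp_le)
      qed
      moreover have "\<bar>gaussian_grad a ?v \<bullet> (?h n *\<^sub>R z)\<bar> \<le> (a + 4) * ?h n * gaussian (a / 4) ?v"
      proof -
        have "\<bar>gaussian_grad a ?v \<bullet> (?h n *\<^sub>R z)\<bar> \<le> (a + 4) * norm (?h n *\<^sub>R z) * gaussian (a / 4) ?v"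
          by (rule gaussian_grad_le[OF a])
        also have "\<dots> \<le> (a + 4) * ?h n * gaussian (a / 4) ?v"
          using a z h[of n] by (intro mult_right_mono mult_left_mono)
            (auto simp: gaussian_pos less_imp_le divide_right_mono)
        finally show ?thesis .
      qed
      ultimately have "\<bar>gaussian a (?v + ?h n *\<^sub>R z) - gaussian a ?v\<bar> \<le> C * ?h n * gaussian (a / 4) ?v + (a + 4) * ?h n * gaussian (a / 4) ?v"
        by linarith
      also have "\<dots> = ?h n * ((a + 4 + C) * gaussian (a / 4) ?v)" by (simp only: algebra_simps)
      finally have q: "\<bar>gaussian a (?v + ?h n *\<^sub>R z) - gaussian a ?v\<bar> \<le> ?h n * ((a + 4 + C) * gaussian (a / 4) ?v)" .
      have "norm (?L n y) = ?N * \<bar>gaussian a (?v + ?h n *\<^sub>R z) - gaussian a ?v\<bar> * \<bar>\<phi> y\<bar>"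
        by (simp add: abs_mult del: of_nat_Suc)
      also have "\<dots> \<le> ?N * (?h n * ((a + 4 + C) * gaussian (a / 4) ?v)) * M"
        using bound(1)[of y] M a q
        by (intro mult_mono mult_left_mono) (auto simp: C_def gaussian_pos less_imp_le)
      also have "\<dots> = (a + 4 + C) * gaussian (a / 4) ?v * M" by (simp del: of_nat_Suc)
      finally show "norm (?L n y) \<le> (a + 4 + C) * gaussian (a / 4) ?v * M" .
    qed
  qed measurable
  have R: "(\<lambda>n. \<integral>y. ?R n y \<partial>lborel) \<longlonglongrightarrow> (LINT y|lborel. gaussian a (x - y) * (g y \<bullet> z))"
  proof (rule integral_dominated_convergence[where w = "\<lambda>y. gaussian a (x - y) * M"])
    show "integrable lborel (\<lambda>y. gaussian a (x - y) * M)" using gi0[OF a] by simp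
    show "AE y in lborel. (\<lambda>n. ?R n y) \<longlonglongrightarrow> gaussian a (x - y) * (g y \<bullet> z)"
      by (intro AE_I2 tendsto_mult_left quot)
    show "AE y in lborel. norm (?R n y) \<le> gaussian a (x - y) * M" for n
    proof (rule AE_I2)
      fix y
      have "\<bar>\<phi> (y + ?h n *\<^sub>R z) - \<phi> y\<bar> \<le> M * norm (y + ?h n *\<^sub>R z - y)"
        by (rule bounded_gradient_Lipschitz[OF deriv bound(2)])
      also have "\<dots> \<le> M * ?h n" using M z h[of n] by (intro mult_left_mono) (auto simp: divide_right_mono)
      finally have "real (Suc n) * \<bar>\<phi> (y + ?h n *\<^sub>R z) - \<phi> y\<bar> \<le> real (Suc n) * (M * ?h n)"
        by (intro mult_left_mono) auto
      also have "\<dots> = M" by (simp del: of_nat_Suc)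
      finally show "norm (?R n y) \<le> gaussian a (x - y) * M"
        by (simp add: abs_mult gaussian_pos less_imp_le del: of_nat_Suc)
    qed
  qed measurable
  show ?thesis using LIMSEQ_unique[OF L[unfolded eqn] R] .
qed

text \<open>
  Taking \<open>a = (n + 1)\<^sup>2\<close> and rescaling turns the integral into an average of \<open>B(x + v / (n + 1))\<close> against a fixed
  Gaussian, which tends to \<open>B(x)\<close> times the total mass.
\<close>

lemma gaussian_approximate_identity:
  fixes B :: "real^'d \<Rightarrow> real"
  assumes cont: "continuous_on UNIV B" and bound: "\<And>y. \<bar>B y\<bar> \<le> M"
    and zero: "\<And>a. a > 0 \<Longrightarrow> (conv (gaussian a) B x) = 0"
  shows "B x = 0"
proof -
  have [measurable]: "B \<in> borel_measurable borel" using cont by (rule borel_measurable_continuous_onI)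
  let ?h = "\<lambda>n. 1 / real (Suc n)"
  have z: "(LINT v|lborel. gaussian 1 v * B (x + ?h n *\<^sub>R v)) = 0" for n
  proof -
    let ?c = "?h n" and ?a = "(real (Suc n))\<^sup>2"
    have g: "gaussian ?a (x - (x + ?c *\<^sub>R v)) = gaussian 1 v" for v :: "real^'d"
      unfolding gaussian_def by (simp add: power_divide field_simps del: of_nat_Suc)
    have "0 = (conv (gaussian ?a) B x)" by (rule zero[symmetric]) simp
    also have "\<dots> = (\<integral>y. gaussian ?a (x - y) * B y \<partial>(density (distr lborel borel (\<lambda>v. x + ?c *\<^sub>R v)) (\<lambda>_. ennreal (\<bar>?c\<bar> ^ DIM(real^'d)))))"
      using lborel_affine[of ?c x] by (simp add: ennreal_power del: of_nat_Suc)
    also have "\<dots> = (\<integral>y. (\<bar>?c\<bar> ^ DIM(real^'d)) *\<^sub>R (gaussian ?a (x - y) * B y) \<partial>(distr lborel borel (\<lambda>v. x + ?c *\<^sub>R v)))"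
      by (rule integral_density) auto
    also have "\<dots> = (LINT v|lborel. (\<bar>?c\<bar> ^ DIM(real^'d)) *\<^sub>R (gaussian ?a (x - (x + ?c *\<^sub>R v)) * B (x + ?c *\<^sub>R v)))"
      by (rule integral_distr) auto
    also have "\<dots> = (\<bar>?c\<bar> ^ DIM(real^'d)) * (LINT v|lborel. gaussian 1 v * B (x + ?c *\<^sub>R v))"
      unfolding g by simp
    finally show ?thesis by simp
  qed
  have "(\<lambda>n. \<integral>v. gaussian 1 v * B (x + ?h n *\<^sub>R v) \<partial>lborel) \<longlonglongrightarrow> (LINT v|(lborel :: (real^'d) measure). gaussian 1 v * B x)"
  proof (rule integral_dominated_convergence[where w = "\<lambda>v :: real^'d. gaussian 1 v * M"])
    show "integrable lborel (\<lambda>v :: real^'d. gaussian 1 v * M)" using gaussian_integrable[of 1, where 'd = 'd] by simp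
    show "AE v in lborel. (\<lambda>n. gaussian 1 v * B (x + ?h n *\<^sub>R v)) \<longlonglongrightarrow> gaussian 1 v * B x"
    proof (intro AE_I2 tendsto_mult_left)
      fix v
      have "(\<lambda>n. x + ?h n *\<^sub>R v) \<longlonglongrightarrow> x + 0 *\<^sub>R v"
        using LIMSEQ_inverse_real_of_nat by (intro tendsto_intros) (simp add: inverse_eq_divide)
      moreover have "isCont B x" using cont by (simp add: continuous_on_eq_continuous_at)
      ultimately show "(\<lambda>n. B (x + ?h n *\<^sub>R v)) \<longlonglongrightarrow> B x"
        using isCont_tendsto_compose[of x B "\<lambda>n. x + ?h n *\<^sub>R v"] by (simp del: of_nat_Suc)
    qed
    show "AE v in lborel. norm (gaussian 1 v * B (x + ?h n *\<^sub>R v)) \<le> gaussian 1 v * M" for n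
      using bound by (auto intro!: AE_I2 mult_left_mono simp: abs_mult gaussian_pos less_imp_le)
  qed measurable
  then have "(LINT v|(lborel :: (real^'d) measure). gaussian 1 v * B x) = 0" unfolding z using LIMSEQ_unique tendsto_const by blast
  then have "(LINT v|(lborel :: (real^'d) measure). gaussian 1 v) * B x = 0" by simp
  moreover have "(LINT v|(lborel :: (real^'d) measure). gaussian 1 v) \<noteq> 0"
  proof
    assume "(LINT v|(lborel :: (real^'d) measure). gaussian 1 v) = 0"
    then have "AE v in (lborel :: (real^'d) measure). gaussian 1 v = 0"
      using integral_nonneg_eq_0_iff_AE[OF gaussian_integrable[of 1, where 'd = 'd]] by (simp add: gaussian_pos less_imp_le)
    then have "AE v in (lborel :: (real^'d) measure). False" by (simp add: less_imp_neq[OF gaussian_pos, symmetric])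
    then show False by (simp add: eventually_False ae_filter_eq_bot_iff emeasure_lborel_UNIV)
  qed
  ultimately show ?thesis by simp
qed


section \<open>Levy measures and their symbols\<close>

text \<open>
  The integrand of a Levy operator. The gradient is a separate argument, so that the expression is linear in
  the pair \<open>(\<phi>, g)\<close> and stable under pointwise limits of both.
\<close>

definition jump :: "(real^'d \<Rightarrow> real) \<Rightarrow> (real^'d \<Rightarrow> real^'d) \<Rightarrow> real^'d \<Rightarrow> real^'d \<Rightarrow> real" where
  "jump \<phi> g x z = \<phi> (x + z) - \<phi> x - indicator (ball 0 1) z * (g x \<bullet> z)"

lemma indicator_ball_measurable [measurable]:
  "(\<lambda>z :: real^'d. indicator (ball 0 r) z :: real) \<in> borel_measurable borel"
  by (intro borel_measurable_indicator) simp

lemma jump_measurable [measurable (raw)]: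
  assumes [measurable]: "\<phi> \<in> borel_measurable borel" "g \<in> borel_measurable borel"
    "f \<in> borel_measurable M" "h \<in> borel_measurable M"
  shows "(\<lambda>w. jump \<phi> g (f w) (h w)) \<in> borel_measurable M"
proof -
  have [measurable]: "(\<lambda>w. indicator (ball 0 1) (h w) :: real) \<in> borel_measurable M"
    by (rule measurable_compose[OF assms(4) indicator_ball_measurable])
  have [measurable]: "(\<lambda>w. \<phi> (f w + h w)) \<in> borel_measurable M" "(\<lambda>w. \<phi> (f w)) \<in> borel_measurable M" "(\<lambda>w. g (f w)) \<in> borel_measurable M"
    by measurable
  show ?thesis unfolding jump_def by measurable
qed

lemma norm_integral_le_nn_integral:
  fixes f :: "'a \<Rightarrow> 'b::{banach, second_countable_topology}"
  shows "ennreal (norm (\<integral>x. f x \<partial>M)) \<le> (\<integral>\<^sup>+x. ennreal (norm (f x)) \<partial>M)"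
  by (cases "integrable M f") (auto simp: integral_norm_bound_ennreal not_integrable_integral_eq)

locale levy =
  fixes \<mu> :: "(real^'d) measure"
  assumes levy: "levy_measure \<mu>"
begin

lemma sets_mu [simp, measurable_cong]: "sets \<mu> = sets borel"
  using levy by (simp add: levy_measure_def)

lemma space_mu [simp]: "space \<mu> = UNIV"
  using sets_eq_imp_space_eq[OF sets_mu] by simp

lemma integrable_levy_weight: "integrable \<mu> (\<lambda>z. min 1 ((norm z)\<^sup>2))"
  using levy by (intro integrableI_bounded) (auto simp: levy_measure_def)

definition levy_mass :: real where
  "levy_mass = (LINT z|\<mu>. min 1 ((norm z)\<^sup>2))"

lemma levy_mass_nonneg: "0 \<le> levy_mass"
  unfolding levy_mass_def by (intro integral_nonneg_AE) auto

lemma nn_integral_levy_weight: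
  assumes "c \<ge> 0"
  shows "(\<integral>\<^sup>+z. ennreal (c * min 1 ((norm z)\<^sup>2)) \<partial>\<mu>) = ennreal (c * levy_mass)"
  using assms integrable_levy_weight
  by (subst nn_integral_eq_integral) (auto simp: levy_mass_def)

text \<open>
  Chebyshev's inequality for the weight \<open>min 1 |z|\<^sup>2\<close>.
\<close>

lemma emeasure_away_finite:
  assumes "0 < r" "r \<le> 1"
  shows "emeasure \<mu> {z. r \<le> norm z} \<le> ennreal (levy_mass / r\<^sup>2)"
proof -
  have "emeasure \<mu> {z. r \<le> norm z} = (\<integral>\<^sup>+z. indicator {z. r \<le> norm z} z \<partial>\<mu>)"
    by (simp add: nn_integral_indicator)
  also have "\<dots> \<le> (\<integral>\<^sup>+z. ennreal (1 / r\<^sup>2 * min 1 ((norm z)\<^sup>2)) \<partial>\<mu>)"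
  proof (rule nn_integral_mono)
    fix z :: "real^'d"
    have "1 \<le> 1 / r\<^sup>2 * min 1 ((norm z)\<^sup>2)" if "r \<le> norm z"
    proof -
      have "r\<^sup>2 \<le> (norm z)\<^sup>2" using that assms by (intro power_mono) auto
      moreover have "r\<^sup>2 \<le> 1" using assms by (simp add: power_le_one)
      ultimately show ?thesis using assms by (simp add: field_simps)
    qed
    then show "indicator {z. r \<le> norm z} z \<le> ennreal (1 / r\<^sup>2 * min 1 ((norm z)\<^sup>2))"
      by (auto simp: indicator_def simp del: times_divide_eq_left intro!: ennreal_leI[of 1, simplified])
  qed
  also have "\<dots> = ennreal (levy_mass / r\<^sup>2)"
    by (subst nn_integral_levy_weight) auto
  finally show ?thesis .
qed

lemma sigma_finite_mu: "sigma_finite_measure \<mu>"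
proof
  let ?A = "range (\<lambda>n. {z :: real^'d. 1 / real (Suc n) \<le> norm z}) \<union> {{0}}"
  have "\<exists>n. 1 / real (Suc n) \<le> norm z" if "z \<noteq> 0" for z :: "real^'d"
    using reals_Archimedean[of "norm z"] that by (auto simp: inverse_eq_divide intro: less_imp_le)
  then have "\<Union>?A = space \<mu>" by auto
  moreover have "emeasure \<mu> a \<noteq> \<infinity>" if "a \<in> ?A" for a
  proof -
    from that consider n where "a = {z :: real^'d. 1 / real (Suc n) \<le> norm z}" | "a = {0}" by auto
    then show ?thesis
    proof cases
      case 1
      have "emeasure \<mu> a \<le> ennreal (levy_mass / (1 / real (Suc n))\<^sup>2)"
        unfolding 1 by (rule emeasure_away_finite) auto
      then show ?thesis by (metis ennreal_neq_top infinity_ennreal_def top.extremum_unique)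
    qed (use levy in \<open>simp add: levy_measure_def\<close>)
  qed
  moreover have "countable ?A" by auto
  moreover have "?A \<subseteq> sets \<mu>" by auto
  ultimately show "\<exists>A. countable A \<and> A \<subseteq> sets \<mu> \<and> \<Union>A = space \<mu> \<and> (\<forall>a\<in>A. emeasure \<mu> a \<noteq> \<infinity>)" by blast
qed

sublocale sigma_finite_measure \<mu> by (rule sigma_finite_mu)

text \<open>
  The Levy operator applied to a Gaussian, a function in \<open>L\<^sup>1\<close>.
\<close>

definition gaussian_jumps :: "real \<Rightarrow> real^'d \<Rightarrow> real" where
  "gaussian_jumps a x = (LINT z|\<mu>. jump (gaussian a) (gaussian_grad a) x z)"

lemma gaussian_jumps_measurable [measurable]: "gaussian_jumps a \<in> borel_measurable borel"
  unfolding gaussian_jumps_def by measurable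

lemma jump_gaussian_L1:
  assumes a: "a > 0"
  obtains C where "C \<ge> 0"
    "\<And>x z :: real^'d. (\<integral>\<^sup>+y. ennreal \<bar>jump (gaussian a) (gaussian_grad a) (x - y) z\<bar> \<partial>lborel) \<le> ennreal (C * min 1 ((norm z)\<^sup>2))"
proof -
  define C1 where "C1 = 5 * a * exp (a / 4)"
  have C1: "C1 \<ge> 0" using a by (simp add: C1_def)
  define I1 where "I1 = (LINT y|(lborel :: (real^'d) measure). gaussian (a / 4) y)"
  define I2 where "I2 = (LINT y|(lborel :: (real^'d) measure). gaussian a y)"
  have I: "I1 \<ge> 0" "I2 \<ge> 0"
    unfolding I1_def I2_def by (auto intro!: integral_nonneg_AE simp: gaussian_pos less_imp_le)
  define C where "C = max (C1 * I1) (2 * I2)"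
  have "C \<ge> 0" using I C1 by (simp add: C_def)
  moreover have "(\<integral>\<^sup>+y. ennreal \<bar>jump (gaussian a) (gaussian_grad a) (x - y) z\<bar> \<partial>lborel) \<le> ennreal (C * min 1 ((norm z)\<^sup>2))" for x z :: "real^'d"
  proof -
    have "(\<integral>\<^sup>+y. ennreal \<bar>jump (gaussian a) (gaussian_grad a) (x - y) z\<bar> \<partial>lborel)
      = (\<integral>\<^sup>+y. ennreal \<bar>jump (gaussian a) (gaussian_grad a) y z\<bar> \<partial>lborel)"
      by (rule nn_integral_reflect) measurable
    also have "\<dots> \<le> ennreal (C * min 1 ((norm z)\<^sup>2))"
    proof (cases "norm z < 1")
      case True
      have "(\<integral>\<^sup>+y. ennreal \<bar>jump (gaussian a) (gaussian_grad a) y z\<bar> \<partial>lborel)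
        \<le> (\<integral>\<^sup>+y. ennreal (C1 * (norm z)\<^sup>2 * gaussian (a / 4) (y :: real^'d)) \<partial>lborel)"
        using gaussian_Taylor[OF a, of z] True
        by (intro nn_integral_mono ennreal_leI) (simp add: jump_def C1_def)
      also have "\<dots> = ennreal (C1 * (norm z)\<^sup>2 * I1)"
        using a C1 gaussian_integrable[of "a / 4"]
        by (subst nn_integral_eq_integral) (auto simp: I1_def gaussian_pos less_imp_le)
      also have "\<dots> \<le> ennreal (C * min 1 ((norm z)\<^sup>2))"
      proof (rule ennreal_leI)
        have "min 1 ((norm z)\<^sup>2) = (norm z)\<^sup>2" using True by (simp add: power_le_one min_absorb2)
        moreover have "C1 * I1 * (norm z)\<^sup>2 \<le> C * (norm z)\<^sup>2" by (intro mult_right_mono) (auto simp: C_def)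
        ultimately show "C1 * (norm z)\<^sup>2 * I1 \<le> C * min 1 ((norm z)\<^sup>2)" by (simp add: mult_ac)
      qed
      finally show ?thesis .
    next
      case False
      have "(\<integral>\<^sup>+y. ennreal \<bar>jump (gaussian a) (gaussian_grad a) y z\<bar> \<partial>lborel)
        \<le> (\<integral>\<^sup>+y. ennreal (gaussian a (z + y)) + ennreal (gaussian a y) \<partial>lborel)"
      proof (intro nn_integral_mono)
        fix y
        have "\<bar>gaussian a (y + z) - gaussian a y\<bar> \<le> gaussian a (z + y) + gaussian a y"
          using gaussian_pos[of a y] gaussian_pos[of a "y + z"] by (simp add: add.commute)
        then show "ennreal \<bar>jump (gaussian a) (gaussian_grad a) y z\<bar> \<le> ennreal (gaussian a (z + y)) + ennreal (gaussian a y)"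
          using False by (simp add: jump_def ennreal_leI gaussian_pos less_imp_le flip: ennreal_plus)
      qed
      also have "\<dots> = (\<integral>\<^sup>+y. ennreal (gaussian a (z + y)) \<partial>lborel) + (\<integral>\<^sup>+y. ennreal (gaussian a (y :: real^'d)) \<partial>lborel)"
        by (rule nn_integral_add) auto
      also have "(\<integral>\<^sup>+y. ennreal (gaussian a (z + y)) \<partial>lborel) = (\<integral>\<^sup>+y. ennreal (gaussian a (y :: real^'d)) \<partial>lborel)"
        by (rule nn_integral_translate) measurable
      also have "(\<integral>\<^sup>+y. ennreal (gaussian a (y :: real^'d)) \<partial>lborel) = ennreal I2"
        using gaussian_integrable[OF a]
        by (subst nn_integral_eq_integral) (auto simp: I2_def gaussian_pos less_imp_le)
      also have "ennreal I2 + ennreal I2 = ennreal (2 * I2)" using I by (simp flip: ennreal_plus)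
      also have "\<dots> \<le> ennreal (C * min 1 ((norm z)\<^sup>2))"
      proof (rule ennreal_leI)
        have "min 1 ((norm z)\<^sup>2) = 1" using False by (simp add: one_le_power min_absorb1)
        then show "2 * I2 \<le> C * min 1 ((norm z)\<^sup>2)" by (simp add: C_def)
      qed
      finally show ?thesis .
    qed
    finally show ?thesis .
  qed
  ultimately show thesis by (rule that)
qed

lemma jump_gaussian_integrable:
  assumes a: "a > 0"
  shows "integrable (\<mu> \<Otimes>\<^sub>M lborel) (\<lambda>(z, y). jump (gaussian a) (gaussian_grad a) (x - y) z)"
proof -
  obtain C where C: "C \<ge> 0"
    "\<And>x z :: real^'d. (\<integral>\<^sup>+y. ennreal \<bar>jump (gaussian a) (gaussian_grad a) (x - y) z\<bar> \<partial>lborel) \<le> ennreal (C * min 1 ((norm z)\<^sup>2))"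
    using jump_gaussian_L1[OF a] by blast
  interpret pair_sigma_finite \<mu> "lborel :: (real^'d) measure" ..
  show ?thesis
    by (rule Fubini_bounded_sections(1)[where b = "\<lambda>z. C * min 1 ((norm z)\<^sup>2)"])
       (use C integrable_levy_weight in \<open>auto simp: case_prod_beta\<close>)
qed

lemma gaussian_jumps_integrable:
  assumes a: "a > 0"
  shows "integrable lborel (gaussian_jumps a)"
proof -
  interpret pair_sigma_finite \<mu> "lborel :: (real^'d) measure" ..
  have "integrable lborel (\<lambda>y. gaussian_jumps a (0 - y))"
    unfolding gaussian_jumps_def
    using integrable_snd[of "\<lambda>z y. jump (gaussian a) (gaussian_grad a) (0 - y) z"] jump_gaussian_integrable[OF a, of 0] by simp
  then show ?thesis by (subst (asm) integrable_reflect) auto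
qed

definition psi :: "real^'d \<Rightarrow> complex" where "psi = levy_symbol 0 \<mu>"

abbreviation symbol_integrand :: "real^'d \<Rightarrow> real^'d \<Rightarrow> complex" where
  "symbol_integrand \<xi> z \<equiv> 1 - cis (\<xi> \<bullet> z) + \<i> * of_real (\<xi> \<bullet> z * indicator (ball 0 1) z)"

lemma psi_eq: "psi \<xi> = (LINT z|\<mu>. symbol_integrand \<xi> z)"
  unfolding psi_def levy_symbol_def by simp

text \<open>
  The Taylor remainder of the character for small jumps, and the trivial bound for the others.
\<close>

lemma symbol_integrand_le: "norm (symbol_integrand \<xi> z) \<le> (2 + (norm \<xi>)\<^sup>2) * min 1 ((norm z)\<^sup>2)"
proof (cases "norm z < 1")
  case True
  have "symbol_integrand \<xi> z = - (cis (\<xi> \<bullet> z) - 1 - \<i> * of_real (\<xi> \<bullet> z))" using True by simp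
  then have "norm (symbol_integrand \<xi> z) \<le> (\<xi> \<bullet> z)\<^sup>2 / 2" by (metis norm_minus_cancel cis_approx2)
  also have "\<dots> \<le> (\<xi> \<bullet> z)\<^sup>2" by simp
  also have "\<dots> \<le> (norm \<xi>)\<^sup>2 * (norm z)\<^sup>2"
    using Cauchy_Schwarz_ineq[of \<xi> z] by (simp add: power2_norm_eq_inner)
  also have "\<dots> \<le> (2 + (norm \<xi>)\<^sup>2) * (norm z)\<^sup>2" by (intro mult_right_mono) auto
  also have "(norm z)\<^sup>2 = min 1 ((norm z)\<^sup>2)" using True by (simp add: power_le_one min_absorb2)
  finally show ?thesis .
next
  case False
  have "norm (symbol_integrand \<xi> z) \<le> norm (1 :: complex) + norm (cis (\<xi> \<bullet> z))"
    using False norm_triangle_ineq4[of 1 "cis (\<xi> \<bullet> z)"] by (simp del: norm_one norm_cis)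
  also have "\<dots> \<le> 2 + (norm \<xi>)\<^sup>2" by simp
  also have "\<dots> = (2 + (norm \<xi>)\<^sup>2) * min 1 ((norm z)\<^sup>2)" using False by (simp add: one_le_power min_absorb1)
  finally show ?thesis .
qed

lemma symbol_integrand_nn:
  "(\<integral>\<^sup>+z. ennreal (norm (symbol_integrand \<xi> z)) \<partial>\<mu>) \<le> ennreal ((2 + (norm \<xi>)\<^sup>2) * levy_mass)"
proof -
  have "(\<integral>\<^sup>+z. ennreal (norm (symbol_integrand \<xi> z)) \<partial>\<mu>)
    \<le> (\<integral>\<^sup>+z. ennreal ((2 + (norm \<xi>)\<^sup>2) * min 1 ((norm z)\<^sup>2)) \<partial>\<mu>)"
    by (intro nn_integral_mono ennreal_leI symbol_integrand_le)
  then show ?thesis by (subst (asm) nn_integral_levy_weight) auto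
qed

lemma symbol_integrand_measurable [measurable (raw)]:
  assumes [measurable]: "f \<in> borel_measurable M" "h \<in> borel_measurable M"
  shows "(\<lambda>w. symbol_integrand (f w) (h w)) \<in> borel_measurable M"
proof -
  have [measurable]: "(\<lambda>w. indicator (ball 0 1) (h w) :: real) \<in> borel_measurable M"
    by (rule measurable_compose[OF assms(2) indicator_ball_measurable])
  show ?thesis by measurable
qed

lemma psi_bound: "norm (psi \<xi>) \<le> (2 + (norm \<xi>)\<^sup>2) * levy_mass"
proof -
  have "ennreal (norm (psi \<xi>)) \<le> ennreal ((2 + (norm \<xi>)\<^sup>2) * levy_mass)"
    unfolding psi_eq by (rule order_trans[OF norm_integral_le_nn_integral symbol_integrand_nn])
  then show ?thesis using levy_mass_nonneg by (subst (asm) ennreal_le_iff) auto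
qed

lemma psi_measurable [measurable]: "psi \<in> borel_measurable borel"
proof -
  have "(\<lambda>\<xi>. \<integral>z. symbol_integrand \<xi> z \<partial>\<mu>) \<in> borel_measurable borel" by measurable
  then show ?thesis unfolding psi_eq[abs_def, symmetric] by simp
qed

end


section \<open>Heat kernels and the Dynkin formula for Gaussians\<close>

locale levy_heat = levy \<mu> for \<mu> :: "(real^'d) measure" +
  fixes p :: "real \<Rightarrow> real^'d \<Rightarrow> real"
  assumes heat: "heat_kernel 0 \<mu> p"
begin

lemma p_measurable: "t > 0 \<Longrightarrow> p t \<in> borel_measurable borel"
  and p_nonneg: "t > 0 \<Longrightarrow> 0 \<le> p t x"
  using heat by (auto simp: heat_kernel_def)

lemma nn_integral_p: "t > 0 \<Longrightarrow> (\<integral>\<^sup>+x. ennreal (p t x) \<partial>lborel) = 1"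
proof -
  assume t: "t > 0"
  note [measurable] = p_measurable[OF t]
  from heat t have "prob_space (density lborel (\<lambda>x. ennreal (p t x)))"
    by (auto simp: heat_kernel_def Let_def)
  from prob_space.emeasure_space_1[OF this] show ?thesis by (simp add: emeasure_density)
qed

lemma p_integrable: "t > 0 \<Longrightarrow> integrable lborel (p t)"
  using nn_integral_p p_measurable p_nonneg by (intro integrableI_bounded) auto

lemma p_char:
  assumes t: "t > 0"
  shows "(LINT x|lborel. of_real (p t x) * cis (- (\<xi> \<bullet> x))) = exp (- (of_real t * psi \<xi>))"
proof -
  note [measurable] = p_measurable[OF t]
  have "(LINT x|density lborel (\<lambda>x. ennreal (p t x)). cis (- (\<xi> \<bullet> x))) = exp (- (of_real t * psi \<xi>))"
    using heat t by (auto simp: heat_kernel_def Let_def psi_def)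
  then show ?thesis
    by (subst (asm) integral_density) (auto simp: p_nonneg[OF t] scaleR_conv_of_real)
qed

text \<open>
  For \<open>t > 0\<close> the exponential is the characteristic function of a probability measure.
\<close>

lemma norm_exp_psi_le: 
  assumes "t \<ge> 0" shows "norm (exp (- (of_real t * psi \<xi>))) \<le> 1"
proof (cases "t = 0")
  case False
  then have t: "t > 0" using assms by simp
  have "ennreal (norm (exp (- (of_real t * psi \<xi>)))) \<le> (\<integral>\<^sup>+x. ennreal (norm (of_real (p t x) * cis (- (\<xi> \<bullet> x)))) \<partial>lborel)"
    unfolding p_char[OF t, symmetric] by (rule norm_integral_le_nn_integral)
  also have "\<dots> = 1" using nn_integral_p[OF t] p_nonneg[OF t] by (simp add: norm_mult)
  finally show ?thesis by (simp add: ennreal_le_1)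
qed simp

lemma semigroup_conv_measurable:
  assumes t: "t > 0" and [measurable]: "J \<in> borel_measurable borel"
  shows "semigroup_conv p t J \<in> borel_measurable borel"
proof -
  note [measurable] = p_measurable[OF t]
  show ?thesis unfolding semigroup_conv_def by measurable
qed

lemma semigroup_conv_reflect:
  assumes t: "t > 0" and [measurable]: "J \<in> borel_measurable borel"
  shows "semigroup_conv p t J x = (LINT v|lborel. p t v * J (x - v))"
proof -
  note [measurable] = p_measurable[OF t]
  show ?thesis unfolding semigroup_conv_def
    using integral_reflect[of "\<lambda>v. p t v * J (x - v)" x] by simp
qed

lemma semigroup_conv_bound:
  assumes t: "t > 0" and J: "\<And>x. \<bar>J x\<bar> \<le> B" and [measurable]: "J \<in> borel_measurable borel"
  shows "\<bar>semigroup_conv p t J x\<bar> \<le> B"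
proof -
  note [measurable] = p_measurable[OF t]
  have "ennreal (norm (semigroup_conv p t J x)) \<le> (\<integral>\<^sup>+v. ennreal (norm (p t v * J (x - v))) \<partial>lborel)"
    unfolding semigroup_conv_reflect[OF t assms(3)] by (rule norm_integral_le_nn_integral)
  also have "\<dots> \<le> (\<integral>\<^sup>+v. ennreal B * ennreal (p t v) \<partial>lborel)"
  proof (intro nn_integral_mono)
    fix v
    have "0 \<le> B" using J[of x] by linarith
    moreover have "norm (p t v * J (x - v)) \<le> B * p t v"
      using mult_left_mono[OF J[of "x - v"] p_nonneg[OF t, of v]] p_nonneg[OF t, of v] by (simp add: abs_mult mult.commute)
    ultimately show "ennreal (norm (p t v * J (x - v))) \<le> ennreal B * ennreal (p t v)"
      using p_nonneg[OF t] by (simp add: ennreal_mult'[symmetric] ennreal_leI)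
  qed
  also have "\<dots> = ennreal B" by (subst nn_integral_cmult) (simp_all add: nn_integral_p[OF t])
  finally show ?thesis using J[of x] by (subst (asm) ennreal_le_iff) auto
qed

lemma semigroup_conv_continuous:
  assumes t: "t > 0" and J: "\<And>x. \<bar>J x\<bar> \<le> B" and cont: "continuous_on UNIV J"
  shows "continuous_on UNIV (semigroup_conv p t J)"
proof -
  note [measurable] = p_measurable[OF t]
  have [measurable]: "J \<in> borel_measurable borel" using cont by (rule borel_measurable_continuous_onI)
  have "isCont (\<lambda>x. \<integral>v. p t v * J (x - v) \<partial>lborel) x" for x
  proof (rule continuous_at_sequentiallyI)
    fix X assume X: "X \<longlonglongrightarrow> x"
    show "(\<lambda>n. \<integral>v. p t v * J (X n - v) \<partial>lborel) \<longlonglongrightarrow> (LINT v|lborel. p t v * J (x - v))"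
    proof (rule integral_dominated_convergence[where w = "\<lambda>v. p t v * B"])
      show "integrable lborel (\<lambda>v. p t v * B)" using p_integrable[OF t] by simp
      show "AE v in lborel. (\<lambda>n. p t v * J (X n - v)) \<longlonglongrightarrow> p t v * J (x - v)"
      proof (intro AE_I2 tendsto_mult_left)
        fix v
        have "isCont J (x - v)" using cont by (simp add: continuous_on_eq_continuous_at)
        moreover have "(\<lambda>n. X n - v) \<longlonglongrightarrow> x - v" using X by (intro tendsto_intros)
        ultimately show "(\<lambda>n. J (X n - v)) \<longlonglongrightarrow> J (x - v)" by (rule isCont_tendsto_compose)
      qed
      show "AE v in lborel. norm (p t v * J (X n - v)) \<le> p t v * B" for n
        using J p_nonneg[OF t] by (auto intro!: AE_I2 mult_left_mono simp: abs_mult)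
    qed measurable
  qed
  moreover have "semigroup_conv p t J = (\<lambda>x. \<integral>v. p t v * J (x - v) \<partial>lborel)"
    by (rule ext, rule semigroup_conv_reflect[OF t]) measurable
  ultimately show ?thesis by (simp add: continuous_on_eq_continuous_at)
qed

text \<open>
  Young's inequality for a probability density.
\<close>

lemma semigroup_conv_L1:
  assumes t: "t > 0" and [measurable]: "J \<in> borel_measurable borel"
  shows "(\<integral>\<^sup>+x. ennreal \<bar>semigroup_conv p t J x\<bar> \<partial>lborel) \<le> (\<integral>\<^sup>+x. ennreal \<bar>J x\<bar> \<partial>lborel)"
proof -
  note [measurable] = p_measurable[OF t]
  have "(\<integral>\<^sup>+x. ennreal \<bar>semigroup_conv p t J x\<bar> \<partial>lborel)
    \<le> (\<integral>\<^sup>+x. (\<integral>\<^sup>+v. ennreal (norm (p t v * J (x - v))) \<partial>lborel) \<partial>lborel)"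
  proof (rule nn_integral_mono)
    fix x
    show "ennreal \<bar>semigroup_conv p t J x\<bar> \<le> (\<integral>\<^sup>+v. ennreal (norm (p t v * J (x - v))) \<partial>lborel)"
      using norm_integral_le_nn_integral[of lborel "\<lambda>v. p t v * J (x - v)"]
      unfolding semigroup_conv_reflect[OF t assms(2)] by simp
  qed
  also have "\<dots> = (\<integral>\<^sup>+v. (\<integral>\<^sup>+x. ennreal (norm (p t v * J (x - v))) \<partial>lborel) \<partial>lborel)"
    by (rule lborel_pair.Fubini') measurable
  also have "\<dots> = (\<integral>\<^sup>+v. ennreal (p t v) * (\<integral>\<^sup>+x. ennreal \<bar>J x\<bar> \<partial>lborel) \<partial>lborel)"
  proof (rule nn_integral_cong)
    fix v
    have "(\<integral>\<^sup>+x. ennreal (norm (p t v * J (x - v))) \<partial>lborel) = (\<integral>\<^sup>+x. ennreal (p t v) * ennreal \<bar>J (- v + x)\<bar> \<partial>lborel)"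
      using p_nonneg[OF t, of v] by (simp add: abs_mult ennreal_mult)
    also have "\<dots> = ennreal (p t v) * (\<integral>\<^sup>+x. ennreal \<bar>J (- v + x)\<bar> \<partial>lborel)"
      by (rule nn_integral_cmult) measurable
    also have "(\<integral>\<^sup>+x. ennreal \<bar>J (- v + x)\<bar> \<partial>lborel) = (\<integral>\<^sup>+x. ennreal \<bar>J x\<bar> \<partial>lborel)"
      by (rule nn_integral_translate[of "\<lambda>x. ennreal \<bar>J x\<bar>"]) measurable
    finally show "(\<integral>\<^sup>+x. ennreal (norm (p t v * J (x - v))) \<partial>lborel) = ennreal (p t v) * (\<integral>\<^sup>+x. ennreal \<bar>J x\<bar> \<partial>lborel)" .
  qed
  also have "\<dots> = (\<integral>\<^sup>+x. ennreal \<bar>J x\<bar> \<partial>lborel)"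
    by (subst nn_integral_multc) (simp_all add: nn_integral_p[OF t])
  finally show ?thesis .
qed

text \<open>
  The semigroup acts by a convolution, so it can be moved from a bounded function to an integrable
  mollifier.
\<close>

lemma convolution_associative:
  assumes t: "t > 0" and J: "integrable lborel J" and \<phi>: "\<And>x. \<bar>\<phi> x\<bar> \<le> B" 
    and \<phi>m [measurable]: "\<phi> \<in> borel_measurable borel"
  shows "(conv J (semigroup_conv p t \<phi>) x) = (conv (semigroup_conv p t J) \<phi> x)"
proof -
  note [measurable] = p_measurable[OF t]
  have [measurable]: "J \<in> borel_measurable borel" using J by auto
  have B: "B \<ge> 0" using \<phi>[of 0] by linarith
  let ?F = "\<lambda>y w. J (x - y) * (p t (y - w) * \<phi> w)"
  have "(LINT w|lborel. (LINT y|lborel. ?F y w)) = (LINT y|lborel. (LINT w|lborel. ?F y w))"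
  proof (rule lborel_pair.Fubini_bounded_sections(2)[where b = "\<lambda>y. \<bar>J (x - y)\<bar> * B"])
    show "integrable lborel (\<lambda>y. \<bar>J (x - y)\<bar> * B)"
      using integrable_reflect[of "\<lambda>y. \<bar>J y\<bar>" x] J by simp
    fix y
    have "(\<integral>\<^sup>+w. ennreal (norm (?F y w)) \<partial>lborel) \<le> (\<integral>\<^sup>+w. ennreal (\<bar>J (x - y)\<bar> * B) * ennreal (p t (y - w)) \<partial>lborel)"
    proof (rule nn_integral_mono)
      fix w
      have "norm (?F y w) = \<bar>J (x - y)\<bar> * (p t (y - w) * \<bar>\<phi> w\<bar>)" using p_nonneg[OF t] by (simp add: abs_mult)
      also have "\<dots> \<le> \<bar>J (x - y)\<bar> * (p t (y - w) * B)" using \<phi>[of w] p_nonneg[OF t] by (intro mult_left_mono) auto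
      finally show "ennreal (norm (?F y w)) \<le> ennreal (\<bar>J (x - y)\<bar> * B) * ennreal (p t (y - w))"
        using B p_nonneg[OF t] by (simp add: ennreal_mult[symmetric] ennreal_leI mult_ac)
    qed
    also have "\<dots> = ennreal (\<bar>J (x - y)\<bar> * B) * (\<integral>\<^sup>+w. ennreal (p t (y - w)) \<partial>lborel)"
      by (rule nn_integral_cmult) measurable
    also have "(\<integral>\<^sup>+w. ennreal (p t (y - w)) \<partial>lborel) = 1"
      using nn_integral_reflect[of "\<lambda>w. ennreal (p t w)" y] nn_integral_p[OF t] by simp
    finally show "(\<integral>\<^sup>+w. ennreal (norm (?F y w)) \<partial>lborel) \<le> ennreal (\<bar>J (x - y)\<bar> * B)" by simp
  qed measurable
  moreover have "(\<lambda>y. \<integral>w. ?F y w \<partial>lborel) = (\<lambda>y. J (x - y) * semigroup_conv p t \<phi> y)"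
    unfolding semigroup_conv_def by simp
  moreover have "(\<lambda>w. \<integral>y. ?F y w \<partial>lborel) = (\<lambda>w. semigroup_conv p t J (x - w) * \<phi> w)"
  proof
    fix w
    have "(LINT y|lborel. ?F y w) = (LINT y|lborel. p t (y - w) * J (x - y) * \<phi> w)" by (simp add: mult_ac)
    also have "\<dots> = (LINT y|lborel. p t (y - w) * J (x - y)) * \<phi> w" by simp
    also have "(LINT y|lborel. p t (y - w) * J (x - y)) = (LINT v|lborel. p t v * J (x - w - v))"
      using integral_translate[of "\<lambda>y. p t (y - w) * J (x - y)" w] by (simp add: diff_diff_eq)
    finally show "(LINT y|lborel. ?F y w) = semigroup_conv p t J (x - w) * \<phi> w"
      by (simp add: semigroup_conv_reflect[OF t])
  qed
  ultimately show ?thesis by metis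
qed

end

text \<open>
  A Gaussian together with its spectral measure \<open>\<Gamma>\<close>.
\<close>

locale gaussian_spectrum = levy_heat \<mu> p for \<mu> :: "(real^'d) measure" and p +
  fixes a :: real and \<Gamma> :: "(real^'d) measure"
  assumes a: "a > 0" and prob: "prob_space \<Gamma>" and sets_\<Gamma> [simp, measurable_cong]: "sets \<Gamma> = sets borel"
    and second_moment: "integrable \<Gamma> (\<lambda>\<xi>. (norm \<xi>)\<^sup>2)"
    and char_\<Gamma>: "\<And>y. (LINT \<xi>|\<Gamma>. cis (y \<bullet> \<xi>)) = of_real (gaussian a y)"
begin

sublocale \<Gamma>: prob_space \<Gamma> by (rule prob)

definition superpose :: "(real^'d \<Rightarrow> complex) \<Rightarrow> real^'d \<Rightarrow> complex" where
  "superpose m w = (LINT \<xi>|\<Gamma>. cis (w \<bullet> \<xi>) * m \<xi>)"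

lemma gaussian_superpose: "of_real (gaussian a w) = superpose (\<lambda>_. 1) w"
  unfolding superpose_def by (simp add: char_\<Gamma>)

lemma weight_integrable: "integrable \<Gamma> (\<lambda>\<xi>. (2 + (norm \<xi>)\<^sup>2) * c)"
  using second_moment by simp

lemma cis_bound_integrable:
  assumes [measurable]: "m \<in> borel_measurable borel" and "\<And>\<xi>. norm (m \<xi>) \<le> (2 + (norm \<xi>)\<^sup>2) * c"
  shows "integrable \<Gamma> (\<lambda>\<xi>. cis (w \<bullet> \<xi>) * m \<xi>)" "integrable \<Gamma> m"
proof -
  have m: "norm (m \<xi>) \<le> norm ((2 + (norm \<xi>)\<^sup>2) * c)" for \<xi>
    using order_trans[OF assms(2) abs_ge_self] by simp
  show "integrable \<Gamma> (\<lambda>\<xi>. cis (w \<bullet> \<xi>) * m \<xi>)"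
    by (rule Bochner_Integration.integrable_bound[OF weight_integrable[of c]], measurable)
       (simp only: norm_mult[of "cis _"] norm_cis mult_1 m AE_I2)
  show "integrable \<Gamma> m"
    by (rule Bochner_Integration.integrable_bound[OF weight_integrable[of c]], measurable)
       (simp only: m AE_I2)
qed

text \<open>
  A character is an eigenfunction of the Levy operator with eigenvalue \<open>-\<psi>(\<xi>)\<close>; integrate over \<open>\<xi>\<close> and
  exchange this with the integral over the jumps.
\<close>

lemma gaussian_jumps_superpose: "of_real (gaussian_jumps a w) = superpose (\<lambda>\<xi>. - psi \<xi>) w"
proof -
  interpret pair_sigma_finite \<Gamma> \<mu> ..
  let ?F = "\<lambda>\<xi> z. cis (w \<bullet> \<xi>) * - symbol_integrand \<xi> z"
  have "(LINT z|\<mu>. (LINT \<xi>|\<Gamma>. ?F \<xi> z)) = (LINT \<xi>|\<Gamma>. (LINT z|\<mu>. ?F \<xi> z))"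
  proof (rule Fubini_bounded_sections(2)[OF _ _ weight_integrable[of levy_mass]])
    show "(\<integral>\<^sup>+z. ennreal (norm (?F \<xi> z)) \<partial>\<mu>) \<le> ennreal ((2 + (norm \<xi>)\<^sup>2) * levy_mass)" for \<xi>
      using symbol_integrand_nn[of \<xi>] by (simp only: norm_mult norm_minus_cancel norm_cis mult_1)
    show "(\<lambda>(\<xi>, z). ?F \<xi> z) \<in> borel_measurable (\<Gamma> \<Otimes>\<^sub>M \<mu>)"
      unfolding case_prod_beta by measurable
  qed
  also have "\<dots> = superpose (\<lambda>\<xi>. - psi \<xi>) w"
    unfolding superpose_def psi_eq
    by (intro Bochner_Integration.integral_cong refl) (simp only: integral_mult_right_zero integral_minus)
  also have "(LINT z|\<mu>. (LINT \<xi>|\<Gamma>. ?F \<xi> z)) = (LINT z|\<mu>. of_real (jump (gaussian a) (gaussian_grad a) w z))"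
  proof (intro Bochner_Integration.integral_cong refl)
    fix z :: "real^'d"
    have i1: "integrable \<Gamma> (\<lambda>\<xi>. cis (y \<bullet> \<xi>))" for y
      by (rule \<Gamma>.integrable_const_bound[where B = 1]) auto
    have le: "norm (\<i> * of_real (z \<bullet> \<xi>)) \<le> (2 + (norm \<xi>)\<^sup>2) * norm z" for \<xi>
    proof -
      have "norm (\<i> * of_real (z \<bullet> \<xi>)) \<le> norm z * norm \<xi>"
        using Cauchy_Schwarz_ineq2[of z \<xi>] by (simp add: norm_mult)
      also have "\<dots> \<le> norm z * (2 + (norm \<xi>)\<^sup>2)"
        using le_one_plus_square[of "norm \<xi>"] by (intro mult_left_mono) auto
      finally show ?thesis by (simp add: mult.commute)
    qed
    have i2: "integrable \<Gamma> (\<lambda>\<xi>. cis (w \<bullet> \<xi>) * (\<i> * of_real (z \<bullet> \<xi>)))"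
      by (rule cis_bound_integrable[OF _ le]) measurable
    have "(LINT \<xi>|\<Gamma>. ?F \<xi> z) = (LINT \<xi>|\<Gamma>. cis ((w + z) \<bullet> \<xi>) - cis (w \<bullet> \<xi>) - of_real (indicator (ball 0 1) z) * (cis (w \<bullet> \<xi>) * (\<i> * of_real (z \<bullet> \<xi>))))"
      by (intro Bochner_Integration.integral_cong refl)
         (simp add: inner_add_left cis_mult[symmetric] inner_commute[of _ z] algebra_simps)
    also have "\<dots> = of_real (gaussian a (w + z)) - of_real (gaussian a w) - of_real (indicator (ball 0 1) z) * of_real (gaussian_grad a w \<bullet> z)"
      using i1 i2 by (simp add: char_\<Gamma> gaussian_grad_characters[OF prob sets_\<Gamma> second_moment char_\<Gamma>])
    finally show "(LINT \<xi>|\<Gamma>. ?F \<xi> z) = of_real (jump (gaussian a) (gaussian_grad a) w z)"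
      by (simp add: jump_def)
  qed
  also have "\<dots> = of_real (gaussian_jumps a w)" unfolding gaussian_jumps_def by (rule integral_complex_of_real)
  finally show ?thesis .
qed

text \<open>
  A character is an eigenfunction of the semigroup with eigenvalue \<open>exp(-t \<psi>(\<xi>))\<close>.
\<close>

lemma heat_superpose:
  assumes t: "t > 0" and [measurable]: "m \<in> borel_measurable borel" "J \<in> borel_measurable borel"
    and m: "\<And>\<xi>. norm (m \<xi>) \<le> (2 + (norm \<xi>)\<^sup>2) * c"
    and J: "\<And>w. of_real (J w) = superpose m w"
  shows "of_real (semigroup_conv p t J w) = superpose (\<lambda>\<xi>. m \<xi> * exp (- (of_real t * psi \<xi>))) w"
proof -
  note [measurable] = p_measurable[OF t]
  interpret pair_sigma_finite \<Gamma> "lborel :: (real^'d) measure" ..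
  let ?F = "\<lambda>\<xi> v. of_real (p t v) * (cis ((w - v) \<bullet> \<xi>) * m \<xi>)"
  have "(LINT v|lborel. (LINT \<xi>|\<Gamma>. ?F \<xi> v)) = (LINT \<xi>|\<Gamma>. (LINT v|lborel. ?F \<xi> v))"
  proof (rule Fubini_bounded_sections(2)[OF _ _ weight_integrable[of c]])
    fix \<xi>
    have "(\<integral>\<^sup>+v. ennreal (norm (?F \<xi> v)) \<partial>lborel) = (\<integral>\<^sup>+v. ennreal (p t v) * ennreal (norm (m \<xi>)) \<partial>lborel)"
      using p_nonneg[OF t] by (simp add: norm_mult ennreal_mult)
    also have "\<dots> = ennreal (norm (m \<xi>))"
      by (subst nn_integral_multc) (simp_all add: nn_integral_p[OF t])
    finally show "(\<integral>\<^sup>+v. ennreal (norm (?F \<xi> v)) \<partial>lborel) \<le> ennreal ((2 + (norm \<xi>)\<^sup>2) * c)"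
      using m[of \<xi>] by (simp add: ennreal_leI)
  qed measurable
  also have "(LINT v|lborel. (LINT \<xi>|\<Gamma>. ?F \<xi> v)) = (LINT v|lborel. of_real (p t v * J (w - v)))"
    by (simp add: J superpose_def)
  also have "\<dots> = of_real (semigroup_conv p t J w)"
    unfolding semigroup_conv_reflect[OF t assms(3)] by (rule integral_complex_of_real)
  also have "(LINT \<xi>|\<Gamma>. (LINT v|lborel. ?F \<xi> v)) = superpose (\<lambda>\<xi>. m \<xi> * exp (- (of_real t * psi \<xi>))) w"
    unfolding superpose_def
  proof (intro Bochner_Integration.integral_cong refl)
    fix \<xi>
    have "?F \<xi> v = (cis (w \<bullet> \<xi>) * m \<xi>) * (of_real (p t v) * cis (- (\<xi> \<bullet> v)))" for v
    proof -
      have "cis ((w - v) \<bullet> \<xi>) = cis (w \<bullet> \<xi>) * cis (- (\<xi> \<bullet> v))"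
        by (simp add: cis_mult inner_diff_left inner_commute[of v])
      then show ?thesis by simp
    qed
    then have "(LINT v|lborel. ?F \<xi> v) = (cis (w \<bullet> \<xi>) * m \<xi>) * (LINT v|lborel. of_real (p t v) * cis (- (\<xi> \<bullet> v)))"
      by (simp only: integral_mult_right_zero)
    then show "(LINT v|lborel. ?F \<xi> v) = cis (w \<bullet> \<xi>) * (m \<xi> * exp (- (of_real t * psi \<xi>)))"
      unfolding p_char[OF t] by (simp add: mult.assoc)
  qed
  finally show ?thesis by simp
qed

lemma heat_gaussian:
  assumes "t > 0"
  shows "of_real (semigroup_conv p t (gaussian a) w) = superpose (\<lambda>\<xi>. exp (- (of_real t * psi \<xi>))) w"
  using heat_superpose[OF assms, of "\<lambda>_. 1" "gaussian a" 1 w] by (simp add: gaussian_superpose)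

text \<open>
  The function \<open>P\<^sub>s(L G)\<close>, defined by its spectral representation. Unlike the convolution with
  \<open>p s\<close>, this expression is visibly measurable jointly in \<open>s\<close> and \<open>w\<close>.
\<close>

definition heat_jumps :: "real \<Rightarrow> real^'d \<Rightarrow> real" where
  "heat_jumps s w = Re (superpose (\<lambda>\<xi>. - psi \<xi> * exp (- (of_real s * psi \<xi>))) w)"

lemma heat_jumps_eq:
  assumes "s > 0"
  shows "semigroup_conv p s (gaussian_jumps a) w = heat_jumps s w"
    and "of_real (heat_jumps s w) = superpose (\<lambda>\<xi>. - psi \<xi> * exp (- (of_real s * psi \<xi>))) w"
proof -
  have *: "of_real (semigroup_conv p s (gaussian_jumps a) w) = superpose (\<lambda>\<xi>. - psi \<xi> * exp (- (of_real s * psi \<xi>))) w"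
    by (rule heat_superpose[OF assms _ _ _ gaussian_jumps_superpose, where c = levy_mass])
       (use psi_bound in \<open>auto\<close>)
  then show 1: "semigroup_conv p s (gaussian_jumps a) w = heat_jumps s w"
    unfolding heat_jumps_def by (metis Re_complex_of_real)
  show "of_real (heat_jumps s w) = superpose (\<lambda>\<xi>. - psi \<xi> * exp (- (of_real s * psi \<xi>))) w"
    using * unfolding 1 .
qed

lemma heat_jumps_measurable [measurable (raw)]:
  assumes [measurable]: "f \<in> borel_measurable M" "h \<in> borel_measurable M"
  shows "(\<lambda>x. heat_jumps (f x) (h x)) \<in> borel_measurable M"
proof -
  have "(\<lambda>x. \<integral>\<xi>. cis (h x \<bullet> \<xi>) * (- psi \<xi> * exp (- (of_real (f x) * psi \<xi>))) \<partial>\<Gamma>) \<in> borel_measurable M"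
    by measurable
  then show ?thesis unfolding heat_jumps_def superpose_def by measurable
qed

lemma exp_psi_FTC:
  assumes t: "t > 0"
  shows "(LINT s|lborel. indicator {0<..<t} s *\<^sub>R (- psi \<xi> * exp (- (of_real s * psi \<xi>)))) = exp (- (of_real t * psi \<xi>)) - 1"
proof -
  have "(LBINT s=ereal 0..ereal t. - psi \<xi> * exp (- (of_real s * psi \<xi>))) = exp (- (of_real t * psi \<xi>)) - exp (- (of_real 0 * psi \<xi>))"
  proof (rule interval_integral_FTC_finite)
    show "continuous_on {min 0 t..max 0 t} (\<lambda>s. - psi \<xi> * exp (- (of_real s * psi \<xi>)))"
      by (intro continuous_intros)
    fix s
    show "((\<lambda>s. exp (- (of_real s * psi \<xi>))) has_vector_derivative - psi \<xi> * exp (- (of_real s * psi \<xi>))) (at s within {min 0 t..max 0 t})"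
      by (auto intro!: derivative_eq_intros has_vector_derivative_real_field simp: mult_ac)
  qed
  then show ?thesis using t
    by (simp add: interval_lebesgue_integral_def set_lebesgue_integral_def zero_ereal_def einterval_eq)
qed

text \<open>
  By the two spectral representations this is the identity
  \<open>exp(-t \<psi>) - 1 = \<integral>\<^sub>0\<^sup>t -\<psi> exp(-s \<psi>) ds\<close>, integrated over \<open>\<xi>\<close>.
\<close>

lemma Dynkin_gaussian:
  assumes t: "t > 0"
  shows "semigroup_conv p t (gaussian a) w - gaussian a w = (time_int t (\<lambda>s. heat_jumps s w))"
proof -
  interpret pair_sigma_finite \<Gamma> "lborel :: real measure" ..
  let ?F = "\<lambda>\<xi> s. cis (w \<bullet> \<xi>) * (indicator {0<..<t} s *\<^sub>R (- psi \<xi> * exp (- (of_real s * psi \<xi>))))"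
  have "(LINT s|lborel. (LINT \<xi>|\<Gamma>. ?F \<xi> s)) = (LINT \<xi>|\<Gamma>. (LINT s|lborel. ?F \<xi> s))"
  proof (rule Fubini_bounded_sections(2)[OF _ _ weight_integrable[of "levy_mass * t"]])
    fix \<xi>
    have "norm (?F \<xi> s) \<le> (2 + (norm \<xi>)\<^sup>2) * levy_mass * indicator {0<..<t} s" for s
    proof (cases "s \<in> {0<..<t}")
      case True
      then have "norm (?F \<xi> s) = norm (psi \<xi>) * norm (exp (- (of_real s * psi \<xi>)))" by (simp add: norm_mult)
      also have "\<dots> \<le> ((2 + (norm \<xi>)\<^sup>2) * levy_mass) * 1"
        using True levy_mass_nonneg by (intro mult_mono psi_bound norm_exp_psi_le) auto
      finally show ?thesis using True by simp
    qed simp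
    then have "(\<integral>\<^sup>+s. ennreal (norm (?F \<xi> s)) \<partial>lborel) \<le> (\<integral>\<^sup>+s. ennreal ((2 + (norm \<xi>)\<^sup>2) * levy_mass * indicator {0<..<t} s) \<partial>lborel)"
      by (intro nn_integral_mono ennreal_leI)
    also have "\<dots> = (\<integral>\<^sup>+s. ennreal ((2 + (norm \<xi>)\<^sup>2) * levy_mass) * indicator {0<..<t} s \<partial>lborel)"
      using levy_mass_nonneg by (intro nn_integral_cong) (auto simp: indicator_def)
    also have "\<dots> = ennreal ((2 + (norm \<xi>)\<^sup>2) * (levy_mass * t))"
      using t levy_mass_nonneg by (simp add: nn_integral_cmult_indicator ennreal_mult[symmetric] mult.assoc)
    finally show "(\<integral>\<^sup>+s. ennreal (norm (?F \<xi> s)) \<partial>lborel) \<le> ennreal ((2 + (norm \<xi>)\<^sup>2) * (levy_mass * t))" .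
  qed measurable
  also have "(LINT s|lborel. (LINT \<xi>|\<Gamma>. ?F \<xi> s)) = (LINT s|lborel. of_real (indicator {0<..<t} s * heat_jumps s w))"
  proof (intro Bochner_Integration.integral_cong refl)
    fix s
    have "(LINT \<xi>|\<Gamma>. ?F \<xi> s) = indicator {0<..<t} s *\<^sub>R superpose (\<lambda>\<xi>. - psi \<xi> * exp (- (of_real s * psi \<xi>))) w"
      unfolding superpose_def by (simp only: mult_scaleR_right integral_scaleR_right)
    also have "\<dots> = of_real (indicator {0<..<t} s * heat_jumps s w)"
      by (cases "s \<in> {0<..<t}") (simp_all add: heat_jumps_eq(2))
    finally show "(LINT \<xi>|\<Gamma>. ?F \<xi> s) = of_real (indicator {0<..<t} s * heat_jumps s w)" .
  qed
  also have "\<dots> = of_real (time_int t (\<lambda>s. heat_jumps s w))" by (rule integral_complex_of_real)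
  also have "(LINT \<xi>|\<Gamma>. (LINT s|lborel. ?F \<xi> s)) = (LINT \<xi>|\<Gamma>. cis (w \<bullet> \<xi>) * exp (- (of_real t * psi \<xi>)) - cis (w \<bullet> \<xi>))"
    by (simp only: integral_mult_right_zero exp_psi_FTC[OF t] right_diff_distrib mult_1_right)
  also have "\<dots> = superpose (\<lambda>\<xi>. exp (- (of_real t * psi \<xi>))) w - superpose (\<lambda>_. 1) w"
  proof -
    have "integrable \<Gamma> (\<lambda>\<xi>. cis (w \<bullet> \<xi>) * exp (- (of_real t * psi \<xi>)))"
      by (rule \<Gamma>.integrable_const_bound[where B = 1])
         (use norm_exp_psi_le[of t] t in \<open>auto simp: norm_mult\<close>)
    moreover have "integrable \<Gamma> (\<lambda>\<xi>. cis (w \<bullet> \<xi>))"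
      by (rule \<Gamma>.integrable_const_bound[where B = 1]) auto
    ultimately show ?thesis unfolding superpose_def by simp
  qed
  also have "\<dots> = of_real (semigroup_conv p t (gaussian a) w - gaussian a w)"
    by (simp add: heat_gaussian[OF t] gaussian_superpose)
  finally have "complex_of_real (time_int t (\<lambda>s. heat_jumps s w)) = of_real (semigroup_conv p t (gaussian a) w - gaussian a w)" .
  then show ?thesis using of_real_eq_iff by (metis (no_types, lifting))
qed

end


section \<open>The mollified Duhamel formula\<close>

lemma integrable_conv_bounded:
  fixes J \<phi> :: "real^'d \<Rightarrow> real"
  assumes J: "integrable lborel J" and \<phi>: "\<And>y. \<bar>\<phi> y\<bar> \<le> B" "\<phi> \<in> borel_measurable borel"
  shows "integrable lborel (\<lambda>y. J (x - y) * \<phi> y)"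
    and "\<bar>\<integral>y. J (x - y) * \<phi> y \<partial>lborel\<bar> \<le> B * (LINT y|lborel. \<bar>J y\<bar>)"
    and "(\<integral>\<^sup>+y. ennreal \<bar>J (x - y) * \<phi> y\<bar> \<partial>lborel) \<le> ennreal (B * (LINT y|lborel. \<bar>J y\<bar>))"
proof -
  have [measurable]: "J \<in> borel_measurable borel" "\<phi> \<in> borel_measurable borel" using J \<phi> by auto
  have B: "B \<ge> 0" using \<phi>(1)[of 0] by linarith
  have iJ: "integrable lborel (\<lambda>y. \<bar>J (x - y)\<bar>)" using integrable_reflect[of "\<lambda>y. \<bar>J y\<bar>" x] J by simp
  have le: "\<bar>J (x - y) * \<phi> y\<bar> \<le> B * \<bar>J (x - y)\<bar>" for y
    using mult_left_mono[OF \<phi>(1)[of y] abs_ge_zero[of "J (x - y)"]] by (simp add: abs_mult mult.commute)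
  have iB: "integrable lborel (\<lambda>y. B * \<bar>J (x - y)\<bar>)" using iJ by simp
  show i: "integrable lborel (\<lambda>y. J (x - y) * \<phi> y)"
    by (rule Bochner_Integration.integrable_bound[OF iB]) (use le B in \<open>auto intro!: AE_I2\<close>)
  have refl: "(LINT y|lborel. \<bar>J (x - y)\<bar>) = (LINT y|lborel. \<bar>J y\<bar>)"
    by (rule integral_reflect) measurable
  have val: "(LINT y|lborel. B * \<bar>J (x - y)\<bar>) = B * (LINT y|lborel. \<bar>J y\<bar>)"
    by (simp add: refl)
  have "\<bar>\<integral>y. J (x - y) * \<phi> y \<partial>lborel\<bar> \<le> (LINT y|lborel. \<bar>J (x - y) * \<phi> y\<bar>)" by (rule integral_abs_bound)
  also have "\<dots> \<le> (LINT y|lborel. B * \<bar>J (x - y)\<bar>)"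
    using i iB le by (intro integral_mono) auto
  finally show "\<bar>\<integral>y. J (x - y) * \<phi> y \<partial>lborel\<bar> \<le> B * (LINT y|lborel. \<bar>J y\<bar>)" unfolding val .
  have "(\<integral>\<^sup>+y. ennreal \<bar>J (x - y) * \<phi> y\<bar> \<partial>lborel) \<le> (\<integral>\<^sup>+y. ennreal (B * \<bar>J (x - y)\<bar>) \<partial>lborel)"
    using le by (intro nn_integral_mono ennreal_leI)
  also have "\<dots> = ennreal (B * (LINT y|lborel. \<bar>J y\<bar>))"
    using iB B by (subst nn_integral_eq_integral) (auto simp: refl)
  finally show "(\<integral>\<^sup>+y. ennreal \<bar>J (x - y) * \<phi> y\<bar> \<partial>lborel) \<le> ennreal (B * (LINT y|lborel. \<bar>J y\<bar>))" .
qed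

lemma integrable_bounded_interval:
  fixes h :: "real \<Rightarrow> real"
  assumes [measurable]: "h \<in> borel_measurable borel" and h: "\<And>s. s \<in> {0<..<t} \<Longrightarrow> \<bar>h s\<bar> \<le> B"
  shows "integrable lborel (\<lambda>s. indicator {0<..<t} s * h s)"
    and "\<bar>\<integral>s. indicator {0<..<t} s * h s \<partial>lborel\<bar> \<le> \<bar>B\<bar> * \<bar>t\<bar>"
    and "(\<integral>\<^sup>+s. ennreal \<bar>indicator {0<..<t} s * h s\<bar> \<partial>lborel) \<le> ennreal (\<bar>B\<bar> * \<bar>t\<bar>)"
proof -
  have h': "\<bar>h s\<bar> \<le> \<bar>B\<bar>" if "s \<in> {0<..<t}" for s
    using h[OF that] by linarith
  have fin: "emeasure lborel {0<..<t} \<le> ennreal \<bar>t\<bar>" by (cases "0 \<le> t") auto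
  have n: "(\<integral>\<^sup>+s. ennreal \<bar>indicator {0<..<t} s * h s\<bar> \<partial>lborel) \<le> ennreal \<bar>B\<bar> * emeasure lborel {0<..<t}"
  proof -
    have "(\<integral>\<^sup>+s. ennreal \<bar>indicator {0<..<t} s * h s\<bar> \<partial>lborel) \<le> (\<integral>\<^sup>+s. ennreal \<bar>B\<bar> * indicator {0<..<t} s \<partial>lborel)"
      using h' by (intro nn_integral_mono) (auto simp: indicator_def intro!: ennreal_leI)
    then show ?thesis by (simp add: nn_integral_cmult_indicator)
  qed
  also have "\<dots> \<le> ennreal \<bar>B\<bar> * ennreal \<bar>t\<bar>" by (intro mult_left_mono fin) auto
  also have "\<dots> = ennreal (\<bar>B\<bar> * \<bar>t\<bar>)" by (simp add: ennreal_mult)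
  finally show n: "(\<integral>\<^sup>+s. ennreal \<bar>indicator {0<..<t} s * h s\<bar> \<partial>lborel) \<le> ennreal (\<bar>B\<bar> * \<bar>t\<bar>)" .
  show "integrable lborel (\<lambda>s. indicator {0<..<t} s * h s)"
    using n by (intro integrableI_bounded) (auto intro: le_less_trans)
  have "ennreal (norm (time_int t h)) \<le> (\<integral>\<^sup>+s. ennreal (norm (indicator {0<..<t} s * h s)) \<partial>lborel)"
    by (rule norm_integral_le_nn_integral)
  then have "ennreal \<bar>\<integral>s. indicator {0<..<t} s * h s \<partial>lborel\<bar> \<le> ennreal (\<bar>B\<bar> * \<bar>t\<bar>)"
    using order_trans[OF _ n] by simp
  then show "\<bar>\<integral>s. indicator {0<..<t} s * h s \<partial>lborel\<bar> \<le> \<bar>B\<bar> * \<bar>t\<bar>"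
    by (subst (asm) ennreal_le_iff) auto
qed

text \<open>
  The nonlinearity enters as a given bounded source \<open>f\<close>, extended to all times (by zero outside
  \<open>{0<..<T}\<close> in the application), so that \<open>f\<close> is a measurable function on the whole product space.
\<close>

locale duhamel = levy_heat \<mu> p for \<mu> :: "(real^'d) measure" and p +
  fixes T B :: real and u f :: "real \<Rightarrow> real^'d \<Rightarrow> real"
  assumes T: "T > 0"
    and f_measurable [measurable]: "(\<lambda>z. f (fst z) (snd z)) \<in> borel_measurable (borel \<Otimes>\<^sub>M borel)"
    and f_bound: "\<And>s y. \<bar>f s y\<bar> \<le> B"
    and f_continuous: "\<And>s. continuous_on UNIV (f s)"
    and u0_measurable [measurable]: "u 0 \<in> borel_measurable borel"
    and u0_bound: "\<And>y. \<bar>u 0 y\<bar> \<le> B"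
    and duhamel_integrable: "\<And>t x. t \<in> {0<..T} \<Longrightarrow> set_integrable lborel {0<..<t} (\<lambda>s. semigroup_conv p (t - s) (f s) x)"
    and duhamel: "\<And>t x. t \<in> {0<..T} \<Longrightarrow> u t x = semigroup_conv p t (u 0) x
       + (LINT s:{0<..<t}|lborel. semigroup_conv p (t - s) (f s) x)"
begin

lemma B_nonneg: "B \<ge> 0"
  using u0_bound[of 0] by linarith

lemma f_slice [measurable]: "f s \<in> borel_measurable borel"
  using f_continuous by (rule borel_measurable_continuous_onI)

lemma f_compose [measurable (raw)]:
  assumes [measurable]: "g \<in> borel_measurable M" "h \<in> borel_measurable M"
  shows "(\<lambda>x. f (g x) (h x)) \<in> borel_measurable M"
proof -
  have "(\<lambda>x. (g x, h x)) \<in> M \<rightarrow>\<^sub>M borel \<Otimes>\<^sub>M borel" by measurable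
  from measurable_compose[OF this f_measurable] show ?thesis by simp
qed

text \<open>
  Convolve the Duhamel formula with an integrable kernel and move the semigroup onto the kernel.
\<close>

lemma duhamel_convolved:
  assumes t: "t \<in> {0<..T}" and J: "integrable lborel J"
  shows "(conv J (u t) x) = (conv (semigroup_conv p t J) (u 0) x)
     + (time_int t (\<lambda>s. conv (semigroup_conv p (t - s) J) (f s) x))"
proof -
  have t0: "t > 0" using t by simp
  have [measurable]: "J \<in> borel_measurable borel" using J by auto
  \<comment> \<open>Continuous in \<open>y\<close>, and measurable in \<open>s\<close> by the integrability that is part of the mild formulation.\<close>
  define S where "S s y = indicator {0<..<t} s * semigroup_conv p (t - s) (f s) y" for s y
  have S_meas: "(\<lambda>z. S (fst z) (snd z)) \<in> borel_measurable (borel \<Otimes>\<^sub>M borel)"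
  proof (rule Caratheodory_measurable)
    fix y
    have "integrable lborel (\<lambda>s. S s y)"
      using duhamel_integrable[OF t, of y] by (simp add: set_integrable_def S_def)
    then show "(\<lambda>s. S s y) \<in> borel_measurable borel" by auto
  next
    fix s
    show "continuous_on UNIV (S s)"
    proof (cases "s \<in> {0<..<t}")
      case True
      then have "continuous_on UNIV (semigroup_conv p (t - s) (f s))"
        by (intro semigroup_conv_continuous[OF _ f_bound f_continuous]) auto
      then show ?thesis using True by (simp add: S_def[abs_def])
    qed (simp add: S_def[abs_def])
  qed
  have S_comp [measurable (raw)]: "(\<lambda>x. S (g x) (h x)) \<in> borel_measurable M"
    if [measurable]: "g \<in> borel_measurable M" "h \<in> borel_measurable M" for g h and M :: "'x measure"
    using measurable_compose[OF _ S_meas, of "\<lambda>x. (g x, h x)" M] by simp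
  have S_bound: "\<bar>S s y\<bar> \<le> B" for s y
    using semigroup_conv_bound[OF _ f_bound f_slice, of "t - s" s y] B_nonneg
    by (cases "s \<in> {0<..<t}") (auto simp: S_def)
  define S1 where "S1 y = (LINT s|lborel. S s y)" for y
  have S1_meas [measurable]: "S1 \<in> borel_measurable borel" unfolding S1_def[abs_def] by measurable
  have S_ind: "indicator {0<..<t} s * S s y = S s y" for s y by (simp add: S_def indicator_def)
  have S_nn: "(\<integral>\<^sup>+s. ennreal \<bar>S s y\<bar> \<partial>lborel) \<le> ennreal (B * t)" for y
    using integrable_bounded_interval(3)[of "\<lambda>s. S s y" t B] S_bound B_nonneg t0 by (simp add: S_ind)
  have S1_bound: "\<bar>S1 y\<bar> \<le> B * t" for y
    using integrable_bounded_interval(2)[of "\<lambda>s. S s y" t B] S_bound B_nonneg t0 by (simp add: S_ind S1_def)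
  have eqn: "u t y = semigroup_conv p t (u 0) y + S1 y" for y
    using duhamel[OF t, of y] by (simp add: S1_def S_def set_lebesgue_integral_def)
  have S0_meas [measurable]: "semigroup_conv p t (u 0) \<in> borel_measurable borel"
    by (rule semigroup_conv_measurable[OF t0]) measurable
  have "(conv J (u t) x) = (LINT y|lborel. J (x - y) * semigroup_conv p t (u 0) y + J (x - y) * S1 y)"
    by (simp add: eqn distrib_left)
  also have "\<dots> = (LINT y|lborel. J (x - y) * semigroup_conv p t (u 0) y) + (conv J S1 x)"
    by (intro Bochner_Integration.integral_add integrable_conv_bounded(1)[OF J, where B = B] integrable_conv_bounded(1)[OF J S1_bound]
        semigroup_conv_bound[OF t0 u0_bound]) measurable
  also have "(LINT y|lborel. J (x - y) * semigroup_conv p t (u 0) y) = (conv (semigroup_conv p t J) (u 0) x)"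
    by (rule convolution_associative[OF t0 J u0_bound]) measurable
  also have "(conv J S1 x) = (LINT y|lborel. (LINT s|lborel. J (x - y) * S s y))"
    unfolding S1_def by simp
  also have "\<dots> = (LINT s|lborel. (conv J (S s) x))"
  proof -
    show ?thesis
    proof (rule lborel_pair.Fubini_bounded_sections(2)[where b = "\<lambda>y. \<bar>J (x - y)\<bar> * (B * t)", symmetric])
      show "integrable lborel (\<lambda>y. \<bar>J (x - y)\<bar> * (B * t))"
        using integrable_reflect[of "\<lambda>y. \<bar>J y\<bar>" x] J by simp
      fix y
      have "(\<integral>\<^sup>+s. ennreal (norm (J (x - y) * S s y)) \<partial>lborel) = ennreal \<bar>J (x - y)\<bar> * (\<integral>\<^sup>+s. ennreal \<bar>S s y\<bar> \<partial>lborel)"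
        by (subst nn_integral_cmult[symmetric]) (auto simp: abs_mult ennreal_mult)
      also have "\<dots> \<le> ennreal \<bar>J (x - y)\<bar> * ennreal (B * t)" by (intro mult_left_mono S_nn) auto
      also have "\<dots> = ennreal (\<bar>J (x - y)\<bar> * (B * t))" using B_nonneg t0 by (simp add: ennreal_mult)
      finally show "(\<integral>\<^sup>+s. ennreal (norm (J (x - y) * S s y)) \<partial>lborel) \<le> ennreal (\<bar>J (x - y)\<bar> * (B * t))" .
    qed measurable
  qed
  also have "\<dots> = (time_int t (\<lambda>s. conv (semigroup_conv p (t - s) J) (f s) x))"
  proof (rule Bochner_Integration.integral_cong[OF refl])
    fix s
    show "(conv J (S s) x) = indicator {0<..<t} s * (conv (semigroup_conv p (t - s) J) (f s) x)"
    proof (cases "s \<in> {0<..<t}")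
      case True
      then have "t - s > 0" by simp
      from convolution_associative[OF this J f_bound f_slice, of x s] show ?thesis
        using True by (simp add: S_def)
    qed (simp add: S_def)
  qed
  finally show ?thesis .
qed

end

locale duhamel_gaussian = duhamel \<mu> p T B u f + gaussian_spectrum \<mu> p a \<Gamma>
  for \<mu> :: "(real^'d) measure" and p T B u f a \<Gamma>
begin

definition jumps_mass :: real where "jumps_mass = (LINT y|lborel. \<bar>gaussian_jumps a y\<bar>)"

lemma jumps_mass_nonneg: "jumps_mass \<ge> 0"
  unfolding jumps_mass_def by (intro integral_nonneg_AE) auto

text \<open>
  As \<open>P\<^sub>s\<close> contracts \<open>L\<^sup>1\<close>, the bound is uniform in time, down to \<open>s = 0\<close>.
\<close>

lemma heat_jumps_slice:
  assumes s: "s > 0" and \<phi>: "\<And>y. \<bar>\<phi> y\<bar> \<le> B" "\<phi> \<in> borel_measurable borel"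
  shows "(\<integral>\<^sup>+w. ennreal \<bar>heat_jumps s (x - w) * \<phi> w\<bar> \<partial>lborel) \<le> ennreal (B * jumps_mass)"
    and "\<bar>\<integral>w. heat_jumps s (x - w) * \<phi> w \<partial>lborel\<bar> \<le> B * jumps_mass"
proof -
  have K: "(\<integral>\<^sup>+x. ennreal \<bar>gaussian_jumps a x\<bar> \<partial>lborel) = ennreal jumps_mass"
    using gaussian_jumps_integrable[OF a] unfolding jumps_mass_def by (subst nn_integral_eq_integral) auto
  have le: "(\<integral>\<^sup>+w. ennreal \<bar>heat_jumps s w\<bar> \<partial>lborel) \<le> ennreal jumps_mass"
    using semigroup_conv_L1[OF s gaussian_jumps_measurable, of a] unfolding K heat_jumps_eq(1)[OF s] .
  have i: "integrable lborel (heat_jumps s)"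
    using le by (intro integrableI_bounded) (auto intro: le_less_trans)
  have "(LINT w|lborel. \<bar>heat_jumps s w\<bar>) \<le> jumps_mass"
    using le i jumps_mass_nonneg by (subst (asm) nn_integral_eq_integral) auto
  then have m: "B * (LINT w|lborel. \<bar>heat_jumps s w\<bar>) \<le> B * jumps_mass" using B_nonneg by (rule mult_left_mono)
  show "(\<integral>\<^sup>+w. ennreal \<bar>heat_jumps s (x - w) * \<phi> w\<bar> \<partial>lborel) \<le> ennreal (B * jumps_mass)"
    by (rule order_trans[OF integrable_conv_bounded(3)[OF i \<phi>] ennreal_leI[OF m]])
  show "\<bar>\<integral>w. heat_jumps s (x - w) * \<phi> w \<partial>lborel\<bar> \<le> B * jumps_mass"
    by (rule order_trans[OF integrable_conv_bounded(2)[OF i \<phi>] m])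
qed

lemma Dynkin_convolved:
  assumes t: "t > 0" and \<phi>: "\<And>y. \<bar>\<phi> y\<bar> \<le> B" "\<phi> \<in> borel_measurable borel"
  shows "(conv (semigroup_conv p t (gaussian a)) \<phi> x)
    = (conv (gaussian a) \<phi> x)
      + (time_int t (\<lambda>s. conv (heat_jumps s) \<phi> x))"
proof -
  note [measurable] = \<phi>(2)
  have gi: "integrable lborel (\<lambda>w. gaussian a (x - w) * \<phi> w)"
    by (rule integrable_conv_bounded(1)[OF gaussian_integrable[OF a] \<phi>])
  let ?F = "\<lambda>s w. indicator {0<..<t} s * heat_jumps s (x - w) * \<phi> w"
  have int: "integrable lborel (\<lambda>s. B * jumps_mass * indicator {0<..<t} s)"
    using integrable_bounded_interval(1)[of "\<lambda>_. B * jumps_mass" t "\<bar>B * jumps_mass\<bar>"] by (simp add: mult.commute)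
  have sect: "(\<integral>\<^sup>+w. ennreal (norm (?F s w)) \<partial>lborel) \<le> ennreal (B * jumps_mass * indicator {0<..<t} s)" for s
    using heat_jumps_slice(1)[OF _ \<phi>, of s x] by (cases "s \<in> {0<..<t}") (auto simp: mult.assoc)
  have F_meas: "case_prod ?F \<in> borel_measurable (lborel \<Otimes>\<^sub>M lborel)" by measurable
  have swap: "(LINT w|lborel. (LINT s|lborel. ?F s w)) = (LINT s|lborel. (LINT w|lborel. ?F s w))"
    by (rule lborel_pair.Fubini_bounded_sections(2)[OF F_meas sect int])
  have "integrable (lborel \<Otimes>\<^sub>M lborel) (case_prod ?F)"
    by (rule lborel_pair.Fubini_bounded_sections(1)[OF F_meas sect int])
  from lborel_pair.integrable_snd[OF this] have Fi: "integrable lborel (\<lambda>w. \<integral>s. ?F s w \<partial>lborel)" .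
  have "semigroup_conv p t (gaussian a) (x - w) * \<phi> w = gaussian a (x - w) * \<phi> w + (LINT s|lborel. ?F s w)" for w
  proof -
    have "semigroup_conv p t (gaussian a) (x - w) = gaussian a (x - w) + (time_int t (\<lambda>s. heat_jumps s (x - w)))"
      using Dynkin_gaussian[OF t, of "x - w"] by simp
    then show ?thesis by (simp add: distrib_right)
  qed
  then have "(conv (semigroup_conv p t (gaussian a)) \<phi> x) = (LINT w|lborel. gaussian a (x - w) * \<phi> w + (LINT s|lborel. ?F s w))"
    by simp
  also have "\<dots> = (conv (gaussian a) \<phi> x) + (LINT w|lborel. (LINT s|lborel. ?F s w))"
    by (rule Bochner_Integration.integral_add[OF gi Fi])
  also have "\<dots> = (conv (gaussian a) \<phi> x) + (time_int t (\<lambda>s. conv (heat_jumps s) \<phi> x))"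
    unfolding swap by (simp add: mult.assoc)
  finally show ?thesis .
qed

text \<open>
  Convolve the Duhamel formula with \<open>L G\<close> and integrate over \<open>(0, t)\<close>. In the double time integral over
  \<open>0 < s < r < t\<close> integrate first over \<open>r - s\<close>: by the Dynkin formula this produces \<open>P\<^bsub>t-s\<^esub> G - G\<close>. The terms with
  \<open>P\<^sub>t G\<close> and \<open>P\<^bsub>t-s\<^esub> G\<close> are the Duhamel formula at time \<open>t\<close> convolved with \<open>G\<close>.
\<close>

lemma mollified_equation:
  assumes t: "t \<in> {0<..T}"
  shows "(conv (gaussian a) (u t) x) = (conv (gaussian a) (u 0) x)
     + (time_int t (\<lambda>s. conv (gaussian a) (f s) x))
     + (time_int t (\<lambda>s. conv (gaussian_jumps a) (u s) x))"
proof -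
  have t0: "t > 0" "t \<le> T" using t by auto
  define X where "X s = (conv (heat_jumps s) (u 0) x)" for s
  define Y where "Y r s = (conv (heat_jumps r) (f s) x)" for r s
  define Ef where "Ef s = (conv (gaussian a) (f s) x)" for s
  have X_meas [measurable]: "X \<in> borel_measurable borel" unfolding X_def[abs_def] by measurable
  have Y_meas [measurable (raw)]: "(\<lambda>z. Y (g z) (h z)) \<in> borel_measurable M"
    if [measurable]: "g \<in> borel_measurable M" "h \<in> borel_measurable M" for g h and M :: "'x measure"
    unfolding Y_def by measurable
  have Ef_meas [measurable]: "Ef \<in> borel_measurable borel" unfolding Ef_def[abs_def] by measurable
  have X_bound: "\<bar>X s\<bar> \<le> B * jumps_mass" if "s > 0" for s
    unfolding X_def by (rule heat_jumps_slice(2)[OF that u0_bound u0_measurable])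
  have Y_bound: "\<bar>Y r s\<bar> \<le> B * jumps_mass" if "r > 0" for r s
    unfolding Y_def by (rule heat_jumps_slice(2)[OF that f_bound f_slice])
  have X_int: "integrable lborel (\<lambda>s. indicator {0<..<t} s * X s)"
    using integrable_bounded_interval(1)[of X t "B * jumps_mass"] X_bound by simp
  have Ef_int: "integrable lborel (\<lambda>s. indicator {0<..<t} s * Ef s)"
    by (rule integrable_bounded_interval(1)[OF Ef_meas]) 
       (unfold Ef_def, rule integrable_conv_bounded(2)[OF gaussian_integrable[OF a] f_bound f_slice])
  \<comment> \<open>The integrand on the triangle \<open>0 < s < r < t\<close>.\<close>
  let ?F = "\<lambda>s r. indicator {0<..<t} s * (indicator {0<..<t} r * (indicator {0<..<r} s * Y (r - s) s))"
  have F_le: "norm (?F s r) \<le> B * jumps_mass * (indicator {0<..<t} s * indicator {0<..<t} r)" for s r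
    using Y_bound[of "r - s" s] B_nonneg jumps_mass_nonneg by (auto simp: indicator_def)
  have F_sect: "(\<integral>\<^sup>+r. ennreal (norm (?F s r)) \<partial>lborel) \<le> ennreal (B * jumps_mass * t * indicator {0<..<t} s)" for s
  proof -
    have "(\<integral>\<^sup>+r. ennreal (norm (?F s r)) \<partial>lborel) \<le> (\<integral>\<^sup>+r. ennreal (B * jumps_mass * indicator {0<..<t} s) * indicator {0<..<t} r \<partial>lborel)"
    proof (rule nn_integral_mono)
      fix r
      have "ennreal (norm (?F s r)) \<le> ennreal (B * jumps_mass * (indicator {0<..<t} s * indicator {0<..<t} r))"
        by (rule ennreal_leI[OF F_le])
      also have "\<dots> = ennreal (B * jumps_mass * indicator {0<..<t} s) * indicator {0<..<t} r"
        by (auto simp: indicator_def)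
      finally show "ennreal (norm (?F s r)) \<le> ennreal (B * jumps_mass * indicator {0<..<t} s) * indicator {0<..<t} r" .
    qed
    also have "\<dots> = ennreal (B * jumps_mass * t * indicator {0<..<t} s)"
      using t0 B_nonneg jumps_mass_nonneg
      by (subst nn_integral_cmult_indicator) (auto simp: ennreal_mult[symmetric] indicator_def)
    finally show ?thesis .
  qed
  have F_meas: "case_prod ?F \<in> borel_measurable (lborel \<Otimes>\<^sub>M lborel)"
  proof -
    have "(\<lambda>z. indicator {0<..<snd z} (fst z) :: real) \<in> borel_measurable (lborel \<Otimes>\<^sub>M (lborel :: real measure))"
    proof -
      have "(\<lambda>z :: real \<times> real. indicator {0<..<snd z} (fst z) :: real) = (\<lambda>z. if 0 < fst z \<and> fst z < snd z then 1 else 0)"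
        by (auto simp: indicator_def fun_eq_iff)
      then show ?thesis by simp
    qed
    note [measurable] = this
    show ?thesis unfolding case_prod_beta by measurable
  qed
  have F_int: "integrable lborel (\<lambda>s. B * jumps_mass * t * indicator {0<..<t} s)"
    using integrable_bounded_interval(1)[of "\<lambda>_. B * jumps_mass * t" t "\<bar>B * jumps_mass * t\<bar>"] by (simp add: mult.commute)
  have F_integrable: "integrable (lborel \<Otimes>\<^sub>M lborel) (case_prod ?F)"
    by (rule lborel_pair.Fubini_bounded_sections(1)[OF F_meas F_sect F_int])
  have swap: "(LINT r|lborel. (LINT s|lborel. ?F s r)) = (LINT s|lborel. (LINT r|lborel. ?F s r))"
    by (rule lborel_pair.Fubini_bounded_sections(2)[OF F_meas F_sect F_int])
  \<comment> \<open>After the shift \<open>r \<mapsto> r - s\<close> this is a time integral as in the Dynkin formula on \<open>(0, t - s)\<close>.\<close>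
  define Z where "Z s = (LINT r|lborel. ?F s r)" for s
  have Z_int: "integrable lborel Z"
    unfolding Z_def using lborel_pair.integrable_fst[OF F_integrable] by simp
  have R_int: "integrable lborel (\<lambda>r. \<integral>s. ?F s r \<partial>lborel)"
    by (rule lborel_pair.integrable_snd[OF F_integrable])
  have Z: "Z s = indicator {0<..<t} s * (time_int (t - s) (\<lambda>r. Y r s))" for s
  proof (cases "s \<in> {0<..<t}")
    case True
    have "Z s = (time_int t (\<lambda>r. indicator {0<..<r} s * Y (r - s) s))"
      unfolding Z_def using True by simp
    also have "\<dots> = (LINT r|lborel. indicator {0<..<t} (s + r) * (indicator {0<..<s + r} s * Y (s + r - s) s))"
    proof (rule integral_translate[symmetric])
      have "(\<lambda>r. indicator {0<..<r} s :: real) = (\<lambda>r. if 0 < s \<and> s < r then 1 else 0)"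
        by (auto simp: indicator_def fun_eq_iff)
      then have [measurable]: "(\<lambda>r. indicator {0<..<r} s :: real) \<in> borel_measurable borel" by simp
      show "(\<lambda>r. indicator {0<..<t} r * (indicator {0<..<r} s * Y (r - s) s)) \<in> borel_measurable borel" by measurable
    qed
    also have "\<dots> = (time_int (t - s) (\<lambda>r. Y r s))"
      using True by (intro Bochner_Integration.integral_cong refl) (auto simp: indicator_def)
    finally show ?thesis using True by simp
  qed (simp add: Z_def)
  have 1: "(conv (gaussian a) (u t) x) = (conv (semigroup_conv p t (gaussian a)) (u 0) x)
     + (LINT s|lborel. indicator {0<..<t} s * Ef s + Z s)"
  proof -
    have "indicator {0<..<t} s * (conv (semigroup_conv p (t - s) (gaussian a)) (f s) x) = indicator {0<..<t} s * Ef s + Z s" for s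
    proof (cases "s \<in> {0<..<t}")
      case True
      then have "t - s > 0" by simp
      from Dynkin_convolved[OF this f_bound f_slice, of x s] show ?thesis
        using True unfolding Z by (simp add: Ef_def Y_def)
    qed (simp add: Z)
    then show ?thesis using duhamel_convolved[OF t gaussian_integrable[OF a], of x] by simp
  qed
  also have "(LINT s|lborel. indicator {0<..<t} s * Ef s + Z s) = (time_int t Ef) + (LINT s|lborel. Z s)"
    by (rule Bochner_Integration.integral_add[OF Ef_int Z_int])
  also have "(conv (semigroup_conv p t (gaussian a)) (u 0) x) = (conv (gaussian a) (u 0) x) + (time_int t X)"
    unfolding X_def by (rule Dynkin_convolved[OF t0(1) u0_bound u0_measurable])
  also have "(LINT s|lborel. Z s) = (LINT r|lborel. (LINT s|lborel. ?F s r))" unfolding swap Z_def ..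
  finally have main: "(conv (gaussian a) (u t) x) = (conv (gaussian a) (u 0) x)
     + (time_int t X) + ((time_int t Ef) + (LINT r|lborel. (LINT s|lborel. ?F s r)))" .
  have "(time_int t (\<lambda>r. conv (gaussian_jumps a) (u r) x))
    = (LINT r|lborel. indicator {0<..<t} r * X r + (LINT s|lborel. ?F s r))"
  proof (rule Bochner_Integration.integral_cong[OF refl])
    fix r
    show "indicator {0<..<t} r * (conv (gaussian_jumps a) (u r) x) = indicator {0<..<t} r * X r + (LINT s|lborel. ?F s r)"
    proof (cases "r \<in> {0<..<t}")
      case True
      then have r: "r \<in> {0<..T}" "r > 0" using t0 by auto
      have "(LINT s|lborel. ?F s r) = (time_int r (\<lambda>s. conv (semigroup_conv p (r - s) (gaussian_jumps a)) (f s) x))"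
      proof (rule Bochner_Integration.integral_cong[OF refl])
        fix s
        show "?F s r = indicator {0<..<r} s * (conv (semigroup_conv p (r - s) (gaussian_jumps a)) (f s) x)"
          using True by (cases "s \<in> {0<..<r}") (auto simp: Y_def heat_jumps_eq(1))
      qed
      then show ?thesis
        using True duhamel_convolved[OF r(1) gaussian_jumps_integrable[OF a], of x]
        by (simp add: X_def heat_jumps_eq(1)[OF r(2)])
    qed simp
  qed
  also have "\<dots> = (time_int t X) + (LINT r|lborel. (LINT s|lborel. ?F s r))"
    by (rule Bochner_Integration.integral_add[OF X_int R_int])
  finally show ?thesis using main unfolding Ef_def by simp
qed

end


section \<open>From mild to classical solutions\<close>

context levy
begin

definition levy_int :: "(real^'d \<Rightarrow> real) \<Rightarrow> (real^'d \<Rightarrow> real^'d) \<Rightarrow> real^'d \<Rightarrow> real" where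
  "levy_int \<phi> g x = (LINT z|\<mu>. jump \<phi> g x z)"

text \<open>
  The jumps are dominated by an integrable weight. If they fail to be measurable, the integral is zero by
  convention and the bound is trivial.
\<close>

lemma levy_int_bound:
  assumes W: "integrable \<mu> W" and le: "\<And>z. \<bar>jump \<phi> g x z\<bar> \<le> W z"
  shows "\<bar>levy_int \<phi> g x\<bar> \<le> (LINT z|\<mu>. W z)"
proof (cases "integrable \<mu> (jump \<phi> g x)")
  case True
  have "\<bar>levy_int \<phi> g x\<bar> \<le> (LINT z|\<mu>. \<bar>jump \<phi> g x z\<bar>)" unfolding levy_int_def by (rule integral_abs_bound)
  also have "\<dots> \<le> (LINT z|\<mu>. W z)" using True W le by (intro integral_mono) auto
  finally show ?thesis .
next
  case False
  have "0 \<le> W z" for z using le[of z] by linarith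
  then show ?thesis unfolding levy_int_def not_integrable_integral_eq[OF False] by simp
qed

text \<open>
  The Levy operator moves from the mollifier to \<open>\<phi>\<close>. For a single jump this is translation invariance
  and integration by parts; Fubini then applies on both sides, with the weight \<open>min 1 |z|\<^sup>2\<close> when the regularity is
  taken from the Gaussian, and with the weight \<open>W\<close> when it is taken from \<open>\<phi>\<close>.
\<close>

lemma gaussian_jumps_adjoint:
  assumes a: "a > 0"
    and deriv: "\<And>y. (\<phi> has_derivative (\<lambda>h. g y \<bullet> h)) (at y)"
    and bound: "\<And>y. \<bar>\<phi> y\<bar> \<le> M" "\<And>y. norm (g y) \<le> M" and g_cont: "continuous_on UNIV g"
    and W: "integrable \<mu> W" and le: "\<And>y z. \<bar>jump \<phi> g y z\<bar> \<le> W z"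
  shows "(conv (gaussian_jumps a) \<phi> x) = (conv (gaussian a) (levy_int \<phi> g) x)"
proof -
  interpret pair_sigma_finite \<mu> "lborel :: (real^'d) measure" ..
  have \<phi>_cont: "continuous_on UNIV \<phi>"
    using deriv by (auto intro!: continuous_at_imp_continuous_on has_derivative_continuous)
  have [measurable]: "\<phi> \<in> borel_measurable borel" "g \<in> borel_measurable borel"
    using \<phi>_cont g_cont by (auto intro: borel_measurable_continuous_onI)
  have M: "M \<ge> 0" using bound(1)[of 0] by linarith
  obtain C where C: "C \<ge> 0"
    "\<And>x z :: real^'d. (\<integral>\<^sup>+y. ennreal \<bar>jump (gaussian a) (gaussian_grad a) (x - y) z\<bar> \<partial>lborel) \<le> ennreal (C * min 1 ((norm z)\<^sup>2))"
    using jump_gaussian_L1[OF a] by blast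
  let ?J = "\<lambda>z y. jump (gaussian a) (gaussian_grad a) (x - y) z * \<phi> y"
  let ?K = "\<lambda>z y. gaussian a (x - y) * jump \<phi> g y z"
  have gi: "integrable lborel (\<lambda>y. gaussian a (x - y + v))" for v :: "real^'d"
    using integrable_reflect[of "gaussian a" "x + v"] gaussian_integrable[OF a] by (simp add: algebra_simps)
  have gi0: "integrable lborel (\<lambda>y. gaussian a (x - y))" using gi[of 0] by simp
  have gb: "integrable lborel (\<lambda>y. gaussian a (x - y + v) * q y)"
    if q: "\<And>y. \<bar>q y\<bar> \<le> N" and [measurable]: "q \<in> borel_measurable borel" for v q N
  proof (rule Bochner_Integration.integrable_bound[OF integrable_mult_left[OF gi[of v], of N]])
    show "AE y in lborel. norm (gaussian a (x - y + v) * q y) \<le> norm (gaussian a (x - y + v) * N)"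
    proof (rule AE_I2)
      fix y
      have "\<bar>q y\<bar> \<le> \<bar>N\<bar>" using q[of y] by linarith
      then show "norm (gaussian a (x - y + v) * q y) \<le> norm (gaussian a (x - y + v) * N)"
        by (simp add: abs_mult mult_left_mono)
    qed
  qed measurable
  have pointwise: "(LINT y|lborel. ?J z y) = (LINT y|lborel. ?K z y)" for z
  proof -
    have i1: "integrable lborel (\<lambda>y. gaussian a (x - y + v) * \<phi> y)" for v by (rule gb[OF bound(1)]) measurable
    have i2: "integrable lborel (\<lambda>y. gaussian a (x - y) * \<phi> (y + z))" using gb[of "\<lambda>y. \<phi> (y + z)" M 0] bound(1) by simp
    have i3: "integrable lborel (\<lambda>y. (gaussian_grad a (x - y) \<bullet> z) * \<phi> y)"
    proof (rule integrable_conv_bounded(1)[OF gaussian_grad_inner_integrable[OF a] bound(1)])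
    qed measurable
    have i4: "integrable lborel (\<lambda>y. gaussian a (x - y) * (g y \<bullet> z))"
    proof -
      have "\<bar>g y \<bullet> z\<bar> \<le> M * norm z" for y
        using order_trans[OF Cauchy_Schwarz_ineq2[of "g y" z] mult_right_mono[OF bound(2)[of y]]] by simp
      then show ?thesis using gb[of "\<lambda>y. g y \<bullet> z" "M * norm z" 0] by simp
    qed
    have shift: "(LINT y|lborel. gaussian a (x - y + z) * \<phi> y) = (LINT y|lborel. gaussian a (x - y) * \<phi> (y + z))"
      using integral_translate[of "\<lambda>y. gaussian a (x - y + z) * \<phi> y" z]
      by (simp add: add.commute diff_diff_eq algebra_simps)
    have ibp: "indicator (ball 0 1) z * (LINT y|lborel. (gaussian_grad a (x - y) \<bullet> z) * \<phi> y)
        = indicator (ball 0 1) z * (LINT y|lborel. gaussian a (x - y) * (g y \<bullet> z))"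
      by (cases "norm z < 1") (auto simp: gaussian_integration_by_parts[OF a _ deriv bound])
    have "(LINT y|lborel. ?J z y) = (LINT y|lborel. gaussian a (x - y + z) * \<phi> y - gaussian a (x - y) * \<phi> y
        - indicator (ball 0 1) z * ((gaussian_grad a (x - y) \<bullet> z) * \<phi> y))"
      by (simp add: jump_def algebra_simps)
    also have "\<dots> = (LINT y|lborel. gaussian a (x - y + z) * \<phi> y) - (conv (gaussian a) \<phi> x)
        - indicator (ball 0 1) z * (LINT y|lborel. (gaussian_grad a (x - y) \<bullet> z) * \<phi> y)"
      using i1[of z] i1[of 0] i3 by simp
    also have "\<dots> = (LINT y|lborel. gaussian a (x - y) * \<phi> (y + z) - gaussian a (x - y) * \<phi> y
        - indicator (ball 0 1) z * (gaussian a (x - y) * (g y \<bullet> z)))"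
      unfolding shift ibp using i2 i1[of 0] i4 by simp
    also have "\<dots> = (LINT y|lborel. ?K z y)" by (simp add: jump_def algebra_simps)
    finally show ?thesis .
  qed
  have "(conv (gaussian_jumps a) \<phi> x) = (LINT y|lborel. (LINT z|\<mu>. ?J z y))"
    unfolding gaussian_jumps_def by simp
  also have "\<dots> = (LINT z|\<mu>. (LINT y|lborel. ?J z y))"
  proof (rule Fubini_bounded_sections(2)[where b = "\<lambda>z. M * C * min 1 ((norm z)\<^sup>2)"])
    show "integrable \<mu> (\<lambda>z. M * C * min 1 ((norm z)\<^sup>2))" using integrable_levy_weight by simp
    fix z
    have "(\<integral>\<^sup>+y. ennreal (norm (?J z y)) \<partial>lborel) \<le> (\<integral>\<^sup>+y. ennreal M * ennreal \<bar>jump (gaussian a) (gaussian_grad a) (x - y) z\<bar> \<partial>lborel)"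
    proof (rule nn_integral_mono)
      fix y
      have "norm (?J z y) \<le> M * \<bar>jump (gaussian a) (gaussian_grad a) (x - y) z\<bar>"
        using mult_left_mono[OF bound(1)[of y] abs_ge_zero[of "jump (gaussian a) (gaussian_grad a) (x - y) z"]]
        by (simp add: abs_mult mult.commute)
      then show "ennreal (norm (?J z y)) \<le> ennreal M * ennreal \<bar>jump (gaussian a) (gaussian_grad a) (x - y) z\<bar>"
        using M by (simp add: ennreal_mult[symmetric] ennreal_leI)
    qed
    also have "\<dots> = ennreal M * (\<integral>\<^sup>+y. ennreal \<bar>jump (gaussian a) (gaussian_grad a) (x - y) z\<bar> \<partial>lborel)"
      by (rule nn_integral_cmult) measurable
    also have "\<dots> \<le> ennreal M * ennreal (C * min 1 ((norm z)\<^sup>2))" by (intro mult_left_mono C) auto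
    also have "\<dots> = ennreal (M * C * min 1 ((norm z)\<^sup>2))" using M C(1) by (simp add: ennreal_mult[symmetric] mult.assoc)
    finally show "(\<integral>\<^sup>+y. ennreal (norm (?J z y)) \<partial>lborel) \<le> ennreal (M * C * min 1 ((norm z)\<^sup>2))" .
  next
    show "case_prod ?J \<in> borel_measurable (\<mu> \<Otimes>\<^sub>M lborel)" unfolding case_prod_beta by measurable
  qed
  also have "\<dots> = (LINT z|\<mu>. (LINT y|lborel. ?K z y))" unfolding pointwise ..
  also have "\<dots> = (LINT y|lborel. (LINT z|\<mu>. ?K z y))"
  proof (rule Fubini_bounded_sections(2)[where b = "\<lambda>z. W z * (LINT y|lborel. gaussian a (x - y))", symmetric])
    show "integrable \<mu> (\<lambda>z. W z * (LINT y|lborel. gaussian a (x - y)))" using W by simp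
    fix z
    have W0: "W z \<ge> 0" using le[of 0 z] by linarith
    have "(\<integral>\<^sup>+y. ennreal (norm (?K z y)) \<partial>lborel) \<le> (\<integral>\<^sup>+y. ennreal (W z * gaussian a (x - y)) \<partial>lborel)"
      using le W0 by (intro nn_integral_mono ennreal_leI)
        (simp add: abs_mult gaussian_pos less_imp_le mult.commute mult_left_mono)
    also have "\<dots> = ennreal (W z * (LINT y|lborel. gaussian a (x - y)))"
      using gi0 W0 by (subst nn_integral_eq_integral) (auto simp: gaussian_pos less_imp_le)
    finally show "(\<integral>\<^sup>+y. ennreal (norm (?K z y)) \<partial>lborel) \<le> ennreal (W z * (LINT y|lborel. gaussian a (x - y)))" .
  next
    show "case_prod ?K \<in> borel_measurable (\<mu> \<Otimes>\<^sub>M lborel)" unfolding case_prod_beta by measurable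
  qed
  also have "\<dots> = (conv (gaussian a) (levy_int \<phi> g) x)" unfolding levy_int_def by simp
  finally show ?thesis .
qed

lemma levy_int_continuous:
  assumes cont: "continuous_on UNIV \<phi>" "continuous_on UNIV g"
    and W: "integrable \<mu> W" and le: "\<And>y z. \<bar>jump \<phi> g y z\<bar> \<le> W z"
  shows "continuous_on UNIV (levy_int \<phi> g)"
proof -
  have [measurable]: "\<phi> \<in> borel_measurable borel" "g \<in> borel_measurable borel"
    using cont by (auto intro: borel_measurable_continuous_onI)
  have c: "isCont \<phi> x" "isCont g x" for x using cont by (auto simp: continuous_on_eq_continuous_at)
  have "isCont (levy_int \<phi> g) x" for x
  proof (rule continuous_at_sequentiallyI)
    fix X assume X: "X \<longlonglongrightarrow> x"
    show "(\<lambda>n. levy_int \<phi> g (X n)) \<longlonglongrightarrow> levy_int \<phi> g x" unfolding levy_int_def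
    proof (rule integral_dominated_convergence[where w = W])
      show "AE z in \<mu>. (\<lambda>n. jump \<phi> g (X n) z) \<longlonglongrightarrow> jump \<phi> g x z"
        unfolding jump_def by (intro AE_I2 tendsto_intros isCont_tendsto_compose[OF c(1)] isCont_tendsto_compose[OF c(2)] X)
    qed (use W le in auto)
  qed
  then show ?thesis by (simp add: continuous_on_eq_continuous_at)
qed

end

text \<open>
  Both sides agree after convolution with every Gaussian, and their difference is continuous and bounded.
  The first conclusion records the measurability of the integrand, so that the identity can be
  subtracted at two times.
\<close>

lemma (in duhamel) strong_form:
  fixes g :: "real \<Rightarrow> real^'d \<Rightarrow> real^'d"
  assumes deriv: "\<And>s y. s \<in> {0..T} \<Longrightarrow> (u s has_derivative (\<lambda>h. g s y \<bullet> h)) (at y)"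
    and bound: "\<And>s y. s \<in> {0..T} \<Longrightarrow> \<bar>u s y\<bar> \<le> M" "\<And>s y. s \<in> {0..T} \<Longrightarrow> norm (g s y) \<le> M"
    and g_cont: "\<And>s. s \<in> {0..T} \<Longrightarrow> continuous_on UNIV (g s)"
    and W: "integrable \<mu> W" and le: "\<And>s y z. s \<in> {0..T} \<Longrightarrow> \<bar>jump (u s) (g s) y z\<bar> \<le> W z"
    and u_meas: "\<And>y. (\<lambda>s. indicator {0<..<T} s * u s y) \<in> borel_measurable borel"
    and g_meas: "\<And>y. (\<lambda>s. indicator {0<..<T} s *\<^sub>R g s y) \<in> borel_measurable borel"
  shows "(\<lambda>s. indicator {0<..<T} s * (f s x + levy_int (u s) (g s) x)) \<in> borel_measurable borel"
    and "\<And>t. t \<in> {0<..T} \<Longrightarrow> u t x = u 0 x + (time_int t (\<lambda>s. f s x + levy_int (u s) (g s) x))"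
proof -
  \<comment> \<open>Cut off in time, so that the Caratheodory lemma applies on the whole real line.\<close>
  define v where "v s y = indicator {0<..<T} s * u s y" for s y
  define k where "k s y = indicator {0<..<T} s *\<^sub>R g s y" for s y
  have u_cont: "continuous_on UNIV (u s)" if "s \<in> {0..T}" for s
    using deriv[OF that] by (auto intro!: continuous_at_imp_continuous_on has_derivative_continuous)
  have ivl: "s \<in> {0..T}" if "s \<in> {0<..<T}" for s using that by auto
  have v_meas: "(\<lambda>z. v (fst z) (snd z)) \<in> borel_measurable (borel \<Otimes>\<^sub>M borel)"
  proof (rule Caratheodory_measurable)
    show "(\<lambda>s. v s y) \<in> borel_measurable borel" for y unfolding v_def by (rule u_meas)
    show "continuous_on UNIV (v s)" for s
      using u_cont[OF ivl, of s] by (cases "s \<in> {0<..<T}") (auto simp: v_def[abs_def])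
  qed
  have k_meas: "(\<lambda>z. k (fst z) (snd z)) \<in> borel_measurable (borel \<Otimes>\<^sub>M borel)"
  proof (rule Caratheodory_measurable)
    show "(\<lambda>s. k s y) \<in> borel_measurable borel" for y unfolding k_def by (rule g_meas)
    show "continuous_on UNIV (k s)" for s
      using g_cont[OF ivl, of s] by (cases "s \<in> {0<..<T}") (auto simp: k_def[abs_def])
  qed
  have v_comp [measurable (raw)]: "(\<lambda>x. v (q x) (h x)) \<in> borel_measurable N"
    if [measurable]: "q \<in> borel_measurable N" "h \<in> borel_measurable N" for q h and N :: "'x measure"
    using measurable_compose[OF _ v_meas, of "\<lambda>x. (q x, h x)" N] by simp
  have k_comp [measurable (raw)]: "(\<lambda>x. k (q x) (h x)) \<in> borel_measurable N"
    if [measurable]: "q \<in> borel_measurable N" "h \<in> borel_measurable N" for q h and N :: "'x measure"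
    using measurable_compose[OF _ k_meas, of "\<lambda>x. (q x, h x)" N] by simp
  define \<Lambda> where "\<Lambda> s y = levy_int (v s) (k s) y" for s y
  have \<Lambda>_comp [measurable (raw)]: "(\<lambda>x. \<Lambda> (q x) (h x)) \<in> borel_measurable N"
    if [measurable]: "q \<in> borel_measurable N" "h \<in> borel_measurable N" for q h and N :: "'x measure"
    unfolding \<Lambda>_def levy_int_def jump_def by measurable
  have \<Lambda>: "\<Lambda> s y = indicator {0<..<T} s * levy_int (u s) (g s) y" for s y
    by (cases "s \<in> {0<..<T}") (simp_all add: \<Lambda>_def levy_int_def jump_def v_def k_def)
  define W0 where "W0 = (LINT z|\<mu>. W z)"
  have W0: "W0 \<ge> 0"
  proof -
    have "0 \<le> W z" for z using le[of 0 0 z] T by (simp add: order_trans[OF abs_ge_zero])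
    then show ?thesis unfolding W0_def by simp
  qed
  have \<Lambda>_bound: "\<bar>\<Lambda> s y\<bar> \<le> W0" for s y
    using levy_int_bound[OF W le[OF ivl], of s y] W0 unfolding \<Lambda> W0_def by (cases "s \<in> {0<..<T}") auto
  have \<Lambda>_cont: "continuous_on UNIV (\<Lambda> s)" for s
  proof (cases "s \<in> {0<..<T}")
    case True
    then have "continuous_on UNIV (levy_int (u s) (g s))"
      by (intro levy_int_continuous[OF u_cont g_cont W le] ivl)
    then show ?thesis using True by (simp add: \<Lambda>[abs_def])
  qed (simp add: \<Lambda>[abs_def])
  define h where "h s y = f s y + \<Lambda> s y" for s y
  have h_comp [measurable (raw)]: "(\<lambda>x. h (q x) (r x)) \<in> borel_measurable N"
    if [measurable]: "q \<in> borel_measurable N" "r \<in> borel_measurable N" for q r and N :: "'x measure"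
    unfolding h_def by measurable
  have h_bound: "\<bar>h s y\<bar> \<le> B + W0" for s y
    using f_bound[of s y] \<Lambda>_bound[of s y] unfolding h_def by linarith
  have h_cont: "isCont (h s) y" for s y
    using f_continuous[of s] \<Lambda>_cont[of s] unfolding h_def[abs_def] by (auto simp: continuous_on_eq_continuous_at)
  have h_eq: "indicator {0<..<t} s * (f s x + levy_int (u s) (g s) x) = indicator {0<..<t} s * h s x"
    if "t \<le> T" for s t x
    using that by (cases "s \<in> {0<..<t}") (auto simp: h_def \<Lambda>)
  show "(\<lambda>s. indicator {0<..<T} s * (f s x + levy_int (u s) (g s) x)) \<in> borel_measurable borel"
    unfolding h_eq[OF order_refl] by measurable
  fix t assume t: "t \<in> {0<..T}"
  then have t0: "0 < t" "t \<le> T" by auto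
  define I where "I y = (time_int t (\<lambda>s. h s y))" for y
  have I_meas [measurable]: "I \<in> borel_measurable borel" unfolding I_def[abs_def] by measurable
  have I_bound: "\<bar>I y\<bar> \<le> (B + W0) * t" for y
    using integrable_bounded_interval(2)[of "\<lambda>s. h s y" t "B + W0"] h_bound B_nonneg W0 t0
    unfolding I_def by simp
  have I_nn: "(\<integral>\<^sup>+s. ennreal \<bar>indicator {0<..<t} s * h s y\<bar> \<partial>lborel) \<le> ennreal ((B + W0) * t)" for y
    using integrable_bounded_interval(3)[of "\<lambda>s. h s y" t "B + W0"] h_bound B_nonneg W0 t0 by simp
  have I_cont: "continuous_on UNIV I"
  proof -
    have "isCont I y" for y
    proof (rule continuous_at_sequentiallyI)
      fix X assume X: "X \<longlonglongrightarrow> y"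
      show "(\<lambda>n. I (X n)) \<longlonglongrightarrow> I y" unfolding I_def
      proof (rule integral_dominated_convergence[where w = "\<lambda>s. indicator {0<..<t} s * (B + W0)"])
        show "integrable lborel (\<lambda>s. indicator {0<..<t} s * (B + W0))"
          using integrable_bounded_interval(1)[of "\<lambda>_. B + W0" t "\<bar>B + W0\<bar>"] by simp
        show "AE s in lborel. (\<lambda>n. indicator {0<..<t} s * h s (X n)) \<longlonglongrightarrow> indicator {0<..<t} s * h s y"
          by (intro AE_I2 tendsto_intros isCont_tendsto_compose[OF h_cont] X)
        show "AE s in lborel. norm (indicator {0<..<t} s * h s (X n)) \<le> indicator {0<..<t} s * (B + W0)" for n
          using h_bound by (intro AE_I2) (simp add: indicator_def)
      qed measurable
    qed
    then show ?thesis by (simp add: continuous_on_eq_continuous_at)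
  qed
  have ut: "t \<in> {0..T}" "0 \<in> {0..T}" using t T by auto
  have [measurable]: "u t \<in> borel_measurable borel" using u_cont[OF ut(1)] by (rule borel_measurable_continuous_onI)
  have "u t x - u 0 x - I x = 0"
  proof (rule gaussian_approximate_identity[where B = "\<lambda>y. u t y - u 0 y - I y" and x = x])
    show "continuous_on UNIV (\<lambda>y. u t y - u 0 y - I y)"
      by (intro continuous_intros u_cont ut I_cont)
    show "\<bar>u t y - u 0 y - I y\<bar> \<le> M + M + (B + W0) * t" for y
      using bound(1)[OF ut(1), of y] bound(1)[OF ut(2), of y] I_bound[of y] by linarith
    fix a :: real assume a: "a > 0"
    obtain \<Gamma> :: "(real^'d) measure" where \<Gamma>: "prob_space \<Gamma>" "sets \<Gamma> = sets borel"
      "integrable \<Gamma> (\<lambda>\<xi>. (norm \<xi>)\<^sup>2)" "\<And>y. (LINT \<xi>|\<Gamma>. cis (y \<bullet> \<xi>)) = of_real (gaussian a y)"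
      using gaussian_characters[OF a] by blast
    interpret duhamel_gaussian \<mu> p T B u f a \<Gamma>
      by (intro duhamel_gaussian.intro duhamel_axioms gaussian_spectrum.intro levy_heat_axioms
          gaussian_spectrum_axioms.intro a \<Gamma>)
    note gint = gaussian_integrable[OF a, where 'd = 'd]
    have adj: "indicator {0<..<t} s * (conv (gaussian_jumps a) (u s) x)
      = indicator {0<..<t} s * (conv (gaussian a) (\<Lambda> s) x)" for s
    proof (cases "s \<in> {0<..<t}")
      case True
      then have s: "s \<in> {0<..<T}" using t0 by auto
      then show ?thesis using True gaussian_jumps_adjoint[OF a deriv bound g_cont W le, of s x] ivl[OF s]
        by (simp add: \<Lambda>)
    qed simp
    define F1 where "F1 s = (conv (gaussian a) (f s) x)" for s
    define F2 where "F2 s = (conv (gaussian a) (\<Lambda> s) x)" for s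
    have [measurable]: "F1 \<in> borel_measurable borel" "F2 \<in> borel_measurable borel"
      unfolding F1_def[abs_def] F2_def[abs_def] by measurable
    have F1_int: "integrable lborel (\<lambda>s. indicator {0<..<t} s * F1 s)"
      by (rule integrable_bounded_interval(1), measurable)
         (unfold F1_def, rule integrable_conv_bounded(2)[OF gint f_bound f_slice])
    have \<Lambda>_slice: "\<Lambda> s \<in> borel_measurable borel" for s by measurable
    have F2_int: "integrable lborel (\<lambda>s. indicator {0<..<t} s * F2 s)"
      by (rule integrable_bounded_interval(1), measurable)
         (unfold F2_def, rule integrable_conv_bounded(2)[OF gint \<Lambda>_bound \<Lambda>_slice])
    have sum: "F1 s + F2 s = (conv (gaussian a) (h s) x)" for s
      unfolding F1_def F2_def h_def
      using integrable_conv_bounded(1)[OF gint f_bound f_slice] integrable_conv_bounded(1)[OF gint \<Lambda>_bound \<Lambda>_slice]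
      by (simp add: distrib_left)
    have "(conv (gaussian a) (u t) x) = (conv (gaussian a) (u 0) x)
       + (time_int t F1) + (time_int t F2)"
      using mollified_equation[OF t, of x] unfolding adj F1_def F2_def .
    also have "\<dots> = (conv (gaussian a) (u 0) x) + (LINT s|lborel. indicator {0<..<t} s * F1 s + indicator {0<..<t} s * F2 s)"
      using F1_int F2_int by simp
    also have "(\<lambda>s. indicator {0<..<t} s * F1 s + indicator {0<..<t} s * F2 s) = (\<lambda>s. \<integral>y. gaussian a (x - y) * (indicator {0<..<t} s * h s y) \<partial>lborel)"
      unfolding distrib_left[symmetric] sum by (rule ext) (simp add: mult.left_commute)
    also have "(LINT s|lborel. (LINT y|lborel. gaussian a (x - y) * (indicator {0<..<t} s * h s y)))
      = (LINT y|lborel. (LINT s|lborel. gaussian a (x - y) * (indicator {0<..<t} s * h s y)))"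
    proof (rule lborel_pair.Fubini_bounded_sections(2)[where b = "\<lambda>y. gaussian a (x - y) * ((B + W0) * t)"])
      show "integrable lborel (\<lambda>y. gaussian a (x - y) * ((B + W0) * t))"
        using integrable_reflect[of "gaussian a" x] gint by simp
      fix y
      have "(\<integral>\<^sup>+s. ennreal (norm (gaussian a (x - y) * (indicator {0<..<t} s * h s y))) \<partial>lborel)
        = ennreal (gaussian a (x - y)) * (\<integral>\<^sup>+s. ennreal \<bar>indicator {0<..<t} s * h s y\<bar> \<partial>lborel)"
        by (subst nn_integral_cmult[symmetric]) (auto simp: abs_mult ennreal_mult gaussian_pos less_imp_le)
      also have "\<dots> \<le> ennreal (gaussian a (x - y)) * ennreal ((B + W0) * t)" by (intro mult_left_mono I_nn) auto
      also have "\<dots> = ennreal (gaussian a (x - y) * ((B + W0) * t))"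
        using B_nonneg W0 t0 by (simp add: ennreal_mult gaussian_pos less_imp_le)
      finally show "(\<integral>\<^sup>+s. ennreal (norm (gaussian a (x - y) * (indicator {0<..<t} s * h s y))) \<partial>lborel)
        \<le> ennreal (gaussian a (x - y) * ((B + W0) * t))" .
    qed measurable
    also have "\<dots> = (conv (gaussian a) I x)" unfolding I_def by simp
    finally have eq: "(conv (gaussian a) (u t) x) = (conv (gaussian a) (u 0) x) + (conv (gaussian a) I x)" .
    have "(LINT y|lborel. gaussian a (x - y) * (u t y - u 0 y - I y))
      = (LINT y|lborel. gaussian a (x - y) * u t y - gaussian a (x - y) * u 0 y - gaussian a (x - y) * I y)"
      by (simp add: right_diff_distrib)
    also have "\<dots> = (conv (gaussian a) (u t) x) - (conv (gaussian a) (u 0) x) - (conv (gaussian a) I x)"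
    proof -
      have "integrable lborel (\<lambda>y. gaussian a (x - y) * u t y)"
        by (rule integrable_conv_bounded(1)[OF gint bound(1)[OF ut(1)]]) measurable
      moreover have "integrable lborel (\<lambda>y. gaussian a (x - y) * u 0 y)"
        by (rule integrable_conv_bounded(1)[OF gint bound(1)[OF ut(2)]]) measurable
      moreover have "integrable lborel (\<lambda>y. gaussian a (x - y) * I y)"
        by (rule integrable_conv_bounded(1)[OF gint I_bound]) measurable
      ultimately show ?thesis by simp
    qed
    finally show "(LINT y|lborel. gaussian a (x - y) * (u t y - u 0 y - I y)) = 0" using eq by simp
  qed
  then show "u t x = u 0 x + (time_int t (\<lambda>s. f s x + levy_int (u s) (g s) x))"
    unfolding I_def h_eq[OF t0(2)] by simp
qed


section \<open>Estimates for the Levy operator\<close>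

text \<open>
  The consequences of \<open>\<phi> \<in> C\<^sub>b\<^sup>\<gamma>\<close> that are used. For \<open>\<gamma> > 2\<close> the Hoelder continuity of the second derivatives is
  expressed by mixed second differences of the gradient. This is symmetric in the two increments
  \<open>h\<close> and \<open>z\<close>, so either of them can be the one that enters linearly.
\<close>

definition regular :: "real \<Rightarrow> real \<Rightarrow> (real^'d \<Rightarrow> real) \<Rightarrow> (real^'d \<Rightarrow> real^'d) \<Rightarrow> bool" where
  "regular \<gamma> M \<phi> g \<longleftrightarrow>
     (\<forall>y. (\<phi> has_derivative (\<lambda>h. g y \<bullet> h)) (at y)) \<and>
     (\<forall>y. \<bar>\<phi> y\<bar> \<le> M) \<and> (\<forall>y. norm (g y) \<le> M) \<and>
     (\<forall>x y. norm (g x - g y) \<le> M * norm (x - y) powr min (\<gamma> - 1) 1) \<and>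
     (\<gamma> > 2 \<longrightarrow> (\<forall>y h z. norm (g (y + h + z) - g (y + h) - g (y + z) + g y) \<le> M * norm h * norm z powr (\<gamma> - 2)))"

lemma regularD:
  assumes "regular \<gamma> M \<phi> g"
  shows "(\<phi> has_derivative (\<lambda>h. g y \<bullet> h)) (at y)" "\<bar>\<phi> y\<bar> \<le> M" "norm (g y) \<le> M"
    "norm (g x - g y) \<le> M * norm (x - y) powr min (\<gamma> - 1) 1"
    "\<gamma> > 2 \<Longrightarrow> norm (g (y + h + z) - g (y + h) - g (y + z) + g y) \<le> M * norm h * norm z powr (\<gamma> - 2)"
    "M \<ge> 0"
  using assms order_trans[OF norm_ge_zero, of "g y" M] unfolding regular_def by blast+

lemma regular_diff:
  assumes 1: "regular \<gamma> M1 \<phi>1 g1" and 2: "regular \<gamma> M2 \<phi>2 g2"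
  shows "regular \<gamma> (M1 + M2) (\<lambda>y. \<phi>1 y - \<phi>2 y) (\<lambda>y. g1 y - g2 y)"
  unfolding regular_def
proof (intro conjI allI impI)
  fix x y h z
  show "((\<lambda>y. \<phi>1 y - \<phi>2 y) has_derivative (\<lambda>h. (g1 y - g2 y) \<bullet> h)) (at y)"
    using has_derivative_diff[OF regularD(1)[OF 1, of y] regularD(1)[OF 2, of y]] by (simp add: inner_diff_left)
  show "\<bar>\<phi>1 y - \<phi>2 y\<bar> \<le> M1 + M2" using regularD(2)[OF 1, of y] regularD(2)[OF 2, of y] by linarith
  show "norm (g1 y - g2 y) \<le> M1 + M2"
    using norm_triangle_ineq4[of "g1 y" "g2 y"] regularD(3)[OF 1, of y] regularD(3)[OF 2, of y] by linarith
  have "norm ((g1 x - g2 x) - (g1 y - g2 y)) \<le> norm (g1 x - g1 y) + norm (g2 x - g2 y)"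
    using norm_triangle_ineq4[of "g1 x - g1 y" "g2 x - g2 y"] by (simp add: algebra_simps)
  also have "\<dots> \<le> M1 * norm (x - y) powr min (\<gamma> - 1) 1 + M2 * norm (x - y) powr min (\<gamma> - 1) 1"
    by (intro add_mono regularD(4)[OF 1] regularD(4)[OF 2])
  finally show "norm ((g1 x - g2 x) - (g1 y - g2 y)) \<le> (M1 + M2) * norm (x - y) powr min (\<gamma> - 1) 1"
    by (simp add: algebra_simps)
  assume \<gamma>: "\<gamma> > 2"
  let ?d1 = "g1 (y + h + z) - g1 (y + h) - g1 (y + z) + g1 y" and ?d2 = "g2 (y + h + z) - g2 (y + h) - g2 (y + z) + g2 y"
  have "norm (?d1 - ?d2) \<le> norm ?d1 + norm ?d2" by (rule norm_triangle_ineq4)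
  also have "\<dots> \<le> M1 * norm h * norm z powr (\<gamma> - 2) + M2 * norm h * norm z powr (\<gamma> - 2)"
    by (intro add_mono regularD(5)[OF 1 \<gamma>] regularD(5)[OF 2 \<gamma>])
  finally show "norm ((g1 (y + h + z) - g2 (y + h + z)) - (g1 (y + h) - g2 (y + h)) - (g1 (y + z) - g2 (y + z)) + (g1 y - g2 y))
      \<le> (M1 + M2) * norm h * norm z powr (\<gamma> - 2)"
    by (simp add: algebra_simps)
qed

lemma regular_mono:
  assumes "regular \<gamma> M \<phi> g" "M \<le> N" shows "regular \<gamma> N \<phi> g"
proof -
  have "M * a \<le> N * a" if "a \<ge> 0" for a using assms(2) that by (rule mult_right_mono)
  note le = order_trans[OF _ this]
  show ?thesis unfolding regular_def
  proof (intro conjI allI impI)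
    fix x y h z
    show "(\<phi> has_derivative (\<lambda>h. g y \<bullet> h)) (at y)" by (rule regularD(1)[OF assms(1)])
    show "\<bar>\<phi> y\<bar> \<le> N" "norm (g y) \<le> N" using regularD(2,3)[OF assms(1), of y] assms(2) by linarith+
    show "norm (g x - g y) \<le> N * norm (x - y) powr min (\<gamma> - 1) 1" by (rule le[OF regularD(4)[OF assms(1)]]) simp
    assume "\<gamma> > 2"
    from regularD(5)[OF assms(1) this, of y h z]
    show "norm (g (y + h + z) - g (y + h) - g (y + z) + g y) \<le> N * norm h * norm z powr (\<gamma> - 2)"
      using le[of _ "norm h * norm z powr (\<gamma> - 2)"] by (simp add: mult.assoc)
  qed
qed

lemma gradient_line:
  fixes \<phi> :: "real^'d \<Rightarrow> real"
  assumes "\<And>y. (\<phi> has_derivative (\<lambda>h. g y \<bullet> h)) (at y)"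
  shows "((\<lambda>t. \<phi> (x + t *\<^sub>R z)) has_real_derivative g (x + t *\<^sub>R z) \<bullet> z) (at t)"
proof -
  have "((\<lambda>t. \<phi> (x + t *\<^sub>R z)) has_derivative (\<lambda>h. g (x + t *\<^sub>R z) \<bullet> (h *\<^sub>R z))) (at t)"
    by (rule has_derivative_compose[of "\<lambda>t. x + t *\<^sub>R z" "\<lambda>t. t *\<^sub>R z", where g = \<phi>])
       (auto intro!: derivative_eq_intros assms)
  then show ?thesis by (simp add: has_field_derivative_def mult_commute_abs)
qed

lemma gradient_MVT:
  fixes \<phi> :: "real^'d \<Rightarrow> real"
  assumes "\<And>y. (\<phi> has_derivative (\<lambda>h. g y \<bullet> h)) (at y)"
  obtains t where "0 < t" "t < 1" "\<phi> (x + z) - \<phi> x = g (x + t *\<^sub>R z) \<bullet> z"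
proof -
  have "\<exists>t::real. 0 < t \<and> t < 1 \<and> \<phi> (x + 1 *\<^sub>R z) - \<phi> (x + 0 *\<^sub>R z) = (1 - 0) * (g (x + t *\<^sub>R z) \<bullet> z)"
    by (rule MVT2[of 0 1 "\<lambda>t. \<phi> (x + t *\<^sub>R z)"]) (auto intro: gradient_line[OF assms])
  then show thesis using that by auto
qed

text \<open>
  The mean value theorem for a difference gives the same intermediate parameter \<open>t\<close> for both segments; hence mixed
  differences of the gradient appear.
\<close>

lemma gradient_MVT_difference:
  fixes \<phi> :: "real^'d \<Rightarrow> real"
  assumes "\<And>y. (\<phi> has_derivative (\<lambda>h. g y \<bullet> h)) (at y)"
  obtains t where "0 < t" "t < 1"
    "(\<phi> (x + z) - \<phi> x) - (\<phi> (y + w) - \<phi> y) = g (x + t *\<^sub>R z) \<bullet> z - g (y + t *\<^sub>R w) \<bullet> w"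
proof -
  have "\<exists>t::real. 0 < t \<and> t < 1 \<and> (\<phi> (x + 1 *\<^sub>R z) - \<phi> (y + 1 *\<^sub>R w)) - (\<phi> (x + 0 *\<^sub>R z) - \<phi> (y + 0 *\<^sub>R w))
      = (1 - 0) * (g (x + t *\<^sub>R z) \<bullet> z - g (y + t *\<^sub>R w) \<bullet> w)"
    by (rule MVT2[of 0 1 "\<lambda>t. \<phi> (x + t *\<^sub>R z) - \<phi> (y + t *\<^sub>R w)"]) (auto intro: DERIV_diff gradient_line[OF assms])
  then show thesis using that by (auto simp: algebra_simps)
qed

text \<open>
  The moment conditions on the jumps say that the operator has order at most \<open>\<alpha>\<close>.
\<close>

locale levy_order = levy \<mu> for \<mu> :: "(real^'d) measure" +
  fixes \<alpha> \<beta> c :: real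
  assumes alpha: "1 < \<alpha>" "\<alpha> \<le> 2" and beta: "0 < \<beta>" "\<beta> < 1"
    and gamma: "\<alpha> + \<beta> \<noteq> 2" and c_pos: "c > 0"
    and low: "\<And>r. \<lbrakk>0 < r; r < 1; \<alpha> + \<beta> < 2\<rbrakk> \<Longrightarrow>
         ennreal (r powr (- \<beta>)) * (\<integral>\<^sup>+ y\<in>ball 0 r. ennreal (norm y powr (\<alpha> + \<beta>)) \<partial>\<mu>)
         + ennreal (r powr (\<alpha> - 1)) * (\<integral>\<^sup>+ y\<in>ball 0 1 - ball 0 r. ennreal (norm y) \<partial>\<mu>) \<le> ennreal c"
    and high: "\<And>r. \<lbrakk>0 < r; r < 1; 2 < \<alpha> + \<beta>\<rbrakk> \<Longrightarrow>
         ennreal (r powr (\<alpha> - 2)) * (\<integral>\<^sup>+ y\<in>ball 0 r. ennreal ((norm y)\<^sup>2) \<partial>\<mu>)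
         + ennreal (r powr (1 - \<beta>)) * (\<integral>\<^sup>+ y\<in>ball 0 1 - ball 0 r. ennreal (norm y powr (\<alpha> + \<beta> - 1)) \<partial>\<mu>) \<le> ennreal c"
begin

abbreviation \<gamma> :: real where "\<gamma> \<equiv> \<alpha> + \<beta>"

text \<open>
  The order to which a first-order Taylor polynomial approximates a function in \<open>C\<^sub>b\<^sup>\<gamma>\<close>.
\<close>

definition \<gamma>' :: real where "\<gamma>' = min \<gamma> 2"

lemma \<gamma>'_eq: "\<gamma>' - 1 = min (\<gamma> - 1) 1" by (simp add: \<gamma>'_def)

lemma \<gamma>'_bounds: "1 < \<gamma>'" "\<gamma>' \<le> 2" using alpha beta by (auto simp: \<gamma>'_def)

lemma zone_indicators_measurable [measurable]:
  "(\<lambda>z :: real^'d. indicator (ball 0 r) z :: ennreal) \<in> borel_measurable borel"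
  "(\<lambda>z :: real^'d. indicator (ball 0 1 - ball 0 r) z :: ennreal) \<in> borel_measurable borel"
  "(\<lambda>z :: real^'d. indicator {z. 1 \<le> norm z} z :: ennreal) \<in> borel_measurable borel"
  by (intro borel_measurable_indicator; auto)+

lemma weighted_le:
  assumes "ennreal (r powr e) * X \<le> ennreal c" and "r > 0"
  shows "X \<le> ennreal (c * r powr (- e))"
proof -
  have "X = ennreal (r powr (- e)) * (ennreal (r powr e) * X)"
    using assms(2) by (simp add: mult.assoc[symmetric] ennreal_mult[symmetric] powr_add[symmetric])
  also have "\<dots> \<le> ennreal (r powr (- e)) * ennreal c" by (intro mult_left_mono assms(1)) auto
  also have "\<dots> = ennreal (c * r powr (- e))" using c_pos by (simp add: ennreal_mult[symmetric] mult.commute)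
  finally show ?thesis .
qed

text \<open>
  The moment of the jumps below scale \<open>r\<close>, in one formula for both ranges of \<open>\<gamma>\<close>.
\<close>

lemma near_mass:
  assumes r: "0 < r" "r < 1"
  shows "(\<integral>\<^sup>+ z\<in>ball 0 r. ennreal (norm z powr \<gamma>') \<partial>\<mu>) \<le> ennreal (c * r powr (\<gamma>' - \<alpha>))"
proof (cases "\<gamma> < 2")
  case True
  have "ennreal (r powr (- \<beta>)) * (\<integral>\<^sup>+ y\<in>ball 0 r. ennreal (norm y powr \<gamma>) \<partial>\<mu>) \<le> ennreal c"
    using low[OF r True] by (rule order_trans[rotated]) simp
  from weighted_le[OF this r(1)] True show ?thesis by (simp add: \<gamma>'_def min_absorb1)
next
  case False
  then have g: "2 < \<gamma>" using gamma by simp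
  have "ennreal (r powr (\<alpha> - 2)) * (\<integral>\<^sup>+ y\<in>ball 0 r. ennreal ((norm y)\<^sup>2) \<partial>\<mu>) \<le> ennreal c"
    using high[OF r g] by (rule order_trans[rotated]) simp
  from weighted_le[OF this r(1)] show ?thesis using g
    by (simp add: \<gamma>'_def min_absorb2)
qed

lemma middle_mass_high:
  assumes r: "0 < r" "r < 1" and g: "2 < \<gamma>"
  shows "(\<integral>\<^sup>+ z\<in>ball 0 1 - ball 0 r. ennreal (norm z powr (\<gamma> - 1)) \<partial>\<mu>) \<le> ennreal (c * r powr (\<beta> - 1))"
proof -
  have "ennreal (r powr (1 - \<beta>)) * (\<integral>\<^sup>+ y\<in>ball 0 1 - ball 0 r. ennreal (norm y powr (\<gamma> - 1)) \<partial>\<mu>) \<le> ennreal c"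
    using high[OF r g] by (rule order_trans[rotated]) simp
  from weighted_le[OF this r(1)] show ?thesis by simp
qed

text \<open>
  For \<open>\<gamma> > 2\<close> only the moment of order \<open>\<gamma> - 1\<close> is controlled; on \<open>|z| \<ge> r\<close> it dominates the first moment, at the
  price of the factor \<open>r\<^bsup>2-\<gamma>\<^esup>\<close>.
\<close>

lemma middle_mass:
  assumes r: "0 < r" "r < 1"
  shows "(\<integral>\<^sup>+ z\<in>ball 0 1 - ball 0 r. ennreal (norm z) \<partial>\<mu>) \<le> ennreal (c * r powr (1 - \<alpha>))"
proof (cases "\<gamma> < 2")
  case True
  have "ennreal (r powr (\<alpha> - 1)) * (\<integral>\<^sup>+ y\<in>ball 0 1 - ball 0 r. ennreal (norm y) \<partial>\<mu>) \<le> ennreal c"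
    using low[OF r True] by (rule order_trans[rotated]) simp
  from weighted_le[OF this r(1)] show ?thesis by simp
next
  case False
  then have g: "2 < \<gamma>" using gamma by simp
  have le: "norm z \<le> r powr (2 - \<gamma>) * norm z powr (\<gamma> - 1)" if "r \<le> norm z" for z :: "real^'d"
  proof -
    have z: "norm z > 0" using that r by linarith
    have "norm z = norm z powr (2 - \<gamma>) * norm z powr (\<gamma> - 1)" using z by (simp add: powr_add[symmetric])
    also have "\<dots> \<le> r powr (2 - \<gamma>) * norm z powr (\<gamma> - 1)"
      using that r g by (intro mult_right_mono powr_mono2') auto
    finally show ?thesis .
  qed
  have "(\<integral>\<^sup>+ z\<in>ball 0 1 - ball 0 r. ennreal (norm z) \<partial>\<mu>)
    \<le> (\<integral>\<^sup>+ z. ennreal (r powr (2 - \<gamma>)) * (ennreal (norm z powr (\<gamma> - 1)) * indicator (ball 0 1 - ball 0 r) z) \<partial>\<mu>)"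
    using le by (intro nn_integral_mono) (auto simp: indicator_def ennreal_mult[symmetric] intro!: ennreal_leI)
  also have "\<dots> = ennreal (r powr (2 - \<gamma>)) * (\<integral>\<^sup>+ z\<in>ball 0 1 - ball 0 r. ennreal (norm z powr (\<gamma> - 1)) \<partial>\<mu>)"
    by (rule nn_integral_cmult) (use zone_indicators_measurable in measurable)
  also have "\<dots> \<le> ennreal (r powr (2 - \<gamma>)) * ennreal (c * r powr (\<beta> - 1))"
    by (intro mult_left_mono middle_mass_high[OF r g]) auto
  also have "\<dots> = ennreal (c * (r powr (2 - \<gamma>) * r powr (\<beta> - 1)))"
    using c_pos by (simp add: ennreal_mult[symmetric] mult_ac)
  also have "r powr (2 - \<gamma>) * r powr (\<beta> - 1) = r powr (1 - \<alpha>)"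
    by (simp add: powr_add[symmetric])
  finally show ?thesis .
qed

lemma far_mass: "(\<integral>\<^sup>+ z\<in>{z. 1 \<le> norm z}. 1 \<partial>\<mu>) \<le> ennreal levy_mass"
  using emeasure_away_finite[of 1] by simp

text \<open>
  All estimates below split the jumps at a scale \<open>r\<close> and at one. The weight \<open>w\<close> of the middle zone is
  \<open>|z|\<close> or \<open>|z|\<^bsup>\<gamma>-1\<^esup>\<close>.
\<close>

lemma nn_integral_three_zones:
  fixes F :: "real^'d \<Rightarrow> real"
  assumes r: "0 < r" "r < 1" and nn: "0 \<le> a" "0 \<le> b" "0 \<le> e" "0 \<le> k"
    and [measurable]: "w \<in> borel_measurable borel" and w: "\<And>z. 0 \<le> w z"
    and middle: "(\<integral>\<^sup>+ z\<in>ball 0 1 - ball 0 r. ennreal (w z) \<partial>\<mu>) \<le> ennreal k"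
    and F1: "\<And>z. norm z < r \<Longrightarrow> \<bar>F z\<bar> \<le> a * norm z powr \<gamma>'"
    and F2: "\<And>z. r \<le> norm z \<Longrightarrow> norm z < 1 \<Longrightarrow> \<bar>F z\<bar> \<le> b * w z"
    and F3: "\<And>z. 1 \<le> norm z \<Longrightarrow> \<bar>F z\<bar> \<le> e"
  shows "(\<integral>\<^sup>+z. ennreal \<bar>F z\<bar> \<partial>\<mu>) \<le> ennreal (a * (c * r powr (\<gamma>' - \<alpha>)) + b * k + e * levy_mass)"
proof -
  let ?A = "ball 0 r :: (real^'d) set" and ?B = "ball 0 1 - ball 0 r :: (real^'d) set" and ?C = "{z :: real^'d. 1 \<le> norm z}"
  have "(\<integral>\<^sup>+z. ennreal \<bar>F z\<bar> \<partial>\<mu>) \<le> (\<integral>\<^sup>+z. ennreal a * (ennreal (norm z powr \<gamma>') * indicator ?A z)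
      + ennreal b * (ennreal (w z) * indicator ?B z) + ennreal e * (1 * indicator ?C z) \<partial>\<mu>)"
  proof (rule nn_integral_mono)
    fix z :: "real^'d"
    consider "norm z < r" | "r \<le> norm z" "norm z < 1" | "1 \<le> norm z" by linarith
    then show "ennreal \<bar>F z\<bar> \<le> ennreal a * (ennreal (norm z powr \<gamma>') * indicator ?A z)
      + ennreal b * (ennreal (w z) * indicator ?B z) + ennreal e * (1 * indicator ?C z)"
    proof cases
      case 1 then show ?thesis using r nn F1[OF 1] by (simp add: ennreal_mult[symmetric] ennreal_leI)
    next
      case 2 then show ?thesis using r nn w[of z] F2[OF 2] by (simp add: ennreal_mult[symmetric] ennreal_leI)
    next
      case 3 then show ?thesis using r nn F3[OF 3] by (simp add: ennreal_leI)
    qed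
  qed
  also have "\<dots> = ennreal a * (\<integral>\<^sup>+z\<in>?A. ennreal (norm z powr \<gamma>') \<partial>\<mu>) + ennreal b * (\<integral>\<^sup>+z\<in>?B. ennreal (w z) \<partial>\<mu>)
      + ennreal e * (\<integral>\<^sup>+z\<in>?C. 1 \<partial>\<mu>)"
    by (subst nn_integral_add, measurable)+ (subst nn_integral_cmult, measurable)+
  also have "\<dots> \<le> ennreal a * ennreal (c * r powr (\<gamma>' - \<alpha>)) + ennreal b * ennreal k + ennreal e * ennreal levy_mass"
    by (intro add_mono mult_left_mono near_mass[OF r] middle far_mass) auto
  also have "\<dots> = ennreal (a * (c * r powr (\<gamma>' - \<alpha>)) + b * k + e * levy_mass)"
    using nn c_pos levy_mass_nonneg by (simp add: ennreal_mult[symmetric])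
  finally show ?thesis .
qed

definition jump_weight :: "real^'d \<Rightarrow> real" where
  "jump_weight z = (if norm z < 1 then norm z powr \<gamma>' else 1)"

lemma jump_weight_nonneg: "0 \<le> jump_weight z" by (simp add: jump_weight_def)

lemma jump_weight_integrable: "integrable \<mu> jump_weight"
proof (rule integrableI_bounded)
  show "jump_weight \<in> borel_measurable \<mu>" unfolding jump_weight_def[abs_def] by measurable
  \<comment> \<open>The scale \<open>1/2\<close> is arbitrary.\<close>
  have "(\<integral>\<^sup>+z. ennreal \<bar>jump_weight z\<bar> \<partial>\<mu>) \<le> ennreal (1 * (c * (1/2) powr (\<gamma>' - \<alpha>)) + 1 * (c * (1/2) powr (1 - \<alpha>)) + 1 * levy_mass)"
  proof (rule nn_integral_three_zones[where w = norm, OF _ _ _ _ _ _ _ _ middle_mass])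
    fix z :: "real^'d" assume "1 / 2 \<le> norm z" "norm z < 1"
    then show "\<bar>jump_weight z\<bar> \<le> 1 * norm z"
      using \<gamma>'_bounds powr_mono'[of 1 \<gamma>' "norm z"] by (simp add: jump_weight_def)
  qed (use c_pos in \<open>auto simp: jump_weight_def\<close>)
  then show "(\<integral>\<^sup>+z. ennreal (norm (jump_weight z)) \<partial>\<mu>) < \<infinity>" by (auto intro: le_less_trans)
qed

lemma regular_jump_small:
  assumes reg: "regular \<gamma> M \<phi> g" and z: "norm z < 1"
  shows "\<bar>jump \<phi> g x z\<bar> \<le> M * norm z powr \<gamma>'"
proof -
  obtain t where t: "0 < t" "t < 1" and eq: "\<phi> (x + z) - \<phi> x = g (x + t *\<^sub>R z) \<bullet> z"
    using gradient_MVT[OF regularD(1)[OF reg], of x z] by blast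
  have "\<bar>jump \<phi> g x z\<bar> = \<bar>(g (x + t *\<^sub>R z) - g x) \<bullet> z\<bar>" using z eq by (simp add: jump_def inner_diff_left)
  also have "\<dots> \<le> norm (g (x + t *\<^sub>R z) - g x) * norm z" by (rule Cauchy_Schwarz_ineq2)
  also have "\<dots> \<le> (M * norm (t *\<^sub>R z) powr (\<gamma>' - 1)) * norm z"
    using regularD(4)[OF reg, of "x + t *\<^sub>R z" x] unfolding \<gamma>'_eq by (intro mult_right_mono) auto
  also have "\<dots> \<le> (M * norm z powr (\<gamma>' - 1)) * norm z"
    using t \<gamma>'_bounds regularD(6)[OF reg] by (intro mult_right_mono mult_left_mono powr_mono2) (auto intro: mult_left_le_one_le)
  also have "\<dots> = M * norm z powr \<gamma>'"
  proof (cases "z = 0")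
    case False
    then have "norm z powr (\<gamma>' - 1) * norm z = norm z powr \<gamma>'" by (simp add: powr_diff)
    then show ?thesis by simp
  qed simp
  finally show ?thesis .
qed

lemma regular_jump_bound:
  assumes reg: "regular \<gamma> M \<phi> g"
  shows "\<bar>jump \<phi> g x z\<bar> \<le> 2 * M * jump_weight z"
proof (cases "norm z < 1")
  case True
  have "\<bar>jump \<phi> g x z\<bar> \<le> M * norm z powr \<gamma>'" by (rule regular_jump_small[OF reg True])
  also have "\<dots> \<le> 2 * M * norm z powr \<gamma>'" using regularD(6)[OF reg] by (intro mult_right_mono) auto
  finally show ?thesis using True by (simp add: jump_weight_def)
next
  case False
  then show ?thesis using regularD(2)[OF reg, of "x + z"] regularD(2)[OF reg, of x]
    by (simp add: jump_def jump_weight_def)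
qed

lemma regular_continuous:
  assumes "regular \<gamma> M \<phi> g"
  shows "continuous_on UNIV \<phi>" "continuous_on UNIV g"
proof -
  show "continuous_on UNIV \<phi>"
    using regularD(1)[OF assms] by (auto intro!: continuous_at_imp_continuous_on has_derivative_continuous)
  have "isCont g x" for x
  proof -
    have "(\<lambda>y. g y - g x) \<midarrow>x\<rightarrow> 0"
    proof (rule Lim_null_comparison)
      show "\<forall>\<^sub>F y in at x. norm (g y - g x) \<le> M * norm (y - x) powr min (\<gamma> - 1) 1"
        using regularD(4)[OF assms] by simp
      have "((\<lambda>y. M * norm (y - x) powr min (\<gamma> - 1) 1) \<longlongrightarrow> M * norm (x - x) powr min (\<gamma> - 1) 1) (at x)"
        using alpha beta by (intro tendsto_intros tendsto_powr') auto
      then show "((\<lambda>y. M * norm (y - x) powr min (\<gamma> - 1) 1) \<longlongrightarrow> 0) (at x)" by simp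
    qed
    then show ?thesis by (simp add: isCont_def LIM_zero_iff)
  qed
  then show "continuous_on UNIV g" by (simp add: continuous_on_eq_continuous_at)
qed

lemma regular_jump_integrable:
  assumes reg: "regular \<gamma> M \<phi> g"
  shows "integrable \<mu> (jump \<phi> g x)"
proof -
  have [measurable]: "\<phi> \<in> borel_measurable borel" "g \<in> borel_measurable borel"
    using regular_continuous[OF reg] by (auto intro: borel_measurable_continuous_onI)
  have "integrable \<mu> (\<lambda>z. 2 * M * jump_weight z)" using jump_weight_integrable by simp
  then show ?thesis
    by (rule Bochner_Integration.integrable_bound)
       (use regular_jump_bound[OF reg] in \<open>auto intro!: AE_I2 intro: order_trans[OF _ abs_ge_self]\<close>)
qed

definition K0 :: real where "K0 = 2 * (LINT z|\<mu>. jump_weight z)"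

lemma K0_nonneg: "K0 \<ge> 0"
  unfolding K0_def using jump_weight_nonneg by simp

lemma regular_levy_int_bound:
  assumes reg: "regular \<gamma> M \<phi> g"
  shows "\<bar>levy_int \<phi> g x\<bar> \<le> K0 * M"
proof -
  have "integrable \<mu> (\<lambda>z. 2 * M * jump_weight z)" using jump_weight_integrable by simp
  from levy_int_bound[OF this regular_jump_bound[OF reg], of x] show ?thesis by (simp add: K0_def mult_ac)
qed

lemma levy_int_diff:
  assumes 1: "regular \<gamma> M1 \<phi>1 g1" and 2: "regular \<gamma> M2 \<phi>2 g2"
  shows "levy_int (\<lambda>y. \<phi>1 y - \<phi>2 y) (\<lambda>y. g1 y - g2 y) x = levy_int \<phi>1 g1 x - levy_int \<phi>2 g2 x"
proof -
  have "jump (\<lambda>y. \<phi>1 y - \<phi>2 y) (\<lambda>y. g1 y - g2 y) x = (\<lambda>z. jump \<phi>1 g1 x z - jump \<phi>2 g2 x z)"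
    by (simp add: fun_eq_iff jump_def inner_diff_left algebra_simps)
  then show ?thesis unfolding levy_int_def
    using regular_jump_integrable[OF 1, of x] regular_jump_integrable[OF 2, of x] by simp
qed

definition K1 :: real where "K1 = 4 * c + 2 * levy_mass"

lemma K1_nonneg: "K1 \<ge> 0" using c_pos levy_mass_nonneg by (simp add: K1_def)

lemma abs_integral_three_zones:
  assumes "(\<integral>\<^sup>+z. ennreal \<bar>F z\<bar> \<partial>\<mu>) \<le> ennreal b" "0 \<le> b"
  shows "\<bar>\<integral>z. F z \<partial>\<mu>\<bar> \<le> b"
proof -
  have "ennreal \<bar>\<integral>z. F z \<partial>\<mu>\<bar> \<le> ennreal b"
    by (rule order_trans[OF norm_integral_le_nn_integral[of \<mu> F, unfolded real_norm_def] assms(1)])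
  then show ?thesis using assms(2) by (simp add: ennreal_le_iff)
qed

text \<open>
  Split at \<open>r = |x - y|\<close>. Below this scale, for \<open>\<gamma> < 2\<close>, estimate the two jumps separately. In all other cases
  with \<open>|z| < 1\<close> the difference of the jumps is controlled by a mixed difference of the gradient with
  increments \<open>x - y\<close> and a multiple of \<open>z\<close>, where the shorter one enters linearly if \<open>\<gamma> > 2\<close>. Each zone contributes
  a multiple of \<open>r\<^bsup>\<beta>\<^esup>\<close>.
\<close>

lemma regular_levy_int_Holder:
  assumes reg: "regular \<gamma> M \<phi> g" and xy: "norm (x - y) < 1"
  shows "\<bar>levy_int \<phi> g x - levy_int \<phi> g y\<bar> \<le> K1 * M * norm (x - y) powr \<beta>"
proof (cases "x = y")
  case False
  define r where "r = norm (x - y)"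
  have r: "0 < r" "r < 1" using False xy by (auto simp: r_def)
  have M: "M \<ge> 0" by (rule regularD(6)[OF reg])
  let ?F = "\<lambda>z. jump \<phi> g x z - jump \<phi> g y z"
  have eq: "levy_int \<phi> g x - levy_int \<phi> g y = (LINT z|\<mu>. ?F z)"
    unfolding levy_int_def using regular_jump_integrable[OF reg] by simp
  have far: "\<bar>?F z\<bar> \<le> 2 * M * r powr \<beta>" if "1 \<le> norm z" for z
  proof -
    have L: "\<bar>\<phi> a - \<phi> b\<bar> \<le> M * norm (a - b)" for a b
      by (rule bounded_gradient_Lipschitz[OF regularD(1)[OF reg] regularD(3)[OF reg]])
    have "\<bar>?F z\<bar> \<le> \<bar>\<phi> (x + z) - \<phi> (y + z)\<bar> + \<bar>\<phi> x - \<phi> y\<bar>" using that by (simp add: jump_def)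
    also have "\<dots> \<le> M * r + M * r" using L[of "x + z" "y + z"] L[of x y] by (simp add: r_def)
    also have "\<dots> = 2 * M * r powr 1" using r by simp
    also have "\<dots> \<le> 2 * M * r powr \<beta>" using r beta M by (intro mult_left_mono powr_mono') auto
    finally show ?thesis .
  qed
  have mid: "\<exists>t. 0 < t \<and> t < 1 \<and> \<bar>?F z\<bar> \<le> norm (g (x + t *\<^sub>R z) - g (y + t *\<^sub>R z) - g x + g y) * norm z"
    if "norm z < 1" for z
  proof -
    obtain t where t: "0 < t" "t < 1" and e: "(\<phi> (x + z) - \<phi> x) - (\<phi> (y + z) - \<phi> y) = g (x + t *\<^sub>R z) \<bullet> z - g (y + t *\<^sub>R z) \<bullet> z"
      using gradient_MVT_difference[OF regularD(1)[OF reg], of x z y z] by blast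
    have "?F z = (g (x + t *\<^sub>R z) - g (y + t *\<^sub>R z) - g x + g y) \<bullet> z"
      using that e by (simp add: jump_def inner_diff_left inner_add_left)
    then show ?thesis using t Cauchy_Schwarz_ineq2 by metis
  qed
  have tz: "norm (t *\<^sub>R z) powr e \<le> norm z powr e" if "0 < t" "t < 1" "e \<ge> 0" for t e and z :: "real^'d"
    using that by (intro powr_mono2) (auto intro: mult_left_le_one_le)
  have "\<bar>\<integral>z. ?F z \<partial>\<mu>\<bar> \<le> K1 * M * r powr \<beta>"
  proof (cases "\<gamma> < 2")
    case True
    have g': "\<gamma>' = \<gamma>" "min (\<gamma> - 1) 1 = \<gamma> - 1" using True by (auto simp: \<gamma>'_def)
    have "(\<integral>\<^sup>+z. ennreal \<bar>?F z\<bar> \<partial>\<mu>) \<le> ennreal ((2 * M) * (c * r powr (\<gamma>' - \<alpha>)) + (2 * M * r powr (\<gamma> - 1)) * (c * r powr (1 - \<alpha>)) + (2 * M * r powr \<beta>) * levy_mass)"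
    proof (rule nn_integral_three_zones[where w = norm, OF r _ _ _ _ _ _ middle_mass[OF r]])
      fix z :: "real^'d" assume z: "norm z < r"
      have "\<bar>?F z\<bar> \<le> M * norm z powr \<gamma>' + M * norm z powr \<gamma>'"
        using regular_jump_small[OF reg, of z x] regular_jump_small[OF reg, of z y] z r by linarith
      then show "\<bar>?F z\<bar> \<le> 2 * M * norm z powr \<gamma>'" by simp
    next
      fix z :: "real^'d" assume z: "r \<le> norm z" "norm z < 1"
      from mid[OF z(2)] obtain t where t: "0 < t" "t < 1" 
        and F: "\<bar>?F z\<bar> \<le> norm (g (x + t *\<^sub>R z) - g (y + t *\<^sub>R z) - g x + g y) * norm z" by blast
      have "norm (g (x + t *\<^sub>R z) - g (y + t *\<^sub>R z) - g x + g y) \<le> norm (g (x + t *\<^sub>R z) - g (y + t *\<^sub>R z)) + norm (g x - g y)"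
        using norm_triangle_ineq4[of "g (x + t *\<^sub>R z) - g (y + t *\<^sub>R z)" "g x - g y"] by (simp add: algebra_simps)
      also have "\<dots> \<le> M * r powr (\<gamma> - 1) + M * r powr (\<gamma> - 1)"
        using regularD(4)[OF reg, of "x + t *\<^sub>R z" "y + t *\<^sub>R z"] regularD(4)[OF reg, of x y]
        unfolding g' by (intro add_mono) (simp_all add: r_def)
      finally have "norm (g (x + t *\<^sub>R z) - g (y + t *\<^sub>R z) - g x + g y) * norm z \<le> (2 * M * r powr (\<gamma> - 1)) * norm z"
        by (intro mult_right_mono) auto
      with F show "\<bar>?F z\<bar> \<le> (2 * M * r powr (\<gamma> - 1)) * norm z" by linarith
    qed (use far M c_pos in auto)
    then have "\<bar>\<integral>z. ?F z \<partial>\<mu>\<bar> \<le> (2 * M) * (c * r powr (\<gamma>' - \<alpha>)) + (2 * M * r powr (\<gamma> - 1)) * (c * r powr (1 - \<alpha>)) + (2 * M * r powr \<beta>) * levy_mass"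
      using M c_pos levy_mass_nonneg by (intro abs_integral_three_zones) auto
    also have "r powr (\<gamma>' - \<alpha>) = r powr \<beta>" unfolding g' by simp
    also have "(2 * M * r powr (\<gamma> - 1)) * (c * r powr (1 - \<alpha>)) = 2 * M * c * (r powr (\<gamma> - 1) * r powr (1 - \<alpha>))" by simp
    also have "r powr (\<gamma> - 1) * r powr (1 - \<alpha>) = r powr \<beta>" by (simp add: powr_add[symmetric])
    also have "2 * M * (c * r powr \<beta>) + 2 * M * c * r powr \<beta> + 2 * M * r powr \<beta> * levy_mass = K1 * M * r powr \<beta>"
      by (simp add: K1_def algebra_simps)
    finally show ?thesis .
  next
    case False
    then have g2: "2 < \<gamma>" and g': "\<gamma>' = 2" using gamma by (auto simp: \<gamma>'_def)
    have "(\<integral>\<^sup>+z. ennreal \<bar>?F z\<bar> \<partial>\<mu>) \<le> ennreal ((M * r powr (\<gamma> - 2)) * (c * r powr (\<gamma>' - \<alpha>)) + (M * r) * (c * r powr (\<beta> - 1)) + (2 * M * r powr \<beta>) * levy_mass)"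
    proof (rule nn_integral_three_zones[where w = "\<lambda>z. norm z powr (\<gamma> - 1)", OF r _ _ _ _ _ _ middle_mass_high[OF r g2]])
      fix z :: "real^'d" assume z: "norm z < r"
      from mid[of z] z r obtain t where t: "0 < t" "t < 1" 
        and F: "\<bar>?F z\<bar> \<le> norm (g (x + t *\<^sub>R z) - g (y + t *\<^sub>R z) - g x + g y) * norm z" by auto
      have "norm (g (x + t *\<^sub>R z) - g (y + t *\<^sub>R z) - g x + g y) \<le> M * norm (t *\<^sub>R z) * r powr (\<gamma> - 2)"
        using regularD(5)[OF reg g2, of y "t *\<^sub>R z" "x - y"] by (simp add: r_def algebra_simps)
      also have "\<dots> \<le> M * norm z * r powr (\<gamma> - 2)"
        using t M by (intro mult_right_mono mult_left_mono) (auto intro: mult_left_le_one_le)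
      finally have "norm (g (x + t *\<^sub>R z) - g (y + t *\<^sub>R z) - g x + g y) * norm z \<le> (M * norm z * r powr (\<gamma> - 2)) * norm z"
        by (intro mult_right_mono) auto
      also have "\<dots> = (M * r powr (\<gamma> - 2)) * norm z powr \<gamma>'" unfolding g' by (simp add: power2_eq_square)
      finally show "\<bar>?F z\<bar> \<le> (M * r powr (\<gamma> - 2)) * norm z powr \<gamma>'" using F by linarith
    next
      fix z :: "real^'d" assume z: "r \<le> norm z" "norm z < 1"
      from mid[OF z(2)] obtain t where t: "0 < t" "t < 1" 
        and F: "\<bar>?F z\<bar> \<le> norm (g (x + t *\<^sub>R z) - g (y + t *\<^sub>R z) - g x + g y) * norm z" by blast
      have "norm (g (x + t *\<^sub>R z) - g (y + t *\<^sub>R z) - g x + g y) \<le> M * r * norm (t *\<^sub>R z) powr (\<gamma> - 2)"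
        using regularD(5)[OF reg g2, of y "x - y" "t *\<^sub>R z"] by (simp add: r_def algebra_simps)
      also have "\<dots> \<le> M * r * norm z powr (\<gamma> - 2)"
        using t M r g2 by (intro mult_left_mono tz) auto
      finally have "norm (g (x + t *\<^sub>R z) - g (y + t *\<^sub>R z) - g x + g y) * norm z \<le> (M * r * norm z powr (\<gamma> - 2)) * norm z"
        by (intro mult_right_mono) auto
      also have "\<dots> = (M * r) * (norm z powr (\<gamma> - 2) * norm z powr 1)" using z r by simp
      also have "norm z powr (\<gamma> - 2) * norm z powr 1 = norm z powr (\<gamma> - 1)" by (simp only: powr_add[symmetric]) simp
      finally show "\<bar>?F z\<bar> \<le> (M * r) * norm z powr (\<gamma> - 1)" using F by linarith
    qed (use far M c_pos r in auto)
    then have "\<bar>\<integral>z. ?F z \<partial>\<mu>\<bar> \<le> (M * r powr (\<gamma> - 2)) * (c * r powr (\<gamma>' - \<alpha>)) + (M * r) * (c * r powr (\<beta> - 1)) + (2 * M * r powr \<beta>) * levy_mass"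
      using M c_pos levy_mass_nonneg r by (intro abs_integral_three_zones) auto
    also have "(M * r powr (\<gamma> - 2)) * (c * r powr (\<gamma>' - \<alpha>)) = M * c * (r powr (\<gamma> - 2) * r powr (\<gamma>' - \<alpha>))" by simp
    also have "r powr (\<gamma> - 2) * r powr (\<gamma>' - \<alpha>) = r powr \<beta>" unfolding g' by (simp add: powr_add[symmetric])
    also have "(M * r) * (c * r powr (\<beta> - 1)) = M * c * (r powr 1 * r powr (\<beta> - 1))" using r by simp
    also have "r powr 1 * r powr (\<beta> - 1) = r powr \<beta>" by (simp only: powr_add[symmetric]) simp
    also have "M * c * r powr \<beta> + M * c * r powr \<beta> + 2 * M * r powr \<beta> * levy_mass \<le> K1 * M * r powr \<beta>"
    proof -
      have "0 \<le> M * c * r powr \<beta>" using M c_pos by simp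
      then show ?thesis by (simp add: K1_def algebra_simps)
    qed
    finally show ?thesis .
  qed
  then show ?thesis using eq by (simp add: r_def)
qed simp

section \<open>Interpolation\<close>

text \<open>
  In both ranges of \<open>\<gamma>\<close> the symmetric second difference of the gradient has the full order \<open>\<gamma> - 1\<close>; for
  \<open>\<gamma> > 2\<close> a first difference would not.
\<close>

lemma regular_symmetric_difference:
  assumes reg: "regular \<gamma> M \<phi> g"
  shows "norm (g (x + v) + g (x - v) - 2 *\<^sub>R g x) \<le> 2 * M * norm v powr (\<gamma> - 1)"
proof (cases "\<gamma> < 2")
  case True
  then have g': "min (\<gamma> - 1) 1 = \<gamma> - 1" by simp
  have "norm (g (x + v) + g (x - v) - 2 *\<^sub>R g x) \<le> norm (g (x + v) - g x) + norm (g (x - v) - g x)"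
    using norm_triangle_ineq[of "g (x + v) - g x" "g (x - v) - g x"] by (simp add: algebra_simps scaleR_2)
  also have "\<dots> \<le> M * norm v powr (\<gamma> - 1) + M * norm v powr (\<gamma> - 1)"
    using regularD(4)[OF reg, of "x + v" x] regularD(4)[OF reg, of "x - v" x] unfolding g' by (intro add_mono) auto
  finally show ?thesis by simp
next
  case False
  then have g2: "2 < \<gamma>" using gamma by simp
  have "norm (g (x + v) + g (x - v) - 2 *\<^sub>R g x) \<le> M * norm v * norm v powr (\<gamma> - 2)"
    using regularD(5)[OF reg g2, of "x - v" v v] by (simp add: algebra_simps scaleR_2)
  also have "\<dots> = M * norm v powr (\<gamma> - 1)"
  proof (cases "v = 0")
    case False
    then have "norm v * norm v powr (\<gamma> - 2) = norm v powr 1 * norm v powr (\<gamma> - 2)" by simp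
    also have "\<dots> = norm v powr (\<gamma> - 1)" by (simp only: powr_add[symmetric]) simp
    finally show ?thesis by simp
  qed simp
  also have "\<dots> \<le> 2 * M * norm v powr (\<gamma> - 1)" using regularD(6)[OF reg] by (intro mult_right_mono) auto
  finally show ?thesis .
qed

text \<open>
  A symmetric difference quotient of \<open>w\<close> with step \<open>r / 4\<close> in the direction of the gradient: the quotient is at
  most of order \<open>r\<^bsup>\<alpha>+\<beta>-1\<^esup>\<close> by the smallness of \<open>w\<close> in \<open>C\<^sub>b\<^sup>\<beta>\<close>, and it differs from the gradient by the same order.
\<close>

lemma interpolate_gradient:
  assumes reg: "regular \<gamma> M w g" and r: "0 < r" "r < 1"
    and small: "\<And>x y. norm (x - y) < 1 \<Longrightarrow> \<bar>w x - w y\<bar> \<le> M * r powr \<alpha> * norm (x - y) powr \<beta>"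
  shows "norm (g x) \<le> 4 * M * r powr (\<gamma> - 1)"
proof (cases "g x = 0")
  case False
  have M: "M \<ge> 0" by (rule regularD(6)[OF reg])
  define e where "e = g x /\<^sub>R norm (g x)"
  have e: "norm e = 1" "g x \<bullet> e = norm (g x)"
    using False by (auto simp: e_def inner_commute dot_square_norm power2_eq_square)
  \<comment> \<open>The step \<open>r / 4\<close> keeps the distance of the two points below one.\<close>
  define v where "v = (r / 4) *\<^sub>R e"
  have v: "norm v = r / 4" using r e by (simp add: v_def)
  obtain t where t: "0 < t" "t < 1" and eq: "(w (x + v) - w x) - (w (x + - v) - w x) = g (x + t *\<^sub>R v) \<bullet> v - g (x + t *\<^sub>R - v) \<bullet> - v"
    using gradient_MVT_difference[OF regularD(1)[OF reg], of x v x "- v"] by blast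
  let ?s = "g (x + t *\<^sub>R v) + g (x - t *\<^sub>R v) - 2 *\<^sub>R g x"
  have "w (x + v) - w (x - v) = (g (x + t *\<^sub>R v) + g (x - t *\<^sub>R v)) \<bullet> v" using eq by (simp add: inner_add_left)
  also have "\<dots> = 2 * (g x \<bullet> v) + ?s \<bullet> v" by (simp add: inner_diff_left inner_add_left)
  also have "g x \<bullet> v = r / 4 * norm (g x)" using e by (simp add: v_def)
  finally have "r / 2 * norm (g x) = w (x + v) - w (x - v) - ?s \<bullet> v" by simp
  also have "\<dots> \<le> \<bar>w (x + v) - w (x - v)\<bar> + \<bar>?s \<bullet> v\<bar>" by linarith
  also have "\<dots> \<le> M * r powr \<alpha> * r powr \<beta> + (2 * M * r powr (\<gamma> - 1)) * (r / 4)"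
  proof (rule add_mono)
    have d: "norm (x + v - (x - v)) = r / 2" 
    proof -
      have "x + v - (x - v) = 2 *\<^sub>R v" by (simp add: scaleR_2)
      then show ?thesis using v by simp
    qed
    have "\<bar>w (x + v) - w (x - v)\<bar> \<le> M * r powr \<alpha> * (r / 2) powr \<beta>"
      using small[of "x + v" "x - v"] r unfolding d by simp
    also have "\<dots> \<le> M * r powr \<alpha> * r powr \<beta>" using M r beta by (intro mult_left_mono powr_mono2) auto
    finally show "\<bar>w (x + v) - w (x - v)\<bar> \<le> M * r powr \<alpha> * r powr \<beta>" .
    have "\<bar>?s \<bullet> v\<bar> \<le> norm ?s * norm v" by (rule Cauchy_Schwarz_ineq2)
    also have "\<dots> \<le> (2 * M * norm (t *\<^sub>R v) powr (\<gamma> - 1)) * norm v"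
      by (intro mult_right_mono regular_symmetric_difference[OF reg]) auto
    also have "\<dots> \<le> (2 * M * r powr (\<gamma> - 1)) * norm v"
    proof -
      have "norm (t *\<^sub>R v) \<le> norm v" using t by (auto intro: mult_left_le_one_le)
      then have "norm (t *\<^sub>R v) \<le> r" using v r by linarith
      then show ?thesis using M alpha beta by (intro mult_right_mono mult_left_mono powr_mono2) auto
    qed
    finally show "\<bar>?s \<bullet> v\<bar> \<le> (2 * M * r powr (\<gamma> - 1)) * (r / 4)" using v by simp
  qed
  also have "M * r powr \<alpha> * r powr \<beta> = M * r powr (\<gamma> - 1) * r"
  proof -
    have "r powr \<alpha> * r powr \<beta> = r powr (\<gamma> - 1) * r powr 1" by (simp only: powr_add[symmetric]) simp
    then show ?thesis using r by simp
  qed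
  finally have "norm (g x) * r \<le> (3 * M * r powr (\<gamma> - 1)) * r" by (simp add: algebra_simps)
  then have "norm (g x) \<le> 3 * M * r powr (\<gamma> - 1)" using r by simp
  also have "\<dots> \<le> 4 * M * r powr (\<gamma> - 1)" using M by (intro mult_right_mono) auto
  finally show ?thesis .
qed (use regularD(6)[OF reg] in simp)

text \<open>
  Take about \<open>r / |v|\<close> steps of length \<open>|v|\<close>. By the bound on mixed differences all increments of \<open>g\<close> along these
  steps nearly agree, so that their sum, which is bounded by twice the supremum of \<open>|g|\<close>, is nearly a
  multiple of the first one.
\<close>

lemma interpolate_gradient_Lipschitz:
  assumes reg: "regular \<gamma> M w g" and r: "0 < r" and g2: "2 < \<gamma>"
    and G: "\<And>x. norm (g x) \<le> 4 * M * r powr (\<gamma> - 1)" and v: "norm v \<le> r"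
  shows "norm (g (x + v) - g x) \<le> 17 * M * r powr (\<gamma> - 2) * norm v"
proof (cases "v = 0")
  case False
  have M: "M \<ge> 0" by (rule regularD(6)[OF reg])
  have nv: "norm v > 0" using False by simp
  define d where "d = g (x + v) - g x"
  have step: "norm (g (x + real k *\<^sub>R v) - g x - real k *\<^sub>R d) \<le> real k * (M * norm v * r powr (\<gamma> - 2))"
    if "real k * norm v \<le> r" for k
    using that
  proof (induction k)
    case (Suc k)
    have "real k * norm v \<le> real (Suc k) * norm v" by (intro mult_right_mono) auto
    then have k: "real k * norm v \<le> r" using Suc.prems by linarith
    let ?a = "g (x + real k *\<^sub>R v) - g x - real k *\<^sub>R d"
    let ?b = "g (x + v + real k *\<^sub>R v) - g (x + v) - g (x + real k *\<^sub>R v) + g x"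
    have "g (x + real (Suc k) *\<^sub>R v) - g x - real (Suc k) *\<^sub>R d = ?a + ?b"
      by (simp add: d_def algebra_simps)
    then have "norm (g (x + real (Suc k) *\<^sub>R v) - g x - real (Suc k) *\<^sub>R d) \<le> norm ?a + norm ?b"
      by (simp only: norm_triangle_ineq)
    also have "norm ?b \<le> M * norm v * norm (real k *\<^sub>R v) powr (\<gamma> - 2)" by (rule regularD(5)[OF reg g2])
    also have "\<dots> \<le> M * norm v * r powr (\<gamma> - 2)" using k M g2 by (intro mult_left_mono powr_mono2) auto
    finally show ?case using Suc.IH[OF k] by (simp add: algebra_simps)
  qed simp
  define n where "n = nat \<lfloor>r / norm v\<rfloor>"
  have q: "r / norm v \<ge> 1" using v nv by simp
  have n: "real n \<le> r / norm v" "r / norm v < real n + 1" unfolding n_def using q by linarith+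
  have "1 \<le> \<lfloor>r / norm v\<rfloor>" using q by (simp add: le_floor_iff)
  then have "1 \<le> n" unfolding n_def by linarith
  then have n1: "real n \<ge> 1" by simp
  have nr: "real n * norm v \<le> r" using n(1) nv by (simp add: field_simps)
  have rn: "r \<le> 2 * real n * norm v"
  proof -
    have "r / norm v \<le> 2 * real n" using n(2) n1 by linarith
    then show ?thesis using nv by (simp add: field_simps)
  qed
  let ?R = "M * r powr (\<gamma> - 2) * norm v"
  have "real n * norm d = norm (real n *\<^sub>R d)" by simp
  also have "\<dots> \<le> norm (g (x + real n *\<^sub>R v) - g x - real n *\<^sub>R d) + (norm (g (x + real n *\<^sub>R v)) + norm (g x))"
  proof -
    have "real n *\<^sub>R d = (g (x + real n *\<^sub>R v) - g x) - (g (x + real n *\<^sub>R v) - g x - real n *\<^sub>R d)" by simp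
    then have "norm (real n *\<^sub>R d) \<le> norm (g (x + real n *\<^sub>R v) - g x) + norm (g (x + real n *\<^sub>R v) - g x - real n *\<^sub>R d)"
      by (metis norm_triangle_ineq4)
    then show ?thesis using norm_triangle_ineq4[of "g (x + real n *\<^sub>R v)" "g x"] by linarith
  qed
  also have "\<dots> \<le> real n * ?R + 8 * M * r powr (\<gamma> - 1)"
    using step[OF nr] G[of x] G[of "x + real n *\<^sub>R v"] by (simp add: algebra_simps)
  also have "8 * M * r powr (\<gamma> - 1) = 8 * M * r powr (\<gamma> - 2) * r"
  proof -
    have "r powr (\<gamma> - 1) = r powr (\<gamma> - 2) * r powr 1" by (simp only: powr_add[symmetric]) simp
    then show ?thesis using r by simp
  qed
  \<comment> \<open>Since \<open>n \<ge> r / (2 |v|)\<close>, the endpoint values contribute \<open>16\<close> and the accumulated error contributes \<open>1\<close>.\<close>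
  also have "\<dots> \<le> 8 * M * r powr (\<gamma> - 2) * (2 * real n * norm v)" using M rn by (intro mult_left_mono) auto
  finally have "real n * norm d \<le> real n * (17 * ?R)" by (simp add: algebra_simps)
  then have "norm d \<le> 17 * ?R" using n1 by simp
  then show ?thesis by (simp add: d_def)
qed simp

text \<open>
  The zones below contribute \<open>17 c\<close>, \<open>8 c\<close> and twice the Levy mass.
\<close>

definition K2 :: real where "K2 = 25 * c + 2 * levy_mass"

lemma K2_nonneg: "K2 \<ge> 0" using c_pos levy_mass_nonneg by (simp add: K2_def)

text \<open>
  Split at \<open>r\<close>. Small jumps use the Taylor remainder, whose constant for \<open>\<gamma> > 2\<close> is the interpolated Lipschitz
  constant of the gradient; for jumps in the middle zone the gradient is small; for the others \<open>w\<close> itself is.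
\<close>

lemma interpolate_levy_int:
  assumes reg: "regular \<gamma> M w g" and r: "0 < r" "r < 1"
    and tiny: "\<And>x. \<bar>w x\<bar> \<le> M * r powr \<alpha>"
    and small: "\<And>x y. norm (x - y) < 1 \<Longrightarrow> \<bar>w x - w y\<bar> \<le> M * r powr \<alpha> * norm (x - y) powr \<beta>"
  shows "\<bar>levy_int w g x\<bar> \<le> K2 * M * r powr \<beta>"
proof -
  have M: "M \<ge> 0" by (rule regularD(6)[OF reg])
  have G: "norm (g x) \<le> 4 * M * r powr (\<gamma> - 1)" for x by (rule interpolate_gradient[OF reg r small])
  let ?F = "jump w g x"
  define a where "a = (if \<gamma> < 2 then M else 17 * M * r powr (\<gamma> - 2))"
  have ar: "a * (c * r powr (\<gamma>' - \<alpha>)) \<le> 17 * c * M * r powr \<beta>"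
  proof (cases "\<gamma> < 2")
    case True
    have "M * c * r powr \<beta> \<le> 17 * (M * c * r powr \<beta>)" using M c_pos by simp
    then show ?thesis using True by (simp add: a_def \<gamma>'_def mult_ac)
  next
    case False
    then have "\<gamma>' = 2" by (simp add: \<gamma>'_def)
    then have "a * (c * r powr (\<gamma>' - \<alpha>)) = 17 * c * M * (r powr (\<gamma> - 2) * r powr (2 - \<alpha>))"
      using False by (simp add: a_def)
    also have "r powr (\<gamma> - 2) * r powr (2 - \<alpha>) = r powr \<beta>" by (simp add: powr_add[symmetric])
    finally show ?thesis by (rule eq_refl)
  qed
  have mid: "\<exists>t. 0 < t \<and> t < 1 \<and> \<bar>?F z\<bar> \<le> norm (g (x + t *\<^sub>R z) - g x) * norm z" if z: "norm z < 1" for z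
  proof -
    obtain t where t: "0 < t" "t < 1" and eq: "w (x + z) - w x = g (x + t *\<^sub>R z) \<bullet> z"
      using gradient_MVT[OF regularD(1)[OF reg], of x z] by blast
    have "?F z = (g (x + t *\<^sub>R z) - g x) \<bullet> z" using z eq by (simp add: jump_def inner_diff_left)
    then show ?thesis using t Cauchy_Schwarz_ineq2 by metis
  qed
  have "(\<integral>\<^sup>+z. ennreal \<bar>?F z\<bar> \<partial>\<mu>) \<le> ennreal (a * (c * r powr (\<gamma>' - \<alpha>)) + (8 * M * r powr (\<gamma> - 1)) * (c * r powr (1 - \<alpha>)) + (2 * M * r powr \<beta>) * levy_mass)"
  proof (rule nn_integral_three_zones[where w = norm, OF r _ _ _ _ _ _ middle_mass[OF r]])
    fix z :: "real^'d" assume z: "norm z < r"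
    then have z1: "norm z < 1" using r by linarith
    show "\<bar>?F z\<bar> \<le> a * norm z powr \<gamma>'"
    proof (cases "\<gamma> < 2")
      case True
      then show ?thesis using regular_jump_small[OF reg z1, of x] by (simp add: a_def)
    next
      case False
      then have g2: "2 < \<gamma>" and g': "\<gamma>' = 2" using gamma by (auto simp: \<gamma>'_def)
      from mid[OF z1] obtain t where t: "0 < t" "t < 1" and F: "\<bar>?F z\<bar> \<le> norm (g (x + t *\<^sub>R z) - g x) * norm z" by blast
      have tz: "norm (t *\<^sub>R z) \<le> norm z" using t by (auto intro: mult_left_le_one_le)
      have "norm (g (x + t *\<^sub>R z) - g x) \<le> 17 * M * r powr (\<gamma> - 2) * norm (t *\<^sub>R z)"
        using tz z by (intro interpolate_gradient_Lipschitz[OF reg r(1) g2 G]) linarith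
      also have "\<dots> \<le> 17 * M * r powr (\<gamma> - 2) * norm z" using tz M by (intro mult_left_mono) auto
      finally have "norm (g (x + t *\<^sub>R z) - g x) * norm z \<le> (17 * M * r powr (\<gamma> - 2) * norm z) * norm z" by (intro mult_right_mono) auto
      also have "\<dots> = a * norm z powr \<gamma>'" using False unfolding g' by (simp add: a_def power2_eq_square)
      finally show ?thesis using F by linarith
    qed
  next
    fix z :: "real^'d" assume z: "r \<le> norm z" "norm z < 1"
    from mid[OF z(2)] obtain t where t: "0 < t" "t < 1" and F: "\<bar>?F z\<bar> \<le> norm (g (x + t *\<^sub>R z) - g x) * norm z" by blast
    have "norm (g (x + t *\<^sub>R z) - g x) \<le> 8 * M * r powr (\<gamma> - 1)"
      using norm_triangle_ineq4[of "g (x + t *\<^sub>R z)" "g x"] G[of x] G[of "x + t *\<^sub>R z"] by linarith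
    then have "norm (g (x + t *\<^sub>R z) - g x) * norm z \<le> (8 * M * r powr (\<gamma> - 1)) * norm z" by (intro mult_right_mono) auto
    then show "\<bar>?F z\<bar> \<le> (8 * M * r powr (\<gamma> - 1)) * norm z" using F by linarith
  next
    fix z :: "real^'d" assume z: "1 \<le> norm z"
    have "\<bar>?F z\<bar> \<le> 2 * (M * r powr \<alpha>)" using z tiny[of "x + z"] tiny[of x] by (simp add: jump_def)
    also have "\<dots> \<le> 2 * (M * r powr \<beta>)" using r alpha beta M by (intro mult_left_mono powr_mono') auto
    finally show "\<bar>?F z\<bar> \<le> 2 * M * r powr \<beta>" by simp
  qed (use M c_pos in \<open>auto simp: a_def\<close>)
  then have "\<bar>\<integral>z. ?F z \<partial>\<mu>\<bar> \<le> a * (c * r powr (\<gamma>' - \<alpha>)) + (8 * M * r powr (\<gamma> - 1)) * (c * r powr (1 - \<alpha>)) + (2 * M * r powr \<beta>) * levy_mass"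
    using M c_pos levy_mass_nonneg by (intro abs_integral_three_zones) (auto simp: a_def)
  also have "(8 * M * r powr (\<gamma> - 1)) * (c * r powr (1 - \<alpha>)) = 8 * M * c * (r powr (\<gamma> - 1) * r powr (1 - \<alpha>))" by simp
  also have "r powr (\<gamma> - 1) * r powr (1 - \<alpha>) = r powr \<beta>" by (simp add: powr_add[symmetric])
  finally have "\<bar>levy_int w g x\<bar> \<le> 17 * c * M * r powr \<beta> + 8 * M * c * r powr \<beta> + 2 * M * r powr \<beta> * levy_mass"
    using ar unfolding levy_int_def by linarith
  then show ?thesis by (simp add: K2_def algebra_simps)
qed

end


section \<open>Hoelder norms and pointwise bounds\<close>

lemma sup_norm_D: "sup_norm S f \<le> ennreal N \<Longrightarrow> 0 \<le> N \<Longrightarrow> x \<in> S \<Longrightarrow> \<bar>f x\<bar> \<le> N"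
  unfolding sup_norm_def using SUP_upper[of x S "\<lambda>x. ennreal \<bar>f x\<bar>"]
  by (metis ennreal_le_iff order_trans)

lemma sup_norm_I: "(\<And>x. x \<in> S \<Longrightarrow> \<bar>f x\<bar> \<le> N) \<Longrightarrow> sup_norm S f \<le> ennreal N"
  unfolding sup_norm_def by (intro SUP_least ennreal_leI)

lemma holder_seminorm_D:
  assumes "holder_seminorm b S f \<le> ennreal N" "0 \<le> N" "x \<in> S" "y \<in> S"
  shows "\<bar>f x - f y\<bar> \<le> N * dist x y powr b"
proof (cases "x = y")
  case False
  have "ennreal (\<bar>f x - f y\<bar> / dist x y powr b) \<le> (SUP y\<in>S - {x}. ennreal (\<bar>f x - f y\<bar> / dist x y powr b))"
    using False assms(4) by (intro SUP_upper) auto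
  also have "\<dots> \<le> holder_seminorm b S f" unfolding holder_seminorm_def
    by (rule SUP_upper[OF assms(3), where f = "\<lambda>x. SUP y\<in>S - {x}. ennreal (\<bar>f x - f y\<bar> / dist x y powr b)"])
  also have "\<dots> \<le> ennreal N" by (rule assms(1))
  finally have "\<bar>f x - f y\<bar> / dist x y powr b \<le> N" using assms(2) by (simp add: ennreal_le_iff)
  then show ?thesis using False by (simp add: divide_le_eq)
qed simp

lemma holder_seminorm_I:
  assumes "\<And>x y. x \<in> S \<Longrightarrow> y \<in> S \<Longrightarrow> \<bar>f x - f y\<bar> \<le> N * dist x y powr b"
  shows "holder_seminorm b S f \<le> ennreal N"
  unfolding holder_seminorm_def
proof (intro SUP_least ennreal_leI)
  fix x y assume "x \<in> S" "y \<in> S - {x}"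
  then show "\<bar>f x - f y\<bar> / dist x y powr b \<le> N"
    using assms[of x y] by (auto simp: divide_le_eq)
qed

lemma sum_ennreal_upto_1: "(\<Sum>j\<le>Suc 0. F j) = F 0 + F (Suc 0)" for F :: "nat \<Rightarrow> ennreal"
  by simp

lemma index_words_Nil: "[] \<in> index_words 0" by (simp add: index_words_def)

lemma index_words_1: "b \<in> Basis \<Longrightarrow> [b] \<in> index_words (Suc 0)" by (simp add: index_words_def)

lemma index_words_2: "b \<in> Basis \<Longrightarrow> b' \<in> Basis \<Longrightarrow> [b, b'] \<in> index_words (Suc (Suc 0))"
  by (simp add: index_words_def)

lemma Cbn_norm_D:
  assumes "Cbn_norm n S f \<le> ennreal N"
  shows "Ck_on n S f" and "\<And>j w. j \<le> n \<Longrightarrow> w \<in> index_words j \<Longrightarrow> sup_norm S (multi_deriv S w f) \<le> ennreal N"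
proof -
  show C: "Ck_on n S f" using assms by (auto simp: Cbn_norm_def top_unique split: if_splits)
  fix j and w :: "'a list" assume j: "j \<le> n" and w: "w \<in> index_words j"
  have "sup_norm S (multi_deriv S w f) \<le> (SUP w\<in>index_words j. sup_norm S (multi_deriv S w f))"
    by (rule SUP_upper[OF w])
  also have "\<dots> \<le> (\<Sum>j\<le>n. SUP w\<in>index_words j. sup_norm S (multi_deriv S w f))"
    using j by (intro member_le_sum) auto
  also have "\<dots> \<le> ennreal N" using assms C by (simp add: Cbn_norm_def)
  finally show "sup_norm S (multi_deriv S w f) \<le> ennreal N" .
qed

lemma Cb_norm_D:
  assumes "Cb_norm \<gamma> S f \<le> ennreal N" and frac: "frac \<gamma> \<noteq> 0"
  shows "Cbn_norm (nat \<lfloor>\<gamma>\<rfloor>) S f \<le> ennreal N"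
    and "w \<in> index_words (nat \<lfloor>\<gamma>\<rfloor>) \<Longrightarrow> holder_seminorm (frac \<gamma>) S (multi_deriv S w f) \<le> ennreal N"
proof -
  let ?h = "SUP w\<in>index_words (nat \<lfloor>\<gamma>\<rfloor>). holder_seminorm (frac \<gamma>) S (multi_deriv S w f)"
  have le: "Cbn_norm (nat \<lfloor>\<gamma>\<rfloor>) S f + ?h \<le> ennreal N"
    using assms by (simp add: Cb_norm_def Let_def)
  show "Cbn_norm (nat \<lfloor>\<gamma>\<rfloor>) S f \<le> ennreal N" using le by (rule order_trans[rotated]) simp
  assume w: "w \<in> index_words (nat \<lfloor>\<gamma>\<rfloor>)"
  have "holder_seminorm (frac \<gamma>) S (multi_deriv S w f) \<le> ?h" by (rule SUP_upper[OF w])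
  also have "\<dots> \<le> Cbn_norm (nat \<lfloor>\<gamma>\<rfloor>) S f + ?h" by simp
  finally show "holder_seminorm (frac \<gamma>) S (multi_deriv S w f) \<le> ennreal N" using le by (rule order_trans)
qed

lemma grad_works:
  fixes \<phi> :: "real^'d \<Rightarrow> real"
  assumes "\<phi> differentiable at y"
  shows "(\<phi> has_derivative (\<lambda>h. grad \<phi> y \<bullet> h)) (at y)"
proof -
  have d: "(\<phi> has_derivative frechet_derivative \<phi> (at y)) (at y)" using assms frechet_derivative_works by blast
  then have lin: "linear (frechet_derivative \<phi> (at y))" by (rule has_derivative_linear)
  have "frechet_derivative \<phi> (at y) h = grad \<phi> y \<bullet> h" for h
  proof -
    have "h = (\<Sum>i\<in>UNIV. (h $ i) *\<^sub>R axis i 1)" by (simp add: vec_eq_iff axis_def if_distrib cong: if_cong)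
    then have "frechet_derivative \<phi> (at y) h = frechet_derivative \<phi> (at y) (\<Sum>i\<in>UNIV. (h $ i) *\<^sub>R axis i 1)" by simp
    also have "\<dots> = (\<Sum>i\<in>UNIV. (h $ i) * frechet_derivative \<phi> (at y) (axis i 1))"
      by (simp add: linear_sum[OF lin] linear_scale[OF lin])
    also have "\<dots> = grad \<phi> y \<bullet> h"
      by (simp add: grad_def partial_deriv_def inner_vec_def mult.commute)
    finally show ?thesis .
  qed
  then show ?thesis using d by (metis (no_types, lifting) ext)
qed

lemma grad_nth: "grad \<phi> x $ i = partial_deriv UNIV (axis i 1) \<phi> x"
  by (simp add: grad_def)

lemma norm_vec_le_card:
  fixes v :: "real^'d"
  assumes "\<And>i. \<bar>v $ i\<bar> \<le> N" shows "norm v \<le> real CARD('d) * N"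
proof -
  have "norm v \<le> (\<Sum>i\<in>UNIV. \<bar>v $ i\<bar>)" by (rule norm_le_l1_cart)
  also have "\<dots> \<le> (\<Sum>i\<in>(UNIV::'d set). N)" by (intro sum_mono assms)
  finally show ?thesis by simp
qed

lemma axis_Basis: "axis i (1::real) \<in> Basis" by (simp add: axis_in_Basis_iff)

text \<open>
  The factor \<open>d\<^sup>2\<close> comes from passing twice from bounds on components to Euclidean norms. For
  \<open>\<gamma> > 2\<close> the mean value theorem in the direction \<open>h\<close> turns the Hoelder bound on second derivatives into the bound
  on mixed differences.
\<close>

lemma Cb_norm_regular:
  fixes \<phi> :: "real^'d \<Rightarrow> real"
  assumes le: "Cb_norm \<gamma> UNIV \<phi> \<le> ennreal N" and N: "N \<ge> 0" and \<gamma>: "\<gamma> \<in> {1<..<2} \<union> {2<..<3}"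
  shows "regular \<gamma> ((real CARD('d))\<^sup>2 * N) \<phi> (grad \<phi>)"
proof -
  define D where "D = real CARD('d)"
  have D: "1 \<le> D" unfolding D_def by (simp add: Suc_leI)
  have DN: "N \<le> D * N" "D * N \<le> D\<^sup>2 * N" "N \<le> D\<^sup>2 * N"
  proof -
    show 1: "N \<le> D * N" using D N mult_right_mono[of 1 D N] by simp
    show 2: "D * N \<le> D\<^sup>2 * N" using D N by (intro mult_right_mono) (auto simp: power2_eq_square)
    show "N \<le> D\<^sup>2 * N" using 1 2 by linarith
  qed
  define n where "n = nat \<lfloor>\<gamma>\<rfloor>"
  consider "1 < \<gamma>" "\<gamma> < 2" "n = 1" "frac \<gamma> = \<gamma> - 1" | "2 < \<gamma>" "\<gamma> < 3" "n = Suc (Suc 0)" "frac \<gamma> = \<gamma> - 2"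
  proof -
    assume 1: "\<lbrakk>1 < \<gamma>; \<gamma> < 2; n = 1; frac \<gamma> = \<gamma> - 1\<rbrakk> \<Longrightarrow> thesis"
      and 2: "\<lbrakk>2 < \<gamma>; \<gamma> < 3; n = Suc (Suc 0); frac \<gamma> = \<gamma> - 2\<rbrakk> \<Longrightarrow> thesis"
    show thesis
    proof (cases "\<gamma> < 2")
      case True
      then have "1 < \<gamma>" using \<gamma> by auto
      moreover from this True have "\<lfloor>\<gamma>\<rfloor> = 1" by (simp add: floor_eq_iff)
      ultimately show ?thesis using True by (intro 1) (simp_all add: n_def frac_def)
    next
      case False
      then have "2 < \<gamma>" "\<gamma> < 3" using \<gamma> by auto
      moreover from this have "\<lfloor>\<gamma>\<rfloor> = 2" by (simp add: floor_eq_iff)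
      ultimately show ?thesis by (intro 2) (simp_all add: n_def frac_def)
    qed
  qed
  note cases = this
  have frac: "frac \<gamma> \<noteq> 0" using cases by cases auto
  have n1: "1 \<le> n" using cases by cases auto
  note Cbn = Cb_norm_D(1)[OF le frac, folded n_def]
  have Ck: "Ck_on (Suc (n - 1)) UNIV \<phi>" using Cbn_norm_D(1)[OF Cbn] n1 by simp
  then have diff: "\<phi> differentiable at y" for y by (simp add: differentiable_on_def)
  have deriv: "(\<phi> has_derivative (\<lambda>h. grad \<phi> y \<bullet> h)) (at y)" for y by (rule grad_works[OF diff])
  have b0: "\<bar>\<phi> y\<bar> \<le> N" for y
    using sup_norm_D[OF Cbn_norm_D(2)[OF Cbn _ index_words_Nil] N, of y] by (simp add: multi_deriv_def)
  have b1: "\<bar>grad \<phi> y $ i\<bar> \<le> N" for y i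
    using sup_norm_D[OF Cbn_norm_D(2)[OF Cbn _ index_words_1[OF axis_Basis]] N, of y i] n1
    by (simp add: multi_deriv_def grad_nth)
  have G: "norm (grad \<phi> y) \<le> D * N" for y unfolding D_def by (rule norm_vec_le_card[OF b1])
  show ?thesis unfolding regular_def D_def[symmetric]
  proof (intro conjI allI impI)
    show "(\<phi> has_derivative (\<lambda>h. grad \<phi> y \<bullet> h)) (at y)" for y by (rule deriv)
    show "\<bar>\<phi> y\<bar> \<le> D\<^sup>2 * N" for y using b0[of y] DN by linarith
    show "norm (grad \<phi> y) \<le> D\<^sup>2 * N" for y using G[of y] DN by linarith
  next
    fix x y
    from cases show "norm (grad \<phi> x - grad \<phi> y) \<le> D\<^sup>2 * N * norm (x - y) powr min (\<gamma> - 1) 1"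
    proof cases
      case 1
      have "\<bar>(grad \<phi> x - grad \<phi> y) $ i\<bar> \<le> N * norm (x - y) powr (\<gamma> - 1)" for i
      proof -
        have "holder_seminorm (frac \<gamma>) UNIV (multi_deriv UNIV [axis i 1] \<phi>) \<le> ennreal N"
          by (rule Cb_norm_D(2)[OF le frac], fold n_def) (use 1 index_words_1[OF axis_Basis, of i] in simp)
        from holder_seminorm_D[OF this N, of x y] show ?thesis
          using 1 by (simp add: multi_deriv_def grad_nth dist_norm)
      qed
      then have "norm (grad \<phi> x - grad \<phi> y) \<le> D * (N * norm (x - y) powr (\<gamma> - 1))"
        unfolding D_def by (rule norm_vec_le_card)
      also have "\<dots> \<le> D\<^sup>2 * N * norm (x - y) powr (\<gamma> - 1)"
        using mult_right_mono[OF DN(2), of "norm (x - y) powr (\<gamma> - 1)"] by (simp add: mult.assoc)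
      finally show ?thesis using 1 by simp
    next
      case 2
      have "\<bar>(grad \<phi> x - grad \<phi> y) $ i\<bar> \<le> D * N * norm (x - y)" for i
      proof -
        let ?\<psi> = "partial_deriv UNIV (axis i 1) \<phi>"
        have "?\<psi> differentiable at y" for y using Ck 2 axis_Basis by (auto simp: differentiable_on_def)
        note d = grad_works[OF this]
        have "\<bar>grad ?\<psi> y $ j\<bar> \<le> N" for y j
          using sup_norm_D[OF Cbn_norm_D(2)[OF Cbn _ index_words_2[OF axis_Basis axis_Basis]] N, of y j i] 2
          by (simp add: multi_deriv_def grad_nth)
        then have "norm (grad ?\<psi> y) \<le> D * N" for y unfolding D_def by (rule norm_vec_le_card)
        from bounded_gradient_Lipschitz[OF d this, of x y] show ?thesis by (simp add: grad_nth)
      qed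
      then have "norm (grad \<phi> x - grad \<phi> y) \<le> D * (D * N * norm (x - y))"
        unfolding D_def by (rule norm_vec_le_card)
      then show ?thesis using 2 by (cases "x = y") (simp_all add: power2_eq_square mult.assoc)
    qed
  next
    fix y h z assume "2 < \<gamma>"
    then have 2: "\<gamma> < 3" "n = Suc (Suc 0)" "frac \<gamma> = \<gamma> - 2" using cases by fastforce+
    have "\<bar>(grad \<phi> (y + h + z) - grad \<phi> (y + h) - grad \<phi> (y + z) + grad \<phi> y) $ i\<bar> \<le> D * N * norm z powr (\<gamma> - 2) * norm h" for i
    proof -
      let ?\<psi> = "partial_deriv UNIV (axis i 1) \<phi>"
      have "?\<psi> differentiable at y" for y using Ck 2 axis_Basis by (auto simp: differentiable_on_def)
      note d = grad_works[OF this]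
      have c: "\<bar>(grad ?\<psi> x - grad ?\<psi> y) $ j\<bar> \<le> N * norm (x - y) powr (\<gamma> - 2)" for x y j
      proof -
        have "holder_seminorm (frac \<gamma>) UNIV (multi_deriv UNIV [axis j 1, axis i 1] \<phi>) \<le> ennreal N"
          by (rule Cb_norm_D(2)[OF le frac], fold n_def) (use 2 index_words_2[OF axis_Basis axis_Basis, of j i] in simp)
        from holder_seminorm_D[OF this N, of x y] show ?thesis
          using 2 by (simp add: multi_deriv_def grad_nth dist_norm)
      qed
      have c': "norm (grad ?\<psi> x - grad ?\<psi> y) \<le> D * (N * norm (x - y) powr (\<gamma> - 2))" for x y
        unfolding D_def by (rule norm_vec_le_card[OF c])
      obtain t where "(?\<psi> (y + z + h) - ?\<psi> (y + z)) - (?\<psi> (y + h) - ?\<psi> y) = grad ?\<psi> (y + z + t *\<^sub>R h) \<bullet> h - grad ?\<psi> (y + t *\<^sub>R h) \<bullet> h"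
        using gradient_MVT_difference[OF d, of "y + z" h y h] by blast
      then have "(grad \<phi> (y + h + z) - grad \<phi> (y + h) - grad \<phi> (y + z) + grad \<phi> y) $ i
          = (grad ?\<psi> (y + z + t *\<^sub>R h) - grad ?\<psi> (y + t *\<^sub>R h)) \<bullet> h"
        by (simp add: grad_nth inner_diff_left algebra_simps)
      then have "\<bar>(grad \<phi> (y + h + z) - grad \<phi> (y + h) - grad \<phi> (y + z) + grad \<phi> y) $ i\<bar>
          \<le> norm (grad ?\<psi> (y + z + t *\<^sub>R h) - grad ?\<psi> (y + t *\<^sub>R h)) * norm h"
        by (simp only: Cauchy_Schwarz_ineq2)
      also have "\<dots> \<le> (D * (N * norm z powr (\<gamma> - 2))) * norm h"
        using c'[of "y + z + t *\<^sub>R h" "y + t *\<^sub>R h"] by (intro mult_right_mono) auto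
      finally show ?thesis by (simp add: mult.assoc)
    qed
    then have "norm (grad \<phi> (y + h + z) - grad \<phi> (y + h) - grad \<phi> (y + z) + grad \<phi> y) \<le> D * (D * N * norm z powr (\<gamma> - 2) * norm h)"
      unfolding D_def by (rule norm_vec_le_card)
    then show "norm (grad \<phi> (y + h + z) - grad \<phi> (y + h) - grad \<phi> (y + z) + grad \<phi> y) \<le> D\<^sup>2 * N * norm h * norm z powr (\<gamma> - 2)"
      by (simp add: power2_eq_square mult_ac)
  qed
qed

lemma frechet_derivative_within_Icc:
  fixes F :: "real \<Rightarrow> real"
  assumes "a < b" "t \<in> {a..b}" "(F has_real_derivative d) (at t within {a..b})"
  shows "frechet_derivative F (at t within {a..b}) = (\<lambda>x. d * x)"
proof -
  have "(F has_derivative (\<lambda>x. d * x)) (at t within cbox a b)"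
    using assms(3) by (simp add: has_field_derivative_def mult_commute_abs)
  then have "frechet_derivative F (at t within cbox a b) = (\<lambda>x. d * x)"
    using assms by (intro frechet_derivative_within_cbox) auto
  then show ?thesis by simp
qed

text \<open>
  The only multi-indices on the real line are the words in the single basis vector \<open>1\<close>.
\<close>

lemma Cb_norm_interval_le:
  fixes F h :: "real \<Rightarrow> real"
  assumes T: "T > 0" and \<theta>: "0 < \<theta>" "\<theta> < 1"
    and deriv: "\<And>t. t \<in> {0..T} \<Longrightarrow> (F has_real_derivative h t) (at t within {0..T})"
    and A: "\<And>t. t \<in> {0..T} \<Longrightarrow> \<bar>F t\<bar> \<le> A" and B: "\<And>t. t \<in> {0..T} \<Longrightarrow> \<bar>h t\<bar> \<le> B"
    and C: "\<And>s t. s \<in> {0..T} \<Longrightarrow> t \<in> {0..T} \<Longrightarrow> \<bar>h s - h t\<bar> \<le> C * \<bar>s - t\<bar> powr \<theta>"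
    and nn: "0 \<le> C"
  shows "Cb_norm (1 + \<theta>) {0..T} F \<le> ennreal (A + B + C)"
proof -
  have "0 \<in> {0..T}" using T by simp
  then have A0: "0 \<le> A" and B0: "0 \<le> B" using A[of 0] B[of 0] by linarith+
  have fl: "nat \<lfloor>1 + \<theta>\<rfloor> = Suc 0" "frac (1 + \<theta>) = \<theta>"
  proof -
    have "\<lfloor>1 + \<theta>\<rfloor> = 1" using \<theta> by (simp add: floor_eq_iff)
    then show "nat \<lfloor>1 + \<theta>\<rfloor> = Suc 0" "frac (1 + \<theta>) = \<theta>" by (simp_all add: frac_def)
  qed
  have pd: "partial_deriv {0..T} 1 F t = h t" if "t \<in> {0..T}" for t
    unfolding partial_deriv_def using frechet_derivative_within_Icc[OF T that deriv[OF that]] by simp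
  have w0: "index_words 0 = {[] :: real list}" by (auto simp: index_words_def)
  have w1: "index_words (Suc 0) = {[1 :: real]}"
    by (auto simp: index_words_def length_Suc_conv)
  have h_cont: "continuous_on {0..T} h"
    unfolding continuous_on_def
  proof
    fix t assume t: "t \<in> {0..T}"
    have "((\<lambda>s. h s - h t) \<longlongrightarrow> 0) (at t within {0..T})"
    proof (rule Lim_null_comparison)
      show "\<forall>\<^sub>F s in at t within {0..T}. norm (h s - h t) \<le> C * \<bar>s - t\<bar> powr \<theta>"
        using C t by (auto simp: eventually_at_filter)
      have "((\<lambda>s. C * \<bar>s - t\<bar> powr \<theta>) \<longlongrightarrow> C * \<bar>t - t\<bar> powr \<theta>) (at t within {0..T})"
        using \<theta> by (intro tendsto_intros tendsto_powr') auto
      then show "((\<lambda>s. C * \<bar>s - t\<bar> powr \<theta>) \<longlongrightarrow> 0) (at t within {0..T})" by simp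
    qed
    then show "(h \<longlongrightarrow> h t) (at t within {0..T})" by (simp add: LIM_zero_iff)
  qed
  have diff: "F differentiable_on {0..T}"
    unfolding differentiable_on_def using deriv real_differentiable_def by blast
  have Ck: "Ck_on (Suc 0) {0..T} F"
    using diff h_cont continuous_on_cong[OF refl pd, of "{0..T}"] by simp
  have "Cbn_norm (Suc 0) {0..T} F = sup_norm {0..T} F + sup_norm {0..T} (partial_deriv {0..T} 1 F)"
    unfolding Cbn_norm_def sum_ennreal_upto_1 w0 w1 if_P[OF Ck] by (simp add: multi_deriv_def)
  also have "\<dots> \<le> ennreal A + ennreal B"
    by (intro add_mono sup_norm_I) (use A B pd in auto)
  finally have 1: "Cbn_norm (Suc 0) {0..T} F \<le> ennreal A + ennreal B" .
  have "holder_seminorm \<theta> {0..T} (partial_deriv {0..T} 1 F) \<le> ennreal C"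
    by (rule holder_seminorm_I) (use C pd in \<open>simp add: dist_real_def\<close>)
  then have 2: "(SUP w\<in>index_words (Suc 0). holder_seminorm \<theta> {0..T} (multi_deriv {0..T} w F)) \<le> ennreal C"
    by (simp add: w1 multi_deriv_def)
  have "Cb_norm (1 + \<theta>) {0..T} F = Cbn_norm (Suc 0) {0..T} F + (SUP w\<in>index_words (Suc 0). holder_seminorm \<theta> {0..T} (multi_deriv {0..T} w F))"
    using \<theta> unfolding Cb_norm_def fl Let_def by simp
  also have "\<dots> \<le> (ennreal A + ennreal B) + ennreal C" by (rule add_mono[OF 1 2])
  also have "\<dots> = ennreal (A + B + C)" using A0 B0 nn by simp
  finally show ?thesis .
qed

section \<open>Regularity in time\<close>

text \<open>
  The two time integrals differ by one over \<open>(s, t)\<close>, up to the null set \<open>{s}\<close>. With \<open>k = 0\<close> this bounds the increment, and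
  with \<open>k\<close> a value of \<open>h\<close> it gives the derivative.
\<close>

lemma integral_increment:
  fixes h :: "real \<Rightarrow> real"
  assumes meas: "(\<lambda>s. indicator {0<..<T} s * h s) \<in> borel_measurable borel"
    and bound: "\<And>s. s \<in> {0<..<T} \<Longrightarrow> \<bar>h s\<bar> \<le> Q"
    and st: "0 \<le> s" "s \<le> t" "t \<le> T"
    and close: "\<And>\<sigma>. s < \<sigma> \<Longrightarrow> \<sigma> < t \<Longrightarrow> \<bar>h \<sigma> - k\<bar> \<le> P" and P: "0 \<le> P"
  shows "\<bar>(time_int t h) - (time_int s h) - (t - s) * k\<bar> \<le> P * (t - s)"
proof -
  define H where "H \<sigma> = indicator {0<..<T} \<sigma> * h \<sigma>" for \<sigma>
  have H_meas [measurable]: "H \<in> borel_measurable borel" using meas unfolding H_def[abs_def] .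
  have HT: "indicator {0<..<\<tau>} \<sigma> * h \<sigma> = indicator {0<..<\<tau>} \<sigma> * H \<sigma>" if "\<tau> \<le> T" for \<tau> \<sigma>
    using that by (auto simp: H_def indicator_def)
  have i: "integrable lborel (\<lambda>\<sigma>. indicator {0<..<\<tau>} \<sigma> * H \<sigma>)" if "\<tau> \<le> T" for \<tau>
    by (rule integrable_bounded_interval(1)[OF H_meas, where B = Q]) (use bound that in \<open>auto simp: H_def\<close>)
  have ik: "integrable lborel (\<lambda>\<sigma>. indicator {s<..<t} \<sigma> * k)"
    using st by (intro integrable_mult_left integrable_real_indicator) auto
  have "(time_int t h) - (time_int s h) - (t - s) * k
    = (LINT \<sigma>|lborel. indicator {0<..<t} \<sigma> * H \<sigma> - indicator {0<..<s} \<sigma> * H \<sigma> - indicator {s<..<t} \<sigma> * k)"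
    using i[of t] i[of s] ik st by (simp add: HT)
  also have "\<dots> = (LINT \<sigma>|lborel. indicator {s<..<t} \<sigma> * (h \<sigma> - k))"
  proof (rule integral_cong_AE)
    have [measurable]: "(\<lambda>\<sigma>. indicator {s<..<t} \<sigma> * (h \<sigma> - k)) \<in> borel_measurable borel"
    proof -
      have "(\<lambda>\<sigma>. indicator {s<..<t} \<sigma> * (h \<sigma> - k)) = (\<lambda>\<sigma>. indicator {s<..<t} \<sigma> * (H \<sigma> - k))"
        using st by (auto simp: H_def indicator_def fun_eq_iff)
      then show ?thesis by simp
    qed
    show "(\<lambda>\<sigma>. indicator {s<..<t} \<sigma> * (h \<sigma> - k)) \<in> borel_measurable lborel" by simp
    show "AE \<sigma> in lborel. indicator {0<..<t} \<sigma> * H \<sigma> - indicator {0<..<s} \<sigma> * H \<sigma> - indicator {s<..<t} \<sigma> * k = indicator {s<..<t} \<sigma> * (h \<sigma> - k)"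
      using AE_lborel_singleton[of s] by eventually_elim (use st in \<open>auto simp: H_def indicator_def\<close>)
  qed measurable
  finally have eq: "(time_int t h) - (time_int s h) - (t - s) * k
    = (LINT \<sigma>|lborel. indicator {s<..<t} \<sigma> * (h \<sigma> - k))" .
  have "ennreal \<bar>\<integral>\<sigma>. indicator {s<..<t} \<sigma> * (h \<sigma> - k) \<partial>lborel\<bar> \<le> (\<integral>\<^sup>+\<sigma>. ennreal (norm (indicator {s<..<t} \<sigma> * (h \<sigma> - k))) \<partial>lborel)"
    using norm_integral_le_nn_integral[of lborel "\<lambda>\<sigma>. indicator {s<..<t} \<sigma> * (h \<sigma> - k)"] by (simp only: real_norm_def)
  also have "\<dots> \<le> (\<integral>\<^sup>+\<sigma>. ennreal P * indicator {s<..<t} \<sigma> \<partial>lborel)"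
    using close by (intro nn_integral_mono) (auto simp: indicator_def intro!: ennreal_leI)
  also have "\<dots> = ennreal (P * (t - s))" using P st by (simp add: nn_integral_cmult_indicator ennreal_mult)
  finally show ?thesis unfolding eq using P st by (subst (asm) ennreal_le_iff) auto
qed

lemma integral_C1:
  fixes h F :: "real \<Rightarrow> real"
  assumes meas: "(\<lambda>s. indicator {0<..<T} s * h s) \<in> borel_measurable borel"
    and bound: "\<And>s. s \<in> {0..T} \<Longrightarrow> \<bar>h s\<bar> \<le> P"
    and F: "\<And>t. t \<in> {0..T} \<Longrightarrow> F t = F0 + (time_int t h)"
    and holder: "\<And>s t. s \<in> {0..T} \<Longrightarrow> t \<in> {0..T} \<Longrightarrow> \<bar>s - t\<bar> < 1 \<Longrightarrow> \<bar>h s - h t\<bar> \<le> Q * \<bar>s - t\<bar> powr \<theta>"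
    and Q: "0 \<le> Q" and \<theta>: "0 < \<theta>" and t: "t \<in> {0..T}"
  shows "(F has_real_derivative h t) (at t within {0..T})"
proof -
  have est: "\<bar>F s - F t - (s - t) * h t\<bar> \<le> Q * \<bar>s - t\<bar> powr \<theta> * \<bar>s - t\<bar>" if s: "s \<in> {0..T}" "\<bar>s - t\<bar> < 1" for s
  proof -
    have close: "\<bar>h \<sigma> - h t\<bar> \<le> Q * \<bar>s - t\<bar> powr \<theta>" if "\<sigma> \<in> {0..T}" "\<bar>\<sigma> - t\<bar> \<le> \<bar>s - t\<bar>" for \<sigma>
    proof -
      have "\<bar>h \<sigma> - h t\<bar> \<le> Q * \<bar>\<sigma> - t\<bar> powr \<theta>" using that s t by (intro holder) auto
      also have "\<dots> \<le> Q * \<bar>s - t\<bar> powr \<theta>" using that Q \<theta> by (intro mult_left_mono powr_mono2) auto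
      finally show ?thesis .
    qed
    have P': "0 \<le> Q * \<bar>s - t\<bar> powr \<theta>" using Q by simp
    have bd: "\<bar>h \<sigma>\<bar> \<le> P" if "\<sigma> \<in> {0<..<T}" for \<sigma> using bound that by auto
    show ?thesis
    proof (cases "s \<le> t")
      case True
      have "\<bar>(time_int t h) - (time_int s h) - (t - s) * h t\<bar>
        \<le> Q * \<bar>s - t\<bar> powr \<theta> * (t - s)"
        using True s t by (intro integral_increment[OF meas bd] close P') auto
      then show ?thesis using True s t F[of s] F[of t] by (simp add: abs_minus_commute algebra_simps)
    next
      case False
      have "\<bar>(time_int s h) - (time_int t h) - (s - t) * h t\<bar>
        \<le> Q * \<bar>s - t\<bar> powr \<theta> * (s - t)"
        using False s t by (intro integral_increment[OF meas bd] close P') auto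
      then show ?thesis using False s t F[of s] F[of t] by (simp add: algebra_simps)
    qed
  qed
  have "((\<lambda>s. (F s - F t) / (s - t) - h t) \<longlongrightarrow> 0) (at t within {0..T})"
  proof (rule Lim_null_comparison)
    have "norm ((F s - F t) / (s - t) - h t) \<le> Q * \<bar>s - t\<bar> powr \<theta>" if "s \<in> {0..T}" "s \<noteq> t" "dist s t < 1" for s
    proof -
      have "(F s - F t) / (s - t) - h t = (F s - F t - (s - t) * h t) / (s - t)"
        using that by (simp add: diff_divide_distrib)
      then have "norm ((F s - F t) / (s - t) - h t) = \<bar>F s - F t - (s - t) * h t\<bar> / \<bar>s - t\<bar>" by (simp add: abs_divide)
      also have "\<dots> \<le> (Q * \<bar>s - t\<bar> powr \<theta> * \<bar>s - t\<bar>) / \<bar>s - t\<bar>"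
        using est[of s] that by (intro divide_right_mono) (auto simp: dist_real_def)
      finally show ?thesis using that by simp
    qed
    then show "\<forall>\<^sub>F s in at t within {0..T}. norm ((F s - F t) / (s - t) - h t) \<le> Q * \<bar>s - t\<bar> powr \<theta>"
      unfolding eventually_at by (intro exI[of _ 1]) auto
    have "((\<lambda>s. Q * \<bar>s - t\<bar> powr \<theta>) \<longlongrightarrow> Q * \<bar>t - t\<bar> powr \<theta>) (at t within {0..T})"
      using \<theta> by (intro tendsto_intros tendsto_powr') auto
    then show "((\<lambda>s. Q * \<bar>s - t\<bar> powr \<theta>) \<longlongrightarrow> 0) (at t within {0..T})" by simp
  qed
  then show ?thesis by (simp add: has_field_derivative_iff LIM_zero_iff)
qed


lemma Cb_norm_1_ge:
  fixes \<phi> :: "'a::euclidean_space \<Rightarrow> real"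
  shows "ennreal \<bar>\<phi> y\<bar> \<le> Cb_norm 1 UNIV \<phi>"
    and "b \<in> Basis \<Longrightarrow> ennreal \<bar>partial_deriv UNIV b \<phi> y\<bar> \<le> Cb_norm 1 UNIV \<phi>"
proof -
  have eq: "Cb_norm 1 UNIV \<phi> = Cbn_norm (Suc 0) UNIV \<phi>" by (simp add: Cb_norm_def)
  have "ennreal \<bar>\<phi> y\<bar> \<le> Cb_norm 1 UNIV \<phi> \<and> (b \<in> Basis \<longrightarrow> ennreal \<bar>partial_deriv UNIV b \<phi> y\<bar> \<le> Cb_norm 1 UNIV \<phi>)"
  proof (cases "Cb_norm 1 UNIV \<phi> = \<infinity>")
    case False
    define N where "N = enn2real (Cb_norm 1 UNIV \<phi>)"
    have N: "0 \<le> N" "Cb_norm 1 UNIV \<phi> = ennreal N" using False by (auto simp: N_def less_top)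
    then have C: "Cbn_norm (Suc 0) UNIV \<phi> \<le> ennreal N" unfolding eq by simp
    have "\<bar>\<phi> y\<bar> \<le> N"
      using sup_norm_D[OF Cbn_norm_D(2)[OF C _ index_words_Nil] N(1), of y] by (simp add: multi_deriv_def)
    moreover have "\<bar>partial_deriv UNIV b \<phi> y\<bar> \<le> N" if "b \<in> Basis"
      using sup_norm_D[OF Cbn_norm_D(2)[OF C _ index_words_1[OF that]] N(1), of y] by (simp add: multi_deriv_def)
    ultimately show ?thesis unfolding N(2) by (auto intro: ennreal_leI)
  qed simp
  then show "ennreal \<bar>\<phi> y\<bar> \<le> Cb_norm 1 UNIV \<phi>"
    and "b \<in> Basis \<Longrightarrow> ennreal \<bar>partial_deriv UNIV b \<phi> y\<bar> \<le> Cb_norm 1 UNIV \<phi>" by auto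
qed

text \<open>
  Convergence in the \<open>C\<^sub>b\<^sup>1\<close> norm implies pointwise convergence of the function and of its gradient; this is where
  measurability in time comes from.
\<close>

lemma C_Cb1_continuous_in_time:
  fixes u :: "real \<Rightarrow> real^'d \<Rightarrow> real"
  assumes u: "u \<in> C_Cb1 T" and diff: "\<And>s y. s \<in> {0<..T} \<Longrightarrow> u s differentiable at y"
  shows "continuous_on {0<..T} (\<lambda>s. u s y)" "continuous_on {0<..T} (\<lambda>s. grad (u s) y)"
proof -
  have lim: "((\<lambda>s. Cb_norm 1 UNIV (\<lambda>x. u s x - u t x)) \<longlongrightarrow> 0) (at t within {0<..T})" if "t \<in> {0<..T}" for t
    using u that by (auto simp: C_Cb1_def)
  have sq: "(F \<longlongrightarrow> F t) (at t within {0<..T})"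
    if t: "t \<in> {0<..T}" and le: "\<And>s. s \<in> {0<..T} \<Longrightarrow> ennreal \<bar>F s - F t\<bar> \<le> Cb_norm 1 UNIV (\<lambda>x. u s x - u t x)" for F :: "real \<Rightarrow> real" and t
  proof -
    have "((\<lambda>s. ennreal \<bar>F s - F t\<bar>) \<longlongrightarrow> 0) (at t within {0<..T})"
    proof (rule tendsto_sandwich[OF _ _ tendsto_const lim[OF t]])
      show "\<forall>\<^sub>F s in at t within {0<..T}. ennreal \<bar>F s - F t\<bar> \<le> Cb_norm 1 UNIV (\<lambda>x. u s x - u t x)"
        unfolding eventually_at_filter using le by (auto intro!: always_eventually)
    qed simp
    then have "((\<lambda>s. \<bar>F s - F t\<bar>) \<longlongrightarrow> 0) (at t within {0<..T})"
      using tendsto_ennreal_iff[of "\<lambda>s. \<bar>F s - F t\<bar>" "at t within {0<..T}" 0] by simp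
    then show ?thesis by (simp add: tendsto_rabs_zero_iff LIM_zero_iff)
  qed
  show "continuous_on {0<..T} (\<lambda>s. u s y)"
    unfolding continuous_on_def
  proof
    fix t assume t: "t \<in> {0<..T}"
    show "((\<lambda>s. u s y) \<longlongrightarrow> u t y) (at t within {0<..T})"
      by (rule sq[OF t]) (rule Cb_norm_1_ge(1))
  qed
  show "continuous_on {0<..T} (\<lambda>s. grad (u s) y)"
    unfolding continuous_on_def
  proof
    fix t assume t: "t \<in> {0<..T}"
    show "((\<lambda>s. grad (u s) y) \<longlongrightarrow> grad (u t) y) (at t within {0<..T})"
    proof (rule vec_tendstoI)
      fix i
      show "((\<lambda>s. grad (u s) y $ i) \<longlongrightarrow> grad (u t) y $ i) (at t within {0<..T})"
      proof (rule sq[OF t])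
        fix s assume s: "s \<in> {0<..T}"
        have "((\<lambda>x. u s x - u t x) has_derivative (\<lambda>h. frechet_derivative (u s) (at y) h - frechet_derivative (u t) (at y) h)) (at y)"
          using diff[OF s] diff[OF t] by (intro has_derivative_diff) (auto simp: frechet_derivative_works[symmetric])
        then have "partial_deriv UNIV (axis i 1) (\<lambda>x. u s x - u t x) y = grad (u s) y $ i - grad (u t) y $ i"
          unfolding partial_deriv_def grad_nth by (simp add: frechet_derivative_at[symmetric])
        then show "ennreal \<bar>grad (u s) y $ i - grad (u t) y $ i\<bar> \<le> Cb_norm 1 UNIV (\<lambda>x. u s x - u t x)"
          using Cb_norm_1_ge(2)[OF axis_Basis, of i "\<lambda>x. u s x - u t x" y] by simp
      qed
    qed
  qed
qed

context levy_order
begin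

text \<open>
  The increment \<open>w = u(t) - u(s)\<close> is regular, and by the integral equation it is small in \<open>C\<^sub>b\<^sup>\<beta>\<close>: it has the factor
  \<open>t - s = r\<^bsup>\<alpha>\<^esup>\<close> that the interpolation lemmas ask for.
\<close>

lemma time_increments:
  assumes reg: "\<And>s. s \<in> {0..T} \<Longrightarrow> regular \<gamma> M (u s) (g s)"
    and meas: "\<And>y. (\<lambda>s. indicator {0<..<T} s * h s y) \<in> borel_measurable borel"
    and repr: "\<And>t y. t \<in> {0..T} \<Longrightarrow> u t y = u 0 y + (time_int t (\<lambda>s. h s y))"
    and P: "0 \<le> P" and bd: "\<And>s y. s \<in> {0<..<T} \<Longrightarrow> \<bar>h s y\<bar> \<le> P"
    and hold: "\<And>s x y. s \<in> {0<..<T} \<Longrightarrow> norm (x - y) < 1 \<Longrightarrow> \<bar>h s x - h s y\<bar> \<le> P * norm (x - y) powr \<beta>"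
    and st: "0 \<le> s" "s < t" "t \<le> T" "t - s < 1"
  shows "norm (g t x - g s x) \<le> 4 * (2 * M + P) * (t - s) powr ((\<gamma> - 1) / \<alpha>)"
    and "\<bar>levy_int (u t) (g t) x - levy_int (u s) (g s) x\<bar> \<le> K2 * (2 * M + P) * (t - s) powr (\<beta> / \<alpha>)"
proof -
  let ?M = "2 * M + P"
  \<comment> \<open>The scale at which the bounds in \<open>C\<^sub>b\<^sup>\<beta>\<close> and in \<open>C\<^sub>b\<^sup>\<gamma>\<close> balance.\<close>
  define r where "r = (t - s) powr (1 / \<alpha>)"
  have mem: "s \<in> {0..T}" "t \<in> {0..T}" using st by auto
  have M: "0 \<le> M" by (rule regularD(6)[OF reg[OF mem(1)]])
  have r: "0 < r" "r < 1" "r powr \<alpha> = t - s"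
    and re: "\<And>e. r powr e = (t - s) powr (e / \<alpha>)"
    using st alpha powr_less_mono2[of "1 / \<alpha>" "t - s" 1] by (auto simp: r_def powr_powr)
  have w: "regular \<gamma> ?M (\<lambda>y. u t y - u s y) (\<lambda>y. g t y - g s y)"
    by (rule regular_mono[OF regular_diff[OF reg[OF mem(2)] reg[OF mem(1)]]]) (use P in simp)
  have tiny: "\<bar>u t y - u s y\<bar> \<le> ?M * r powr \<alpha>" for y
  proof -
    have "\<bar>(time_int t (\<lambda>\<sigma>. h \<sigma> y)) - (time_int s (\<lambda>\<sigma>. h \<sigma> y)) - (t - s) * 0\<bar> \<le> P * (t - s)"
      by (rule integral_increment[OF meas bd]) (use st bd P in auto)
    then have "\<bar>u t y - u s y\<bar> \<le> P * (t - s)" using repr[OF mem(1), of y] repr[OF mem(2), of y] by simp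
    also have "\<dots> \<le> ?M * (t - s)" using M st by (intro mult_right_mono) auto
    finally show ?thesis by (simp add: r(3))
  qed
  have small: "\<bar>(u t x - u s x) - (u t y - u s y)\<bar> \<le> ?M * r powr \<alpha> * norm (x - y) powr \<beta>" if xy: "norm (x - y) < 1" for x y
  proof -
    let ?k = "\<lambda>\<sigma>. h \<sigma> x - h \<sigma> y"
    have m: "(\<lambda>s. indicator {0<..<T} s * ?k s) \<in> borel_measurable borel"
      using borel_measurable_diff[OF meas[of x] meas[of y]] by (simp add: right_diff_distrib)
    have b: "\<bar>?k \<sigma>\<bar> \<le> 2 * P" if "\<sigma> \<in> {0<..<T}" for \<sigma> using bd[OF that, of x] bd[OF that, of y] by linarith
    have split: "(time_int \<tau> (\<lambda>\<sigma>. ?k \<sigma>)) = (time_int \<tau> (\<lambda>\<sigma>. h \<sigma> x)) - (time_int \<tau> (\<lambda>\<sigma>. h \<sigma> y))"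
      if "\<tau> \<le> T" for \<tau>
    proof -
      have i: "integrable lborel (\<lambda>\<sigma>. indicator {0<..<\<tau>} \<sigma> * h \<sigma> z)" for z
      proof -
        have eq: "indicator {0<..<\<tau>} \<sigma> * (indicator {0<..<T} \<sigma> * h \<sigma> z) = indicator {0<..<\<tau>} \<sigma> * h \<sigma> z" for \<sigma>
          using that by (auto simp: indicator_def)
        have "integrable lborel (\<lambda>\<sigma>. indicator {0<..<\<tau>} \<sigma> * (indicator {0<..<T} \<sigma> * h \<sigma> z))"
          by (rule integrable_bounded_interval(1)[OF meas, where B = P]) (use bd that in auto)
        then show ?thesis unfolding eq .
      qed
      show ?thesis unfolding right_diff_distrib by (rule Bochner_Integration.integral_diff[OF i i])
    qed
    have "\<bar>(time_int t (\<lambda>\<sigma>. ?k \<sigma>)) - (time_int s (\<lambda>\<sigma>. ?k \<sigma>)) - (t - s) * 0\<bar>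
      \<le> (P * norm (x - y) powr \<beta>) * (t - s)"
      by (rule integral_increment[OF m b]) (use st hold[OF _ xy] P in auto)
    moreover have "(u t x - u s x) - (u t y - u s y)
      = (time_int t (\<lambda>\<sigma>. ?k \<sigma>)) - (time_int s (\<lambda>\<sigma>. ?k \<sigma>)) - (t - s) * 0"
      using split[of t] split[of s] st repr[OF mem(1), of x] repr[OF mem(1), of y] repr[OF mem(2), of x] repr[OF mem(2), of y]
      by linarith
    ultimately have "\<bar>(u t x - u s x) - (u t y - u s y)\<bar> \<le> (P * norm (x - y) powr \<beta>) * (t - s)"
      by (simp only:)
    also have "\<dots> = P * (norm (x - y) powr \<beta> * (t - s))" by simp
    also have "\<dots> \<le> ?M * (norm (x - y) powr \<beta> * (t - s))" using M st by (intro mult_right_mono) auto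
    finally show ?thesis by (simp add: r(3) mult_ac)
  qed
  show "norm (g t x - g s x) \<le> 4 * ?M * (t - s) powr ((\<gamma> - 1) / \<alpha>)"
    using interpolate_gradient[OF w r(1,2) small] by (simp add: re)
  show "\<bar>levy_int (u t) (g t) x - levy_int (u s) (g s) x\<bar> \<le> K2 * ?M * (t - s) powr (\<beta> / \<alpha>)"
    using interpolate_levy_int[OF w r(1,2) tiny small, of x]
    unfolding levy_int_diff[OF reg[OF mem(2)] reg[OF mem(1)]] by (simp add: re)
qed

text \<open>
  The constant in the final estimate, in terms of a bound \<open>F0\<close> on \<open>H\<close>, its Lipschitz constant \<open>Lc\<close> in the gradient,
  its Hoelder constants \<open>Mc\<close> in space and \<open>Kc\<close> in time, and the dimension \<open>D\<close>.
\<close>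

definition time_const :: "real \<Rightarrow> real \<Rightarrow> real \<Rightarrow> real \<Rightarrow> real \<Rightarrow> real" where
  "time_const F0 Lc Mc Kc D = 3 * (F0 + Mc) + Kc + (4 * Lc + K2) * (F0 + Mc)
     + (1 + 3 * (K0 + K1 + Lc) + (4 * Lc + K2) * (2 + (K0 + K1 + Lc))) * D\<^sup>2 + 1"

text \<open>
  The bounds on \<open>H\<close> are only required for gradients in a ball of radius \<open>R\<close>, which contains those of \<open>u\<close>. The
  argument first uses \<open>h\<close> on the open interval \<open>(0, T)\<close>, which gives the increments of \<open>u\<close> on \<open>[0, T]\<close>; these
  bound the gradient of \<open>u\<close> at time zero, and only then \<open>h\<close> can be estimated up to \<open>t = 0\<close>.
\<close>

lemma mild_solution_Holder_in_time:
  fixes H :: "real \<Rightarrow> real^'d \<Rightarrow> real^'d \<Rightarrow> real" and u :: "real \<Rightarrow> real^'d \<Rightarrow> real"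
  assumes T: "T > 0" and heat: "heat_kernel 0 \<mu> p"
    and H_cont: "continuous_on ({0..T} \<times> UNIV \<times> UNIV) (\<lambda>(t, x, q). H t x q)"
    and H_zero: "\<And>t x. t \<in> {0<..<T} \<Longrightarrow> \<bar>H t x 0\<bar> \<le> H0" and H0: "H0 \<ge> 0"
    and m: "m < R" "0 \<le> R" and nonneg: "0 \<le> Lc" "0 \<le> Mc" "0 \<le> Kc"
    and H_lip: "\<And>t x q q'. t \<in> {0<..<T} \<Longrightarrow> norm q < R \<Longrightarrow> norm q' < R \<Longrightarrow> \<bar>H t x q - H t x q'\<bar> \<le> Lc * norm (q - q')"
    and H_space: "\<And>t x x' q. t \<in> {0..T} \<Longrightarrow> norm q < R \<Longrightarrow> norm (x - x') < 1 \<Longrightarrow> \<bar>H t x q - H t x' q\<bar> \<le> Mc * norm (x - x') powr \<beta>"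
    and H_time: "\<And>t s x q. t \<in> {0..T} \<Longrightarrow> s \<in> {0..T} \<Longrightarrow> \<bar>t - s\<bar> < 1 \<Longrightarrow> norm q < R \<Longrightarrow> \<bar>H t x q - H s x q\<bar> \<le> Kc * \<bar>t - s\<bar> powr (\<beta> / \<alpha>)"
    and u: "u \<in> C_Cb1 T" and mild: "mild_solution T p H u0 u"
    and N: "0 \<le> N" and uN: "\<And>t. t \<in> {0..T} \<Longrightarrow> Cb_norm \<gamma> UNIV (u t) \<le> ennreal N"
    and grad_le: "\<And>t x. t \<in> {0<..T} \<Longrightarrow> norm (grad (u t) x) \<le> m"
  shows "Cb_norm (1 + \<beta> / \<alpha>) {0..T} (\<lambda>t. u t x) \<le> ennreal (time_const (H0 + Lc * R) Lc Mc Kc (real CARD('d)) * (N + 1))"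
proof -
  define D where "D = real CARD('d)"
  define M where "M = D\<^sup>2 * N"
  define g where "g s = grad (u s)" for s
  define \<theta> where "\<theta> = \<beta> / \<alpha>"
  define F0 where "F0 = H0 + Lc * R"
  have \<theta>: "0 < \<theta>" "\<theta> < 1" using alpha beta by (auto simp: \<theta>_def)
  have D: "0 \<le> D" by (simp add: D_def)
  have M: "0 \<le> M" using N by (simp add: M_def)
  have R: "0 < R"
  proof -
    have "0 \<le> m" using order_trans[OF norm_ge_zero grad_le[of T 0]] T by simp
    then show ?thesis using m by linarith
  qed
  have F0: "0 \<le> F0" using H0 nonneg R by (simp add: F0_def)
  have reg: "regular \<gamma> M (u s) (g s)" if "s \<in> {0..T}" for s
    unfolding M_def D_def g_def
    by (rule Cb_norm_regular[OF uN[OF that] N]) (use alpha beta gamma in auto)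
  have diff: "u s differentiable at y" if "s \<in> {0..T}" for s y
    using regularD(1)[OF reg[OF that]] by (auto simp: differentiable_def)
  have u_cont: "continuous_on {0<..T} (\<lambda>s. u s y)" and g_cont: "continuous_on {0<..T} (\<lambda>s. g s y)" for y
    using C_Cb1_continuous_in_time[OF u diff] by (auto simp: g_def)
  \<comment> \<open>The bounds on \<open>H\<close> extend from the open interval to the end points by continuity.\<close>
  have H_cont_t: "continuous_on {0..T} (\<lambda>t. H t x q)" for x q
  proof -
    have "continuous_on {0..T} (\<lambda>t. (\<lambda>(t, x, q). H t x q) (t, x, q))"
      by (rule continuous_on_compose2[OF H_cont]) (auto intro!: continuous_intros)
    then show ?thesis by simp
  qed
  have closure: "closure {0<..<T} = {0..T}" using T by simp
  have H_lip': "\<bar>H t x q - H t x q'\<bar> \<le> Lc * norm (q - q')" if "t \<in> {0..T}" "norm q < R" "norm q' < R" for t x q q'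
    by (rule continuous_le_on_closure[of "{0<..<T}" "\<lambda>t. \<bar>H t x q - H t x q'\<bar>" t])
       (use that H_lip[of _ q q' x] in \<open>auto simp: closure intro!: continuous_intros H_cont_t\<close>)
  have H_zero': "\<bar>H t x 0\<bar> \<le> H0" if "t \<in> {0..T}" for t x
    by (rule continuous_le_on_closure[of "{0<..<T}" "\<lambda>t. \<bar>H t x 0\<bar>" t])
       (use that H_zero[of _ x] in \<open>auto simp: closure intro!: continuous_intros H_cont_t\<close>)
  have H_bound: "\<bar>H t x q\<bar> \<le> F0" if "t \<in> {0..T}" "norm q < R" for t x q
  proof -
    have "\<bar>H t x q - H t x 0\<bar> \<le> Lc * norm (q - 0)" by (rule H_lip') (use that R in auto)
    also have "\<dots> \<le> Lc * R" using that nonneg by (intro mult_left_mono) auto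
    finally show ?thesis using H_zero'[OF that(1), of x] by (simp add: F0_def)
  qed
  \<comment> \<open>Set to zero outside \<open>(0, T)\<close>: the gradient of \<open>u\<close> at time zero is only bounded further below.\<close>
  define f where "f s y = (if s \<in> {0<..<T} then H s y (g s y) else 0)" for s y
  have g_lt: "norm (g s y) < R" if "s \<in> {0<..T}" for s y
    using grad_le[OF that, of y] m by (simp add: g_def)
  have ivl: "s \<in> {0..T}" "s \<in> {0<..T}" if "s \<in> {0<..<T}" for s using that by auto
  have fF0: "\<bar>f s y\<bar> \<le> F0" for s y
    using H_bound[of s "g s y" y] g_lt[of s y] ivl[of s] F0 by (auto simp: f_def)
  have f_cont: "continuous_on UNIV (f s)" for s
  proof (cases "s \<in> {0<..<T}")
    case True
    have "continuous_on UNIV (\<lambda>y. (\<lambda>(t, x, q). H t x q) (s, y, g s y))"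
      by (rule continuous_on_compose2[OF H_cont])
         (use regular_continuous(2)[OF reg[OF ivl(1)[OF True]]] True in \<open>auto intro!: continuous_intros\<close>)
    moreover have "f s = (\<lambda>y. H s y (g s y))" using True by (auto simp: f_def)
    ultimately show ?thesis by simp
  next
    case False
    then have "f s = (\<lambda>y. 0)" by (auto simp: f_def)
    then show ?thesis by simp
  qed
  have f_meas: "(\<lambda>z. f (fst z) (snd z)) \<in> borel_measurable (borel \<Otimes>\<^sub>M borel)"
  proof (rule Caratheodory_measurable)
    fix y
    have gc: "continuous_on {0<..<T} (\<lambda>s. g s y)" by (rule continuous_on_subset[OF g_cont]) auto
    have "continuous_on {0<..<T} (\<lambda>s. (\<lambda>(t, x, q). H t x q) (s, y, g s y))"
      by (rule continuous_on_compose2[OF H_cont])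
         (use gc in \<open>auto intro!: continuous_intros\<close>)
    then have "continuous_on {0<..<T} (\<lambda>s. H s y (g s y))" by simp
    then have "(\<lambda>s. indicator {0<..<T} s *\<^sub>R H s y (g s y)) \<in> borel_measurable borel"
      by (intro borel_measurable_continuous_on_indicator) auto
    moreover have "(\<lambda>s. f s y) = (\<lambda>s. indicator {0<..<T} s *\<^sub>R H s y (g s y))" by (auto simp: f_def indicator_def)
    ultimately show "(\<lambda>s. f s y) \<in> borel_measurable borel" by simp
  qed (rule f_cont)
  have f_eq: "semigroup_conv p (t - s) (\<lambda>y. H s y (grad (u s) y)) x = semigroup_conv p (t - s) (f s) x"
    if "t \<in> {0<..T}" "s \<in> {0<..<t}" for s t x
  proof -
    have "(\<lambda>y. H s y (grad (u s) y)) = f s" using that by (auto simp: f_def g_def)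
    then show ?thesis by simp
  qed
  have mem0: "0 \<in> {0..T}" using T by simp
  interpret heat: levy_heat \<mu> p by unfold_locales (rule heat)
  \<comment> \<open>The single bound \<open>F0 + M\<close> serves for both the source and the initial value.\<close>
  interpret duh: duhamel \<mu> p T "F0 + M" u f
  proof
    show "T > 0" by (rule T)
    show "(\<lambda>z. f (fst z) (snd z)) \<in> borel_measurable (borel \<Otimes>\<^sub>M borel)" by (rule f_meas)
    show "\<bar>f s y\<bar> \<le> F0 + M" for s y using fF0[of s y] M by linarith
    show "continuous_on UNIV (f s)" for s by (rule f_cont)
    show "u 0 \<in> borel_measurable borel"
      by (rule borel_measurable_continuous_onI[OF regular_continuous(1)[OF reg[OF mem0]]])
    show "\<bar>u 0 y\<bar> \<le> F0 + M" for y using regularD(2)[OF reg[OF mem0], of y] F0 by linarith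
  next
    fix t x assume t: "t \<in> {0<..T}"
    have "set_integrable lborel {0<..<t} (\<lambda>s. semigroup_conv p (t - s) (\<lambda>y. H s y (grad (u s) y)) x)"
      using mild t by (auto simp: mild_solution_def)
    also have "?this \<longleftrightarrow> set_integrable lborel {0<..<t} (\<lambda>s. semigroup_conv p (t - s) (f s) x)"
      by (rule set_integrable_cong) (auto simp: f_eq[OF t])
    finally show "set_integrable lborel {0<..<t} (\<lambda>s. semigroup_conv p (t - s) (f s) x)" .
    have "u t x = semigroup_conv p t u0 x + (LINT s:{0<..<t}|lborel. semigroup_conv p (t - s) (\<lambda>y. H s y (grad (u s) y)) x)" "u0 = u 0"
      using mild t by (auto simp: mild_solution_def)
    moreover have "(LINT s:{0<..<t}|lborel. semigroup_conv p (t - s) (\<lambda>y. H s y (grad (u s) y)) x)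
      = (LINT s:{0<..<t}|lborel. semigroup_conv p (t - s) (f s) x)"
      by (rule set_lebesgue_integral_cong) (auto simp: f_eq[OF t])
    ultimately show "u t x = semigroup_conv p t (u 0) x + (LINT s:{0<..<t}|lborel. semigroup_conv p (t - s) (f s) x)"
      by simp
  qed
  define h where "h s y = H s y (g s y) + levy_int (u s) (g s) y" for s y
  have W: "integrable \<mu> (\<lambda>z. 2 * M * jump_weight z)" using jump_weight_integrable by simp
  have ind: "(\<lambda>s. indicator {0<..<T} s * u s y) \<in> borel_measurable borel"
    "(\<lambda>s. indicator {0<..<T} s *\<^sub>R g s y) \<in> borel_measurable borel" for y
  proof -
    have "(\<lambda>s. indicator {0<..<T} s *\<^sub>R u s y) \<in> borel_measurable borel"
      by (intro borel_measurable_continuous_on_indicator continuous_on_subset[OF u_cont]) auto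
    then show "(\<lambda>s. indicator {0<..<T} s * u s y) \<in> borel_measurable borel" by simp
    show "(\<lambda>s. indicator {0<..<T} s *\<^sub>R g s y) \<in> borel_measurable borel"
      by (intro borel_measurable_continuous_on_indicator continuous_on_subset[OF g_cont]) auto
  qed
  note strong = duh.strong_form[OF regularD(1)[OF reg] regularD(2)[OF reg] regularD(3)[OF reg]
      regular_continuous(2)[OF reg] W regular_jump_bound[OF reg] ind]
  have fh: "indicator {0<..<t} s * (f s y + levy_int (u s) (g s) y) = indicator {0<..<t} s * h s y" if "t \<le> T" for s t y
    using that by (auto simp: f_def h_def indicator_def)
  have h_meas: "(\<lambda>s. indicator {0<..<T} s * h s y) \<in> borel_measurable borel" for y
    using strong(1)[of y] unfolding fh[OF order_refl] .
  have repr: "u t y = u 0 y + (time_int t (\<lambda>s. h s y))" if "t \<in> {0..T}" for t y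
  proof (cases "t = 0")
    case False
    then have "t \<in> {0<..T}" "t \<le> T" using that by auto
    then show ?thesis using strong(2)[of t y] fh[of t] by simp
  qed simp
  define P where "P = (F0 + Mc) + (K0 + K1 + Lc) * M"
  have P0: "0 \<le> P" using F0 nonneg K0_nonneg K1_nonneg M by (simp add: P_def)
  have bound_gen: "\<bar>h s y\<bar> \<le> P" if s: "s \<in> {0..T}" and gs: "norm (g s y) < R" for s y
  proof -
    have "\<bar>h s y\<bar> \<le> F0 + K0 * M"
      using H_bound[OF s gs, of y] regular_levy_int_bound[OF reg[OF s], of y] unfolding h_def by linarith
    also have "\<dots> \<le> P" using nonneg K1_nonneg M by (simp add: P_def distrib_right)
    finally show ?thesis .
  qed
  have hold: "\<bar>h s x - h s y\<bar> \<le> P * norm (x - y) powr \<beta>" if s: "s \<in> {0<..<T}" and xy: "norm (x - y) < 1" for s x y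
  proof -
    note s' = ivl[OF s]
    let ?d = "norm (x - y)"
    have e: "?d powr min (\<gamma> - 1) 1 \<le> ?d powr \<beta>"
      using xy alpha beta by (intro powr_mono') auto
    have "\<bar>H s x (g s x) - H s y (g s x)\<bar> \<le> Mc * ?d powr \<beta>" by (rule H_space[OF s'(1) g_lt[OF s'(2)] xy])
    moreover have "\<bar>H s y (g s x) - H s y (g s y)\<bar> \<le> Lc * (M * ?d powr \<beta>)"
    proof -
      have "norm (g s x - g s y) \<le> M * ?d powr \<beta>"
        using regularD(4)[OF reg[OF s'(1)], of x y] mult_left_mono[OF e M] by linarith
      then have "Lc * norm (g s x - g s y) \<le> Lc * (M * ?d powr \<beta>)" using nonneg by (intro mult_left_mono) auto
      then show ?thesis using H_lip'[OF s'(1) g_lt[OF s'(2)] g_lt[OF s'(2)], of y x y] by linarith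
    qed
    moreover have "\<bar>levy_int (u s) (g s) x - levy_int (u s) (g s) y\<bar> \<le> K1 * M * ?d powr \<beta>"
      by (rule regular_levy_int_Holder[OF reg[OF s'(1)] xy])
    ultimately have "\<bar>h s x - h s y\<bar> \<le> Mc * ?d powr \<beta> + Lc * (M * ?d powr \<beta>) + K1 * M * ?d powr \<beta>"
      unfolding h_def by linarith
    also have "\<dots> = (Mc + Lc * M + K1 * M) * ?d powr \<beta>" by (simp add: algebra_simps)
    also have "\<dots> \<le> P * ?d powr \<beta>"
      using F0 K0_nonneg M by (intro mult_right_mono) (auto simp: P_def algebra_simps)
    finally show ?thesis .
  qed
  have bd: "\<bar>h s y\<bar> \<le> P" if "s \<in> {0<..<T}" for s y
    by (rule bound_gen[OF ivl(1)[OF that] g_lt[OF ivl(2)[OF that]]])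
  let ?M = "2 * M + P"
  have incr: "norm (g t x - g s x) \<le> 4 * ?M * (t - s) powr ((\<gamma> - 1) / \<alpha>)"
    "\<bar>levy_int (u t) (g t) x - levy_int (u s) (g s) x\<bar> \<le> K2 * ?M * (t - s) powr (\<beta> / \<alpha>)"
    if "0 \<le> s" "s < t" "t \<le> T" "t - s < 1" for s t x
    by (rule time_increments[OF reg h_meas repr P0 bd hold]; (assumption | rule that))+
  \<comment> \<open>The gradient at time zero is the limit of later gradients, so it obeys the same bound.\<close>
  have g0: "norm (g 0 y) \<le> m" for y
  proof (rule tendsto_lowerbound[of "\<lambda>t. m + 4 * ?M * t powr ((\<gamma> - 1) / \<alpha>)" m "at_right 0"])
    have "((\<lambda>t. m + 4 * ?M * t powr ((\<gamma> - 1) / \<alpha>)) \<longlongrightarrow> m + 4 * ?M * 0 powr ((\<gamma> - 1) / \<alpha>)) (at_right 0)"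
      using alpha beta by (intro tendsto_intros tendsto_powr') (auto simp: eventually_at_filter)
    then show "((\<lambda>t. m + 4 * ?M * t powr ((\<gamma> - 1) / \<alpha>)) \<longlongrightarrow> m) (at_right 0)" by simp
    have "norm (g 0 y) \<le> m + 4 * ?M * t powr ((\<gamma> - 1) / \<alpha>)" if "0 < t" "t < min 1 T" for t
    proof -
      have "norm (g t y - g 0 y) \<le> 4 * ?M * (t - 0) powr ((\<gamma> - 1) / \<alpha>)"
        using that by (intro incr(1)) auto
      moreover have "norm (g t y) \<le> m" using that by (auto simp: g_def intro!: grad_le)
      ultimately show ?thesis using norm_triangle_ineq3[of "g t y" "g 0 y"] by simp
    qed
    then show "\<forall>\<^sub>F t in at_right 0. norm (g 0 y) \<le> m + 4 * ?M * t powr ((\<gamma> - 1) / \<alpha>)"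
      unfolding eventually_at_right_field using T by (intro exI[of _ "min 1 T"]) auto
  qed simp
  have g_lt': "norm (g s y) < R" if "s \<in> {0..T}" for s y
    using that g0[of y] m g_lt[of s y] by (cases "s = 0") auto
  have hP: "\<bar>h s y\<bar> \<le> P" if "s \<in> {0..T}" for s y by (rule bound_gen[OF that g_lt'[OF that]])
  \<comment> \<open>The Hoelder constant of \<open>h\<close> in time for \<open>|t - s| < 1\<close>; for larger distances the bound \<open>P\<close> on \<open>|h|\<close> suffices.\<close>
  define Q where "Q = Kc + (4 * Lc + K2) * ?M"
  have Q0: "0 \<le> Q" using nonneg K2_nonneg M P0 by (simp add: Q_def)
  have near_ordered: "\<bar>h t y - h s y\<bar> \<le> Q * (t - s) powr \<theta>" if st: "0 \<le> s" "s < t" "t \<le> T" "t - s < 1" for s t y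
  proof -
    let ?e = "(t - s) powr \<theta>"
    have mem: "s \<in> {0..T}" "t \<in> {0..T}" using st by auto
    have "\<bar>H t y (g t y) - H s y (g t y)\<bar> \<le> Kc * \<bar>t - s\<bar> powr (\<beta> / \<alpha>)"
      by (rule H_time[OF mem(2,1) _ g_lt'[OF mem(2)]]) (use st in auto)
    then have "\<bar>H t y (g t y) - H s y (g t y)\<bar> \<le> Kc * ?e" using st by (simp add: \<theta>_def)
    moreover have "\<bar>H s y (g t y) - H s y (g s y)\<bar> \<le> Lc * (4 * ?M * ?e)"
    proof -
      have "norm (g t y - g s y) \<le> 4 * ?M * (t - s) powr ((\<gamma> - 1) / \<alpha>)" by (rule incr(1)[OF st])
      also have "\<dots> \<le> 4 * ?M * ?e"
        using st alpha beta M P0 unfolding \<theta>_def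
        by (intro mult_left_mono powr_mono' divide_right_mono) auto
      finally have "Lc * norm (g t y - g s y) \<le> Lc * (4 * ?M * ?e)" using nonneg by (intro mult_left_mono) auto
      then show ?thesis using H_lip'[OF mem(1) g_lt'[OF mem(2)] g_lt'[OF mem(1)], of y y y] by linarith
    qed
    moreover have "\<bar>levy_int (u t) (g t) y - levy_int (u s) (g s) y\<bar> \<le> K2 * ?M * ?e"
      unfolding \<theta>_def by (rule incr(2)[OF st])
    ultimately have "\<bar>h t y - h s y\<bar> \<le> Kc * ?e + Lc * (4 * ?M * ?e) + K2 * ?M * ?e"
      unfolding h_def by linarith
    then show ?thesis by (simp add: Q_def algebra_simps)
  qed
  have near: "\<bar>h s y - h t y\<bar> \<le> Q * \<bar>s - t\<bar> powr \<theta>" if "s \<in> {0..T}" "t \<in> {0..T}" "\<bar>s - t\<bar> < 1" for s t y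
  proof -
    consider "s < t" | "s = t" | "t < s" by linarith
    then show ?thesis
      using near_ordered[of s t y] near_ordered[of t s y] that by cases (auto simp: abs_minus_commute)
  qed
  have holder_t: "\<bar>h s y - h t y\<bar> \<le> (Q + 2 * P) * \<bar>s - t\<bar> powr \<theta>" if "s \<in> {0..T}" "t \<in> {0..T}" for s t y
  proof (cases "\<bar>s - t\<bar> < 1")
    case True
    have "Q * \<bar>s - t\<bar> powr \<theta> \<le> (Q + 2 * P) * \<bar>s - t\<bar> powr \<theta>" using P0 by (intro mult_right_mono) auto
    then show ?thesis using near[OF that True, of y] by linarith
  next
    case False
    then have one: "1 \<le> \<bar>s - t\<bar> powr \<theta>" using \<theta> by (intro ge_one_powr_ge_zero) auto
    have "\<bar>h s y - h t y\<bar> \<le> Q + 2 * P" using hP[OF that(1), of y] hP[OF that(2), of y] Q0 abs_triangle_ineq4[of "h s y" "h t y"] by linarith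
    also have "\<dots> \<le> (Q + 2 * P) * \<bar>s - t\<bar> powr \<theta>"
      using mult_left_mono[OF one, of "Q + 2 * P"] P0 Q0 by simp
    finally show ?thesis .
  qed
  have "Cb_norm (1 + \<theta>) {0..T} (\<lambda>t. u t x) \<le> ennreal (M + P + (Q + 2 * P))"
  proof (rule Cb_norm_interval_le[OF T \<theta>, where h = "\<lambda>t. h t x"])
    show "((\<lambda>t. u t x) has_real_derivative h t x) (at t within {0..T})" if "t \<in> {0..T}" for t
      by (rule integral_C1[OF h_meas hP repr near Q0 \<theta>(1) that])
    show "\<bar>u t x\<bar> \<le> M" if "t \<in> {0..T}" for t by (rule regularD(2)[OF reg[OF that]])
  qed (use hP holder_t P0 Q0 in auto)
  also have "M + P + (Q + 2 * P) \<le> time_const F0 Lc Mc Kc D * (N + 1)"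
  proof -
    define a0 where "a0 = F0 + Mc"
    define a1 where "a1 = K0 + K1 + Lc"
    define b where "b = 4 * Lc + K2"
    have nn: "0 \<le> a0" "0 \<le> a1" "0 \<le> b" "0 \<le> Kc"
      using F0 nonneg K0_nonneg K1_nonneg K2_nonneg by (auto simp: a0_def a1_def b_def)
    have "M + P + (Q + 2 * P) = (3 * a0 + Kc + b * a0) + (1 + 3 * a1 + b * (2 + a1)) * D\<^sup>2 * N"
      unfolding P_def Q_def a0_def[symmetric] a1_def[symmetric] b_def[symmetric] M_def by (simp add: algebra_simps)
    also have "\<dots> \<le> (3 * a0 + Kc + b * a0) * (N + 1) + (1 + 3 * a1 + b * (2 + a1)) * D\<^sup>2 * (N + 1) + 1 * (N + 1)"
    proof -
      have "X + Y * N \<le> X * (N + 1) + Y * (N + 1) + 1 * (N + 1)" if "0 \<le> X" "0 \<le> Y" for X Y :: real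
        using that N mult_nonneg_nonneg[of X N] by (simp add: algebra_simps)
      then show ?thesis using nn by simp
    qed
    also have "\<dots> = time_const F0 Lc Mc Kc D * (N + 1)"
      unfolding time_const_def a0_def a1_def b_def by (simp only: distrib_right)
    finally show ?thesis .
  qed
  finally show ?thesis unfolding \<theta>_def F0_def D_def by (simp add: ennreal_leI)
qed

lemma time_const_pos:
  assumes "0 \<le> F0" "0 \<le> Lc" "0 \<le> Mc" "0 \<le> Kc"
  shows "0 < time_const F0 Lc Mc Kc D"
proof -
  have "0 \<le> 3 * (F0 + Mc) + Kc + (4 * Lc + K2) * (F0 + Mc)
     + (1 + 3 * (K0 + K1 + Lc) + (4 * Lc + K2) * (2 + (K0 + K1 + Lc))) * D\<^sup>2"
    using assms K0_nonneg K1_nonneg K2_nonneg by (intro add_nonneg_nonneg mult_nonneg_nonneg) auto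
  then show ?thesis unfolding time_const_def by linarith
qed

end

section \<open>The regularity theorem\<close>

text \<open>
  For each value \<open>m\<close> of the supremum of the gradient, choose the constants of \<open>H\<close> for the ball of radius
  \<open>|m| + 1\<close>; they do not depend on the solution. If the supremum of the \<open>C\<^sub>b\<^sup>\<gamma>\<close> norms is infinite, so is the right-hand side.
\<close>

theorem theorem5p10:
  fixes T \<alpha> \<beta> :: real
    and H :: "real \<Rightarrow> real^'d \<Rightarrow> real^'d \<Rightarrow> real"
    and A :: "real^'d^'d"
    and \<mu> :: "(real^'d) measure"
    and L :: "(real^'d \<Rightarrow> real) \<Rightarrow> real^'d \<Rightarrow> real"
    and p :: "real \<Rightarrow> real^'d \<Rightarrow> real"
  assumes T: "T > 0" and beta: "\<beta> \<in> {0<..<1}"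
    and levy: "levy_operator A \<mu> L"
    and kernel: "heat_kernel A \<mu> p"
    and kernel_smooth: "\<forall>t>0. p t \<in> Cb_infinity"
    and alpha: "\<alpha> \<in> {1<..2}"
    and kernel_grad: "\<exists>c0>0. \<forall>t\<in>{0<..T}.
      (\<integral>\<^sup>+ y. ennreal (norm (grad (p t) y)) \<partial>lborel) \<le> ennreal (c0 * t powr (- 1 / \<alpha>))"
    and alpha_beta: "\<alpha> + \<beta> \<in> {1<..<2} \<union> {2<..<3}"
    and A: "A = 0"
    and mu: "\<exists>c>0. \<forall>r\<in>{0<..<1}.
      (\<alpha> + \<beta> \<in> {1<..<2} \<longrightarrow>
         ennreal (r powr (- \<beta>)) * (\<integral>\<^sup>+ y\<in>ball 0 r. ennreal (norm y powr (\<alpha> + \<beta>)) \<partial>\<mu>)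
         + ennreal (r powr (\<alpha> - 1)) * (\<integral>\<^sup>+ y\<in>ball 0 1 - ball 0 r. ennreal (norm y) \<partial>\<mu>)
         \<le> ennreal c) \<and>
      (\<alpha> + \<beta> \<in> {2<..<3} \<longrightarrow>
         ennreal (r powr (\<alpha> - 2)) * (\<integral>\<^sup>+ y\<in>ball 0 r. ennreal ((norm y)\<^sup>2) \<partial>\<mu>)
         + ennreal (r powr (1 - \<beta>)) *
             (\<integral>\<^sup>+ y\<in>ball 0 1 - ball 0 r. ennreal (norm y powr (\<alpha> + \<beta> - 1)) \<partial>\<mu>)
         \<le> ennreal c)"
    and H_cont: "continuous_on ({0..T} \<times> UNIV \<times> UNIV) (\<lambda>(t, x, q). H t x q)"
    and H_zero: "\<exists>H0>0. \<forall>t\<in>{0<..<T}. \<forall>x. \<bar>H t x 0\<bar> \<le> H0"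
    and H_lip: "\<forall>R>0. \<exists>LR>0. \<forall>t\<in>{0<..<T}. \<forall>x. \<forall>q\<in>ball 0 R. \<forall>q'\<in>ball 0 R.
      \<bar>H t x q - H t x q'\<bar> \<le> LR * norm (q - q')"
    and H_space: "\<forall>R>0. \<exists>MR>0. \<forall>t\<in>{0..T}. \<forall>q\<in>ball 0 R. \<forall>x x'. norm (x - x') < 1 \<longrightarrow>
      \<bar>H t x q - H t x' q\<bar> \<le> MR * norm (x - x') powr \<beta>"
    and H_time: "\<forall>R>0. \<exists>KR>0. \<forall>t1\<in>{0..T}. \<forall>t2\<in>{0..T}. \<bar>t2 - t1\<bar> < 1 \<longrightarrow>
      (\<forall>x. \<forall>q\<in>ball 0 R. \<bar>H t2 x q - H t1 x q\<bar> \<le> KR * \<bar>t2 - t1\<bar> powr (\<beta> / \<alpha>))"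
  shows "\<exists>C :: real \<Rightarrow> real. (\<forall>m. C m > 0) \<and>
    (\<forall>u0 u. u0 \<in> Cb (\<alpha> + \<beta>) UNIV \<longrightarrow> u \<in> Cb_Cb1 T \<longrightarrow> mild_solution T p H u0 u \<longrightarrow>
      (SUP x. Cb_norm (1 + \<beta> / \<alpha>) {0..T} (\<lambda>t. u t x))
        \<le> ennreal (C (grad_sup T u)) * ((SUP t\<in>{0..T}. Cb_norm (\<alpha> + \<beta>) UNIV (u t)) + 1))"
proof -
  obtain c where c: "c > 0" and mu_c: "\<forall>r\<in>{0<..<1}.
      (\<alpha> + \<beta> \<in> {1<..<2} \<longrightarrow>
         ennreal (r powr (- \<beta>)) * (\<integral>\<^sup>+ y\<in>ball 0 r. ennreal (norm y powr (\<alpha> + \<beta>)) \<partial>\<mu>)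
         + ennreal (r powr (\<alpha> - 1)) * (\<integral>\<^sup>+ y\<in>ball 0 1 - ball 0 r. ennreal (norm y) \<partial>\<mu>)
         \<le> ennreal c) \<and>
      (\<alpha> + \<beta> \<in> {2<..<3} \<longrightarrow>
         ennreal (r powr (\<alpha> - 2)) * (\<integral>\<^sup>+ y\<in>ball 0 r. ennreal ((norm y)\<^sup>2) \<partial>\<mu>)
         + ennreal (r powr (1 - \<beta>)) *
             (\<integral>\<^sup>+ y\<in>ball 0 1 - ball 0 r. ennreal (norm y powr (\<alpha> + \<beta> - 1)) \<partial>\<mu>)
         \<le> ennreal c)"
    using mu by blast
  have range: "1 < \<alpha>" "\<alpha> \<le> 2" "0 < \<beta>" "\<beta> < 1" "\<alpha> + \<beta> \<noteq> 2" using alpha beta alpha_beta by auto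
  interpret levy \<mu> using levy by unfold_locales (simp add: levy_operator_def)
  interpret levy_order \<mu> \<alpha> \<beta> c
  proof
    fix r :: real assume r: "0 < r" "r < 1"
    show "ennreal (r powr (- \<beta>)) * (\<integral>\<^sup>+ y\<in>ball 0 r. ennreal (norm y powr (\<alpha> + \<beta>)) \<partial>\<mu>)
         + ennreal (r powr (\<alpha> - 1)) * (\<integral>\<^sup>+ y\<in>ball 0 1 - ball 0 r. ennreal (norm y) \<partial>\<mu>) \<le> ennreal c" if "\<alpha> + \<beta> < 2"
      using mu_c[rule_format, of r] r that range by simp
    show "ennreal (r powr (\<alpha> - 2)) * (\<integral>\<^sup>+ y\<in>ball 0 r. ennreal ((norm y)\<^sup>2) \<partial>\<mu>)
         + ennreal (r powr (1 - \<beta>)) * (\<integral>\<^sup>+ y\<in>ball 0 1 - ball 0 r. ennreal (norm y powr (\<alpha> + \<beta> - 1)) \<partial>\<mu>) \<le> ennreal c" if "2 < \<alpha> + \<beta>"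
      using mu_c[rule_format, of r] r that range by simp
  qed (use range c in auto)
  obtain H0 where H0: "H0 > 0" "\<forall>t\<in>{0<..<T}. \<forall>x. \<bar>H t x 0\<bar> \<le> H0" using H_zero by blast
  have "\<exists>C>0. \<forall>u0 u. u0 \<in> Cb (\<alpha> + \<beta>) UNIV \<longrightarrow> u \<in> Cb_Cb1 T \<longrightarrow> mild_solution T p H u0 u \<longrightarrow> grad_sup T u = m \<longrightarrow>
      (SUP x. Cb_norm (1 + \<beta> / \<alpha>) {0..T} (\<lambda>t. u t x))
        \<le> ennreal C * ((SUP t\<in>{0..T}. Cb_norm (\<alpha> + \<beta>) UNIV (u t)) + 1)" for m
  proof -
    define R where "R = \<bar>m\<bar> + 1"
    have R: "R > 0" "m < R" by (auto simp: R_def)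
    obtain Lc where Lc: "Lc > 0" "\<forall>t\<in>{0<..<T}. \<forall>x. \<forall>q\<in>ball 0 R. \<forall>q'\<in>ball 0 R. \<bar>H t x q - H t x q'\<bar> \<le> Lc * norm (q - q')"
      using H_lip[rule_format, OF R(1)] by blast
    obtain Mc where Mc: "Mc > 0" "\<forall>t\<in>{0..T}. \<forall>q\<in>ball 0 R. \<forall>x x'. norm (x - x') < 1 \<longrightarrow> \<bar>H t x q - H t x' q\<bar> \<le> Mc * norm (x - x') powr \<beta>"
      using H_space[rule_format, OF R(1)] by blast
    obtain Kc where Kc: "Kc > 0" "\<forall>t1\<in>{0..T}. \<forall>t2\<in>{0..T}. \<bar>t2 - t1\<bar> < 1 \<longrightarrow>
      (\<forall>x. \<forall>q\<in>ball 0 R. \<bar>H t2 x q - H t1 x q\<bar> \<le> Kc * \<bar>t2 - t1\<bar> powr (\<beta> / \<alpha>))"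
      using H_time[rule_format, OF R(1)] by blast
    define C where "C = time_const (H0 + Lc * R) Lc Mc Kc (real CARD('d))"
    have C: "C > 0" unfolding C_def using H0 Lc Mc Kc R by (intro time_const_pos) auto
    have "(SUP x. Cb_norm (1 + \<beta> / \<alpha>) {0..T} (\<lambda>t. u t x)) \<le> ennreal C * ((SUP t\<in>{0..T}. Cb_norm (\<alpha> + \<beta>) UNIV (u t)) + 1)"
      if u: "u \<in> Cb_Cb1 T" and mild: "mild_solution T p H u0 u" and m: "grad_sup T u = m" for u0 u
    proof (cases "(SUP t\<in>{0..T}. Cb_norm (\<alpha> + \<beta>) UNIV (u t)) = \<infinity>")
      case True
      show ?thesis unfolding True using C by (simp add: ennreal_mult_top)
    next
      case False
      define N where "N = enn2real (SUP t\<in>{0..T}. Cb_norm (\<alpha> + \<beta>) UNIV (u t))"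
      have N: "0 \<le> N" "(SUP t\<in>{0..T}. Cb_norm (\<alpha> + \<beta>) UNIV (u t)) = ennreal N"
        unfolding N_def ennreal_enn2real_if using False by (simp_all only: infinity_ennreal_def if_False enn2real_nonneg)
      have uN: "Cb_norm (\<alpha> + \<beta>) UNIV (u t) \<le> ennreal N" if "t \<in> {0..T}" for t
        unfolding N(2)[symmetric] using that by (rule SUP_upper)
      have grad_le: "norm (grad (u t) x) \<le> m" if t: "t \<in> {0<..T}" for t x
      proof -
        have "norm (grad (u s) y) \<le> (real CARD('d))\<^sup>2 * N" if "s \<in> {0<..T}" for s y
          using regularD(3)[OF Cb_norm_regular[OF uN N(1) alpha_beta]] that by auto
        then have "bdd_above ((\<lambda>(t, x). norm (grad (u t) x)) ` ({0<..T} \<times> UNIV))"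
          by (intro bdd_aboveI[of _ "(real CARD('d))\<^sup>2 * N"]) auto
        from cSUP_upper[OF _ this, of "(t, x)"] show ?thesis using t m by (simp add: grad_sup_def)
      qed
      have "Cb_norm (1 + \<beta> / \<alpha>) {0..T} (\<lambda>t. u t x) \<le> ennreal (C * (N + 1))" for x
        unfolding C_def
      proof (rule mild_solution_Holder_in_time[OF T _ H_cont _ _ R(2) _ _ _ _ _ _ _ _ mild N(1) uN grad_le])
        show "heat_kernel 0 \<mu> p" using kernel unfolding A .
        show "u \<in> C_Cb1 T" using u by (simp add: Cb_Cb1_def)
      qed (use H0 Lc Mc Kc R in \<open>auto simp: mem_ball\<close>)
      then have "(SUP x. Cb_norm (1 + \<beta> / \<alpha>) {0..T} (\<lambda>t. u t x)) \<le> ennreal (C * (N + 1))" by (rule SUP_least)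
      also have "\<dots> = ennreal C * (ennreal N + 1)" using C N(1) by (simp add: ennreal_mult)
      finally show ?thesis unfolding N(2) .
    qed
    then show ?thesis using C by blast
  qed
  then obtain C where "\<forall>m. C m > 0 \<and> (\<forall>u0 u. u0 \<in> Cb (\<alpha> + \<beta>) UNIV \<longrightarrow> u \<in> Cb_Cb1 T \<longrightarrow> mild_solution T p H u0 u \<longrightarrow> grad_sup T u = m \<longrightarrow>
      (SUP x. Cb_norm (1 + \<beta> / \<alpha>) {0..T} (\<lambda>t. u t x))
        \<le> ennreal (C m) * ((SUP t\<in>{0..T}. Cb_norm (\<alpha> + \<beta>) UNIV (u t)) + 1))"
    by metis
  then show ?thesis by blast
qed

end
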